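(* Let $\alpha$ be a ribbon, let $m<\ell(\alpha)$, and let $x=se$ or $x=nw$. Suppose that $$D=(\varepsilon^k_m(\alpha),\mathcal N)_x\qquad\text{and}\qquad D'=(\varepsilon^k_m(\alpha),\mathcal N^{*})_x .$$ Then $D\sim D'$.
   Context: Partitions are identified with Ferrers diagrams in English notation (row 1 on top); a skew diagram $D=\lambda/\mu$ is the set of cells of $\lambda$ not in $\mu\subseteq\lambda$, considered up to translation and insertion/removal of empty rows or columns. $s_D=\sum_Tx^T$ over column-strict fillings of $D$ (rows weakly increasing, columns strictly increasing downward) is the skew Schur function; $D_1\sim D_2$ means $s_{D_1}=s_{D_2}$. $D$ is connected if it is not a disjoint union $D_1\oplus D_2$ (two proper subdiagrams, $D_2$ north and east of $D_1$, sharing no row or column). A ribbon is a connected nonempty skew diagram with no $2\times2$ block of cells; a composition $\alpha=(\alpha_1,\dots,\alpha_k)$ is identified with the ribbon with $\alpha_i$ cells in the $i$-th row from the bottom, and $\ell(\alpha)=k$ is its number of rows. The diagonal of cell $(i,j)$ is $j-i$. A nonempty ribbon $\omega$ protrudes from the top (resp. bottom) of a skew diagram $D$ if the restriction of $D$ to its $|\omega|$ northeasternmost (resp. southwesternmost) diagonals is $\omega$ and its restriction to its $|\omega|+1$ northeasternmost (resp. southwesternmost) diagonals is also a ribbon. If $\omega$ protrudes from the top of $D_1$ and the bottom of $D_2$, $D_1\amalg_\omega D_2$ is obtained by translating and identifying the copy of $\omega$ in the northeast of $D_1$ with the one in the southwest of $D_2$. For ribbons $\alpha=(\alpha_1,\dots,\alpha_k)$,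 $\beta=(\beta_1,\dots,\beta_\ell)$ and $m\ge1$, the $m$-intersection $\alpha\cap_m\beta$ exists if there is a ribbon $\omega=(\omega_1,\dots,\omega_m)$ with $m$ rows protruding from the top of $\alpha$ and the bottom of $\beta$ with $\omega_1=\beta_1$ and $\omega_m=\alpha_k$ (when $m=1$, instead $\omega_1:=\min\{\alpha_k,\beta_1\}$). Then $\alpha\cap_m\beta:=\omega$ and the $m$-union is $\alpha\cup_m\beta:=\alpha\amalg_\omega\beta$. The $m$-intersection is trivial if it equals $\alpha$ or $\beta$. If $\alpha\cap_m\alpha$ exists and is nontrivial, $\varepsilon^k_m(\alpha):=\alpha\cup_m\alpha\cup_m\cdots\cup_m\alpha$ ($k$ factors). The southeast decomposition of a connected skew diagram $D$: the first ribbon $\theta$ starts at the cell on the lower left, traverses the southeast border of $D$, and ends at the cell on the upper right; remove $\theta$ and iterate on each connected component of what remains. The northwest decomposition is defined in the same way with the northwest border. $D$ has a southeast ribbon staircase decomposition if there are a ribbon $\alpha$ and $m<\ell(\alpha)$ such that every ribbon in its southeast decomposition is of the form $\alpha\cap_m\alpha$ or $\varepsilon^p_m(\alpha)$ for various $p\ge1$. Let $k$ be the maximum $p$ occurring, so the largest ribbon is $\theta=\varepsilon^k_m(\alpha)$; number its $k$ copies of $\alpha$ by $1,\dots,k$ from southwest to northeast. The nesting $\mathcal N$ is the word of length $k-1$ in the letters dot, left parenthesis, right parenthesis, vertical slash determined by the remaining ribbons of the decomposition (those other than $\theta$): a ribbon of the form $\varepsilon^p_m(\alpha)$ occupying the same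 diagonals as the copies of $\alpha$ in $\theta$ numbered $i+1,\dots,j$ creates a left parenthesis in position $i$ and a right parenthesis in position $j$; a ribbon of the form $\alpha\cap_m\alpha$ occupying the same diagonals as the intersection of copies $i$ and $i+1$ creates a vertical slash in position $i$; all other letters are dots. One then writes $D=(\varepsilon^k_m(\alpha),\mathcal N)_{se}$. The notation $D=(\varepsilon^k_m(\alpha),\mathcal N)_{nw}$ is defined analogously with the northwest decomposition. The reverse nesting $\mathcal N^{*}$ is $\mathcal N$ read in reverse (mirror image, so that left and right parentheses are interchanged; e.g. $()\,.\,(|)$ becomes $(|)\,.\,()$).
   Formalization: Every ribbon of the decomposition other than θ is required to create a letter of the nesting (occupy the diagonals of copies i+1,…,j or of an intersection of neighbouring copies); otherwise α=(2,1), m=1 gives the 2×2 square and α the same empty nesting. *)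

theory Defs
  imports "HOL-Library.Multiset" "HOL-Library.FuncSet"
begin

section \<open>Skew diagrams and skew Schur functions\<close>

text \<open>
  A cell is a pair (row, column); rows are numbered downwards (English notation).
  Diagrams are concrete finite sets of cells, and the convention that they are considered up to
  translation is made explicit by the relation \<open>same_shape\<close>.  Empty rows and columns need
  no separate treatment: every diagram with empty rows or columns inserted is again a translate of
  some \<open>\<lambda>/\<mu>\<close>, and whenever two diagrams are compared below, they are connected, so that they
  have no empty rows or columns between their cells.
\<close>

type_synonym cell = "int \<times> int"
type_synonym diagram = "cell set"

definition translate :: "cell \<Rightarrow> diagram \<Rightarrow> diagram" where
  "translate v D = (\<lambda>(i, j). (i + fst v, j + snd v)) ` D"

definition same_shape :: "diagram \<Rightarrow> diagram \<Rightarrow> bool"  (infix "\<simeq>" 50) where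
  "D \<simeq> E \<longleftrightarrow> (\<exists>v. E = translate v D)"

definition is_partition :: "(nat \<Rightarrow> nat) \<Rightarrow> bool" where
  "is_partition p \<longleftrightarrow> antimono p \<and> finite {i. p i \<noteq> 0}"

definition ferrers :: "(nat \<Rightarrow> nat) \<Rightarrow> diagram" where
  "ferrers p = {(int i, int j) | i j. j < p i}"

definition skew_diagram :: "diagram \<Rightarrow> bool" where
  "skew_diagram D \<longleftrightarrow>
     (\<exists>p q v. is_partition p \<and> is_partition q \<and> ferrers q \<subseteq> ferrers p \<and>
        D = translate v (ferrers p - ferrers q))"

definition column_strict_fillings :: "diagram \<Rightarrow> (cell \<Rightarrow> nat) set" where
  "column_strict_fillings D =
     {T \<in> extensional D.
        (\<forall>i j j'. (i, j) \<in> D \<and> (i, j') \<in> D \<and> j \<le> j' \<longrightarrow> T (i, j) \<le> T (i, j')) \<and>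
        (\<forall>i i' j. (i, j) \<in> D \<and> (i', j) \<in> D \<and> i < i' \<longrightarrow> T (i, j) < T (i', j))}"

text \<open>
  The formal power series \<open>\<Sum>\<^sub>T x\<^sup>T\<close> in the variables \<open>x\<^sub>0, x\<^sub>1, x\<^sub>2, \<dots>\<close> is given by its coefficient
  function.  A monomial is a finite multiset of variable indices; \<open>x\<^sup>T\<close> is the multiset of
  entries of \<open>T\<close>.
\<close>

definition skew_schur :: "diagram \<Rightarrow> nat multiset \<Rightarrow> nat" where
  "skew_schur D M = card {T \<in> column_strict_fillings D. image_mset T (mset_set D) = M}"

definition schur_equivalent :: "diagram \<Rightarrow> diagram \<Rightarrow> bool"  (infix "\<sim>" 50) where
  "D\<^sub>1 \<sim> D\<^sub>2 \<longleftrightarrow> skew_schur D\<^sub>1 = skew_schur D\<^sub>2"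


section \<open>Connectedness and ribbons\<close>

definition is_direct_sum :: "diagram \<Rightarrow> diagram \<Rightarrow> diagram \<Rightarrow> bool" where
  "is_direct_sum D D\<^sub>1 D\<^sub>2 \<longleftrightarrow>
     D = D\<^sub>1 \<union> D\<^sub>2 \<and> D\<^sub>1 \<noteq> {} \<and> D\<^sub>2 \<noteq> {} \<and>
     (\<forall>(i\<^sub>1, j\<^sub>1) \<in> D\<^sub>1. \<forall>(i\<^sub>2, j\<^sub>2) \<in> D\<^sub>2. i\<^sub>2 < i\<^sub>1 \<and> j\<^sub>1 < j\<^sub>2)"

definition connected_diagram :: "diagram \<Rightarrow> bool" where
  "connected_diagram D \<longleftrightarrow> (\<nexists>D\<^sub>1 D\<^sub>2. is_direct_sum D D\<^sub>1 D\<^sub>2)"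

definition components :: "diagram \<Rightarrow> diagram set" where
  "components D =
     {C. C \<noteq> {} \<and> C \<subseteq> D \<and> connected_diagram C \<and>
         (\<forall>C'. C \<subseteq> C' \<and> C' \<subseteq> D \<and> connected_diagram C' \<longrightarrow> C' = C)}"

definition ribbon :: "diagram \<Rightarrow> bool" where
  "ribbon D \<longleftrightarrow>
     skew_diagram D \<and> connected_diagram D \<and> D \<noteq> {} \<and>
     (\<nexists>i j. {(i, j), (i, j + 1), (i + 1, j), (i + 1, j + 1)} \<subseteq> D)"

text \<open>
  A ribbon \<open>\<alpha>\<close> corresponds to the composition \<open>(\<alpha>\<^sub>1, \<dots>, \<alpha>\<^sub>k)\<close> with \<open>k = num_rows \<alpha>\<close> and
  \<open>\<alpha>\<^sub>i = part \<alpha> i\<close>, the number of cells in the \<open>i\<close>-th row from the bottom, for \<open>1 \<le> i \<le> k\<close>.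
\<close>

definition num_rows :: "diagram \<Rightarrow> nat" where
  "num_rows D = card (fst ` D)"

definition part :: "diagram \<Rightarrow> nat \<Rightarrow> nat" where
  "part D i = card {c \<in> D. fst c = Max (fst ` D) - (int i - 1)}"


section \<open>Protrusion, amalgamation and m-unions\<close>

definition diag :: "cell \<Rightarrow> int" where
  "diag c = snd c - fst c"

text \<open>
  The restrictions of \<open>D\<close> to its \<open>n\<close> northeasternmost, resp. southwesternmost, nonempty diagonals
  (to all of \<open>D\<close>, if it has fewer than \<open>n\<close> of them).
\<close>

definition ne_part :: "nat \<Rightarrow> diagram \<Rightarrow> diagram" where
  "ne_part n D = {c \<in> D. card {d \<in> diag ` D. diag c < d} < n}"

definition sw_part :: "nat \<Rightarrow> diagram \<Rightarrow> diagram" where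
  "sw_part n D = {c \<in> D. card {d \<in> diag ` D. d < diag c} < n}"

definition protrudes_top :: "diagram \<Rightarrow> diagram \<Rightarrow> bool" where
  "protrudes_top \<omega> D \<longleftrightarrow>
     ribbon \<omega> \<and> ne_part (card \<omega>) D \<simeq> \<omega> \<and> ribbon (ne_part (card \<omega> + 1) D)"

definition protrudes_bottom :: "diagram \<Rightarrow> diagram \<Rightarrow> bool" where
  "protrudes_bottom \<omega> D \<longleftrightarrow>
     ribbon \<omega> \<and> sw_part (card \<omega>) D \<simeq> \<omega> \<and> ribbon (sw_part (card \<omega> + 1) D)"

text \<open>Meaningful if \<open>\<omega>\<close> protrudes from the top of \<open>D\<^sub>1\<close> and from the bottom of \<open>D\<^sub>2\<close>.\<close>

definition amalgamate :: "diagram \<Rightarrow> diagram \<Rightarrow> diagram \<Rightarrow> diagram" where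
  "amalgamate \<omega> D\<^sub>1 D\<^sub>2 =
     D\<^sub>1 \<union> translate (THE v. translate v (sw_part (card \<omega>) D\<^sub>2) = ne_part (card \<omega>) D\<^sub>1) D\<^sub>2"

definition is_m_intersection :: "nat \<Rightarrow> diagram \<Rightarrow> diagram \<Rightarrow> diagram \<Rightarrow> bool" where
  "is_m_intersection m \<alpha> \<beta> \<omega> \<longleftrightarrow>
     ribbon \<omega> \<and> num_rows \<omega> = m \<and> protrudes_top \<omega> \<alpha> \<and> protrudes_bottom \<omega> \<beta> \<and>
     (if m = 1 then part \<omega> 1 = min (part \<alpha> (num_rows \<alpha>)) (part \<beta> 1)
      else part \<omega> 1 = part \<beta> 1 \<and> part \<omega> m = part \<alpha> (num_rows \<alpha>))"

text \<open>The m-intersection is determined by \<open>m, \<alpha>, \<beta>\<close> up to translation only.\<close>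

definition m_intersection :: "nat \<Rightarrow> diagram \<Rightarrow> diagram \<Rightarrow> diagram" where
  "m_intersection m \<alpha> \<beta> = (SOME \<omega>. is_m_intersection m \<alpha> \<beta> \<omega>)"

definition m_union :: "nat \<Rightarrow> diagram \<Rightarrow> diagram \<Rightarrow> diagram" where
  "m_union m \<alpha> \<beta> = amalgamate (m_intersection m \<alpha> \<beta>) \<alpha> \<beta>"

definition nontrivial_self_intersection :: "nat \<Rightarrow> diagram \<Rightarrow> bool" where
  "nontrivial_self_intersection m \<alpha> \<longleftrightarrow>
     (\<exists>\<omega>. is_m_intersection m \<alpha> \<alpha> \<omega>) \<and> \<not> m_intersection m \<alpha> \<alpha> \<simeq> \<alpha>"

text \<open>
  \<open>eps m \<alpha> k\<close> is \<open>\<alpha> \<union>\<^sub>m \<dots> \<union>\<^sub>m \<alpha>\<close> with \<open>k \<ge> 1\<close> factors; the value at \<open>k = 0\<close> is a dummy.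
\<close>

fun eps :: "nat \<Rightarrow> diagram \<Rightarrow> nat \<Rightarrow> diagram" where
  "eps m \<alpha> 0 = {}"
| "eps m \<alpha> (Suc 0) = \<alpha>"
| "eps m \<alpha> (Suc (Suc k)) = m_union m (eps m \<alpha> (Suc k)) \<alpha>"


section \<open>Southeast and northwest decompositions\<close>

datatype side = SE | NW

text \<open>
  The southeast border of a connected skew diagram consists of the cells without a neighbour
  diagonally below to the right; these form the ribbon from the lower left cell to the upper right
  cell along the southeast boundary.  Similarly for the northwest border.
\<close>

fun border :: "side \<Rightarrow> diagram \<Rightarrow> diagram" where
  "border SE D = {(i, j) \<in> D. (i + 1, j + 1) \<notin> D}"
| "border NW D = {(i, j) \<in> D. (i - 1, j - 1) \<notin> D}"

inductive decomposition_ribbon :: "side \<Rightarrow> diagram \<Rightarrow> diagram \<Rightarrow> bool" for x where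
  first: "D \<noteq> {} \<Longrightarrow> connected_diagram D \<Longrightarrow> decomposition_ribbon x D (border x D)"
| iterate: "connected_diagram D \<Longrightarrow> C \<in> components (D - border x D) \<Longrightarrow>
    decomposition_ribbon x C \<rho> \<Longrightarrow> decomposition_ribbon x D \<rho>"

definition decomposition :: "side \<Rightarrow> diagram \<Rightarrow> diagram set" where
  "decomposition x D = {\<rho>. decomposition_ribbon x D \<rho>}"


section \<open>Ribbon staircases and their nestings\<close>

definition ribbon_staircase_decomposition :: "side \<Rightarrow> diagram \<Rightarrow> nat \<Rightarrow> diagram \<Rightarrow> bool" where
  "ribbon_staircase_decomposition x \<alpha> m D \<longleftrightarrow>
     skew_diagram D \<and> connected_diagram D \<and>
     ribbon \<alpha> \<and> 1 \<le> m \<and> m < num_rows \<alpha> \<and> nontrivial_self_intersection m \<alpha> \<and>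
     (\<forall>\<rho> \<in> decomposition x D. \<rho> \<simeq> m_intersection m \<alpha> \<alpha> \<or> (\<exists>p \<ge> 1. \<rho> \<simeq> eps m \<alpha> p))"

text \<open>
  For \<open>\<theta> \<simeq> eps m \<alpha> k\<close> and \<open>1 \<le> i \<le> k\<close>, the \<open>i\<close>-th copy of \<open>\<alpha>\<close> in \<open>\<theta>\<close>, counted from the
  southwest: the first \<open>i\<close> copies make up the southwestern \<open>eps m \<alpha> i\<close> inside \<open>\<theta>\<close>, and
  the \<open>i\<close>-th one is its northeastern end.
\<close>

definition ribbon_copy :: "nat \<Rightarrow> diagram \<Rightarrow> diagram \<Rightarrow> nat \<Rightarrow> diagram" where
  "ribbon_copy m \<alpha> \<theta> i = ne_part (card \<alpha>) (sw_part (card (eps m \<alpha> i)) \<theta>)"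

definition spans_copies :: "nat \<Rightarrow> diagram \<Rightarrow> diagram \<Rightarrow> diagram \<Rightarrow> nat \<Rightarrow> nat \<Rightarrow> bool" where
  "spans_copies m \<alpha> \<theta> \<rho> i j \<longleftrightarrow>
     (\<exists>p \<ge> 1. \<rho> \<simeq> eps m \<alpha> p) \<and> diag ` \<rho> = diag ` (\<Union>l \<in> {i + 1..j}. ribbon_copy m \<alpha> \<theta> l)"

definition spans_intersection :: "nat \<Rightarrow> diagram \<Rightarrow> diagram \<Rightarrow> diagram \<Rightarrow> nat \<Rightarrow> bool" where
  "spans_intersection m \<alpha> \<theta> \<rho> i \<longleftrightarrow>
     \<rho> \<simeq> m_intersection m \<alpha> \<alpha> \<and>
     diag ` \<rho> = diag ` (ribbon_copy m \<alpha> \<theta> i \<inter> ribbon_copy m \<alpha> \<theta> (i + 1))"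

datatype letter = Dot | LParen | RParen | Slash

fun creates_letter :: "nat \<Rightarrow> diagram \<Rightarrow> nat \<Rightarrow> diagram \<Rightarrow> diagram \<Rightarrow> nat \<Rightarrow> letter \<Rightarrow> bool" where
  "creates_letter m \<alpha> k \<theta> \<rho> i LParen \<longleftrightarrow> (\<exists>j. i < j \<and> j < k \<and> spans_copies m \<alpha> \<theta> \<rho> i j)"
| "creates_letter m \<alpha> k \<theta> \<rho> j RParen \<longleftrightarrow> (\<exists>i. 1 \<le> i \<and> i < j \<and> spans_copies m \<alpha> \<theta> \<rho> i j)"
| "creates_letter m \<alpha> k \<theta> \<rho> i Slash \<longleftrightarrow> spans_intersection m \<alpha> \<theta> \<rho> i"
| "creates_letter m \<alpha> k \<theta> \<rho> i Dot \<longleftrightarrow> False"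

text \<open>
  \<open>is_staircase x \<alpha> m k \<N> D\<close> is the notation \<open>D = (\<epsilon>\<^sup>k\<^sub>m(\<alpha>), \<N>)\<^sub>x\<close>.  The positions
  \<open>1, \<dots>, k - 1\<close> of the word \<open>\<N>\<close> are the list indices \<open>0, \<dots>, k - 2\<close>.  The letters describe \<open>D\<close>
  only if every ribbon other than \<open>\<theta>\<close> creates one, so this is required.  It does not follow from the
  shapes of the ribbons: the \<open>2 \<times> 2\<close> square consists of a ribbon \<open>\<alpha> = (2, 1)\<close> and a single
  cell, which has the shape of \<open>\<alpha> \<inter>\<^sub>1 \<alpha>\<close>, but no nesting of length \<open>0\<close> records that cell.
\<close>

definition is_staircase :: "side \<Rightarrow> diagram \<Rightarrow> nat \<Rightarrow> nat \<Rightarrow> letter list \<Rightarrow> diagram \<Rightarrow> bool" where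
  "is_staircase x \<alpha> m k \<N> D \<longleftrightarrow>
     ribbon_staircase_decomposition x \<alpha> m D \<and>
     (\<exists>\<theta> \<in> decomposition x D.
        1 \<le> k \<and> \<theta> \<simeq> eps m \<alpha> k \<and>
        (\<forall>\<rho> \<in> decomposition x D. \<forall>p \<ge> 1. \<rho> \<simeq> eps m \<alpha> p \<longrightarrow> p \<le> k) \<and>
        length \<N> = k - 1 \<and>
        (\<forall>\<rho> \<in> decomposition x D - {\<theta>}. \<exists>i \<in> {1..<k}. \<exists>L. creates_letter m \<alpha> k \<theta> \<rho> i L) \<and>
        (\<forall>i \<in> {1..<k}. \<forall>L. L \<noteq> Dot \<longrightarrow>
           (\<N> ! (i - 1) = L \<longleftrightarrow>
             (\<exists>\<rho> \<in> decomposition x D - {\<theta>}. creates_letter m \<alpha> k \<theta> \<rho> i L))))"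

fun mirror_letter :: "letter \<Rightarrow> letter" where
  "mirror_letter LParen = RParen"
| "mirror_letter RParen = LParen"
| "mirror_letter Slash = Slash"
| "mirror_letter Dot = Dot"

definition reverse_nesting :: "letter list \<Rightarrow> letter list" where
  "reverse_nesting \<N> = map mirror_letter (rev \<N>)"

end

(* By the Lindstroem-Gessel-Viennot lemma a skew Schur function is a determinant: the ribbons of the
   decomposition become lattice paths on the common cutting strip given by the border of D, column-strict
   fillings of D become nonintersecting families of paths, and the entry of the determinant for a start
   p and an end q counts the fillings of the piece of the strip between p and q.  In a ribbon staircase
   the strip is periodic, every start is the beginning of a copy of alpha and every end is the end of a
   copy, so an entry depends only on the difference of the two copy numbers.  Reversing the nesting
   reflects the set of starts onto the set of ends and vice versa, which transposes the matrix up to a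
   permutation of its rows.  Hence the two determinants agree up to sign, and they agree because both
   have nonnegative coefficients.  How starts are matched with ends therefore never matters.  The
   northwest case is the southeast case rotated by a half turn. *)

theory Submission
  imports Defs "HOL-Combinatorics.Permutations" "HOL-Library.Product_Plus"
begin

section \<open>Lattice paths and the Lindstroem--Gessel--Viennot cancellation\<close>

text \<open>The decomposition enters only through two sets of diagonals: those where some ribbon
  begins and those where some ribbon ends. They are where the number of cells on a diagonal rises or
  falls, a description that treats both sides alike and forgets the pairing. With \<open>w\<close>
  the size of the self-intersection and \<open>d\<close> the displacement of consecutive copies,
  ribbons begin at \<open>P + d * i\<close> and end at \<open>P + w - 1 + d * j\<close>; a slash
  contributes the same number to both lists. The reflection sends a path from \<open>a\<close> to
  \<open>b\<close> to one from \<open>\<kappa> - b\<close> to \<open>\<kappa> - a\<close>. It does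
  so by the translation by \<open>\<kappa> - a - b\<close>, a multiple of \<open>d\<close> apart
  from the change of base point, and never by reversing the path, so no symmetry of the ribbon is
  involved. The price is that the paths of one family move by different amounts, which may destroy
  nonintersection. The two diagrams are therefore compared through the full signed sums, before any
  cancellation.\<close>

definition lattice_path :: "(int \<Rightarrow> bool) \<Rightarrow> int \<Rightarrow> int \<Rightarrow> (int \<Rightarrow> int) \<Rightarrow> bool" where
  "lattice_path s p q T \<longleftrightarrow>
     p \<le> q \<and> (\<forall>c. if p \<le> c \<and> c \<le> q then 0 \<le> T c else T c = -1) \<and>
     (\<forall>c. p \<le> c \<and> c < q \<longrightarrow> (if s c then T c \<le> T (c + 1) else T (c + 1) < T c))"

text \<open>At a north step a path descends, so the height \<open>k\<close> is negated there: the points of a path are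
  traversed in the lexicographic order of \<open>(c, k)\<close>.\<close>

definition passes :: "(int \<Rightarrow> bool) \<Rightarrow> (int \<Rightarrow> int) \<Rightarrow> int \<Rightarrow> int \<Rightarrow> bool" where
  "passes s T c k \<longleftrightarrow>
     (if s c then 0 \<le> k \<and> T c \<le> k \<and> k \<le> T (c + 1) else k \<le> 0 \<and> T (c + 1) < - k \<and> - k \<le> T c)"

definition splice :: "int \<Rightarrow> (int \<Rightarrow> int) \<Rightarrow> (int \<Rightarrow> int) \<Rightarrow> int \<Rightarrow> int" where
  "splice c T U = (\<lambda>x. if x \<le> c then T x else U x)"

text \<open>The value -1 off the interval lies below every entry. A start after an east step and an
  end before a north step then behave in \<open>passes\<close> like ordinary steps from and to -1,
  without separate cases for end points.\<close>

lemma lattice_path_nonneg_iff: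
  assumes "lattice_path s p q T"
  shows "0 \<le> T c \<longleftrightarrow> p \<le> c \<and> c \<le> q"
proof -
  have "if p \<le> c \<and> c \<le> q then 0 \<le> T c else T c = -1"
    using assms unfolding lattice_path_def by blast
  then show ?thesis by (auto split: if_splits)
qed

lemma lattice_path_outside: "lattice_path s p q T \<Longrightarrow> \<not> (p \<le> c \<and> c \<le> q) \<Longrightarrow> T c = -1"
  by (auto simp: lattice_path_def)

lemma lattice_path_ge: "lattice_path s p q T \<Longrightarrow> - 1 \<le> T c"
  using lattice_path_nonneg_iff[of s p q T c] lattice_path_outside[of s p q T c] by force

lemma lattice_path_step:
  "lattice_path s p q T \<Longrightarrow> p \<le> c \<Longrightarrow> c < q \<Longrightarrow> if s c then T c \<le> T (c + 1) else T (c + 1) < T c"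
  by (auto simp: lattice_path_def)

text \<open>The shared point lies between the last value of the head and the first value of the
  tail, and the weak or strict bounds in \<open>passes\<close> are those of a step of kind
  \<open>s c\<close>, so the joint is a legal step. The point may also lie just before the first
  entry of a path or just after its last one.\<close>

lemma lattice_path_splice:
  assumes T: "lattice_path s p q T" and U: "lattice_path s p' q' U"
    and passes: "passes s T c k" "passes s U c k"
  shows "lattice_path s p q' (splice c T U)"
proof -
  have range: "p \<le> c + 1" "p' \<le> c + 1" "c \<le> q" "c \<le> q'" "p \<le> q'"
    and at_c: "if s c then T c \<le> U (c + 1) else U (c + 1) < T c"
    using passes lattice_path_nonneg_iff[OF T, of "c + 1"] lattice_path_nonneg_iff[OF U, of "c + 1"]
      lattice_path_nonneg_iff[OF T, of c] lattice_path_nonneg_iff[OF U, of c]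
    by (auto simp: passes_def split: if_splits)
  show ?thesis
    unfolding lattice_path_def
  proof (intro conjI allI impI)
    show "p \<le> q'" by (rule range)
    show "if p \<le> x \<and> x \<le> q' then 0 \<le> splice c T U x else splice c T U x = - 1" for x
    proof (cases "x \<le> c")
      case True
      then show ?thesis
        using range lattice_path_nonneg_iff[OF T, of x] lattice_path_outside[OF T, of x]
        by (simp add: splice_def)
    next
      case False
      then show ?thesis
        using range lattice_path_nonneg_iff[OF U, of x] lattice_path_outside[OF U, of x]
        by (simp add: splice_def)
    qed
    show "if s x then splice c T U x \<le> splice c T U (x + 1) else splice c T U (x + 1) < splice c T U x"
      if x: "p \<le> x \<and> x < q'" for x
    proof -
      consider "x < c" | "x = c" | "c < x" by linarith
      then show ?thesis
      proof cases
        case 1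
        then show ?thesis using lattice_path_step[OF T, of x] x range by (simp add: splice_def)
      next
        case 2
        then show ?thesis using at_c by (simp add: splice_def)
      next
        case 3
        then show ?thesis using lattice_path_step[OF U, of x] x range by (simp add: splice_def)
      qed
    qed
  qed
qed

section \<open>Crossings and the exchange of tails\<close>

definition crossing :: "(int \<Rightarrow> bool) \<Rightarrow> int set \<Rightarrow> (int \<Rightarrow> int \<Rightarrow> int) \<Rightarrow> int \<Rightarrow> int \<Rightarrow> bool" where
  "crossing s I F c k \<longleftrightarrow> (\<exists>i\<in>I. \<exists>j\<in>I. i \<noteq> j \<and> passes s (F i) c k \<and> passes s (F j) c k)"

definition nonintersecting :: "(int \<Rightarrow> bool) \<Rightarrow> int set \<Rightarrow> (int \<Rightarrow> int \<Rightarrow> int) \<Rightarrow> bool" where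
  "nonintersecting s I F \<longleftrightarrow> (\<forall>c k. \<not> crossing s I F c k)"

text \<open>The order is the one in which paths traverse their points. Everything up to the first
  crossing thus belongs to the heads, which an exchange of tails keeps.\<close>

definition first_crossing ::
    "(int \<Rightarrow> bool) \<Rightarrow> int set \<Rightarrow> (int \<Rightarrow> int \<Rightarrow> int) \<Rightarrow> int \<Rightarrow> int \<Rightarrow> bool" where
  "first_crossing s I F c k \<longleftrightarrow>
     crossing s I F c k \<and> (\<forall>c' k'. crossing s I F c' k' \<longrightarrow> c < c' \<or> (c = c' \<and> k \<le> k'))"

text \<open>Heads stay with their index, so starts are unchanged and the permutation of the ends is
  composed with the transposition on the right.\<close>

definition swap_tails :: "int \<Rightarrow> int \<Rightarrow> int \<Rightarrow> (int \<Rightarrow> int \<Rightarrow> int) \<Rightarrow> int \<Rightarrow> int \<Rightarrow> int" where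
  "swap_tails c i j F = (\<lambda>l. splice c (F l) (F (Transposition.transpose i j l)))"

definition weight :: "(int \<Rightarrow> int) \<Rightarrow> nat multiset" where
  "weight T = image_mset (\<lambda>c. nat (T c)) (mset_set {c. 0 \<le> T c})"

definition families :: "(int \<Rightarrow> bool) \<Rightarrow> int set \<Rightarrow> (int \<Rightarrow> int) \<Rightarrow> (int \<Rightarrow> int) \<Rightarrow> nat multiset \<Rightarrow>
    (int \<Rightarrow> int \<Rightarrow> int) set" where
  "families s I lo hi M =
     {F. (\<forall>i\<in>I. lattice_path s (lo i) (hi i) (F i)) \<and> (\<forall>i. i \<notin> I \<longrightarrow> F i = (\<lambda>_. -1)) \<and>
         (\<Sum>i\<in>I. weight (F i)) = M}"

lemma first_crossing_unique:
  "first_crossing s I F c k \<Longrightarrow> first_crossing s I F c' k' \<Longrightarrow> c = c' \<and> k = k'"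
  unfolding first_crossing_def by force

text \<open>A passing needs an entry at \<open>c\<close> or \<open>c + 1\<close>, which leaves
  finitely many \<open>c\<close>. For the least of them the heights are bounded too, so both minima
  exist.\<close>

lemma first_crossing_exists:
  assumes fin: "finite I" and paths: "\<And>i. i \<in> I \<Longrightarrow> lattice_path s (lo i) (hi i) (F i)"
    and "crossing s I F c0 k0"
  obtains c k where "first_crossing s I F c k"
proof -
  have c: "\<exists>i\<in>I. c \<in> {lo i - 1..hi i}" if "crossing s I F c k" for c k
  proof -
    obtain i where i: "i \<in> I" "passes s (F i) c k" using \<open>crossing s I F c k\<close> by (auto simp: crossing_def)
    then have "0 \<le> F i c \<or> 0 \<le> F i (c + 1)" by (auto simp: passes_def split: if_splits)
    then show ?thesis
      using i(1) lattice_path_nonneg_iff[OF paths[OF i(1)], of c]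
        lattice_path_nonneg_iff[OF paths[OF i(1)], of "c + 1"]
      by (intro bexI[of _ i]) auto
  qed
  define C where "C = {c. \<exists>k. crossing s I F c k}"
  have "C \<subseteq> (\<Union>i\<in>I. {lo i - 1..hi i})" unfolding C_def using c by auto
  then have "finite C" using fin finite_subset by fastforce
  moreover have "C \<noteq> {}" using assms C_def by auto
  ultimately have MC: "Min C \<in> C" "\<And>c. c \<in> C \<Longrightarrow> Min C \<le> c" by auto
  define K where "K = {k. crossing s I F (Min C) k}"
  have "K \<subseteq> (\<Union>i\<in>I. {- F i (Min C)..F i (Min C + 1)} \<union> {0..F i (Min C + 1)} \<union> {- F i (Min C)..0})"
    unfolding K_def crossing_def passes_def by (auto split: if_splits)
  then have "finite K" by (rule finite_subset) (use fin in auto)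
  moreover have "K \<noteq> {}" using MC C_def K_def by auto
  ultimately have MK: "Min K \<in> K" "\<And>k. k \<in> K \<Longrightarrow> Min K \<le> k" by auto
  have "first_crossing s I F (Min C) (Min K)"
    unfolding first_crossing_def
  proof (intro conjI allI impI)
    show "crossing s I F (Min C) (Min K)" using MK K_def by auto
    fix c' k' assume a: "crossing s I F c' k'"
    then have "Min C \<le> c'" using MC C_def by auto
    then show "Min C < c' \<or> Min C = c' \<and> Min K \<le> k'"
      using a MK(2)[of k'] unfolding K_def mem_Collect_eq by (metis order_le_imp_less_or_eq)
  qed
  then show ?thesis by (rule that)
qed

text \<open>For \<open>c' = c\<close> only the far end of the segment changes, and in both paths
  that end lies at or beyond \<open>k\<close>.\<close>

lemma passes_splice_before:
  assumes "passes s T c k" "passes s U c k" "c' < c \<or> (c' = c \<and> k' \<le> k)"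
  shows "passes s (splice c T U) c' k' = passes s T c' k'"
  using assms by (auto simp: passes_def splice_def split: if_splits)

lemma passes_swap_tails:
  assumes "passes s (F i) c k" "passes s (F j) c k" "c' < c \<or> (c' = c \<and> k' \<le> k)"
  shows "passes s (swap_tails c i j F l) c' k' = passes s (F l) c' k'"
proof (cases "l = i \<or> l = j")
  case True
  then show ?thesis using passes_splice_before[OF _ _ assms(3)] assms(1,2)
    unfolding swap_tails_def by fastforce
next
  case False
  then have "swap_tails c i j F l = F l" by (auto simp: swap_tails_def splice_def)
  then show ?thesis by simp
qed

lemma first_crossing_swap_tails:
  assumes f: "first_crossing s I F c k"
    and ij: "i \<in> I" "j \<in> I" "i \<noteq> j" "passes s (F i) c k" "passes s (F j) c k"
  shows "first_crossing s I (swap_tails c i j F) c k"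
proof -
  have eq: "crossing s I (swap_tails c i j F) c' k' = crossing s I F c' k'"
    if "c' < c \<or> (c' = c \<and> k' \<le> k)" for c' k'
    unfolding crossing_def using passes_swap_tails[of s F i c k j, OF ij(4,5) that] by simp
  show ?thesis
    unfolding first_crossing_def
  proof (intro conjI allI impI)
    show "crossing s I (swap_tails c i j F) c k" using f eq by (simp add: first_crossing_def)
    fix c' k' assume "crossing s I (swap_tails c i j F) c' k'"
    then show "c < c' \<or> c = c' \<and> k \<le> k'"
      using f eq[of c' k'] unfolding first_crossing_def by force
  qed
qed

lemma swap_tails_involution: "swap_tails c i j (swap_tails c i j F) = F"
  by (auto simp: swap_tails_def splice_def fun_eq_iff)

lemma lattice_path_support: "lattice_path s p q T \<Longrightarrow> {c. 0 \<le> T c} = {p..q}"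
  using lattice_path_nonneg_iff by auto

lemma weight_split:
  assumes "finite {c. 0 \<le> T c}"
  shows "weight T = image_mset (\<lambda>x. nat (T x)) (mset_set {x. 0 \<le> T x \<and> x \<le> c}) +
                    image_mset (\<lambda>x. nat (T x)) (mset_set {x. 0 \<le> T x \<and> \<not> x \<le> c})"
proof -
  have "finite {x. 0 \<le> T x \<and> x \<le> c}" "finite {x. 0 \<le> T x \<and> \<not> x \<le> c}"
    using assms by (auto elim: rev_finite_subset)
  then have "mset_set ({x. 0 \<le> T x \<and> x \<le> c} \<union> {x. 0 \<le> T x \<and> \<not> x \<le> c}) =
      mset_set {x. 0 \<le> T x \<and> x \<le> c} + mset_set {x. 0 \<le> T x \<and> \<not> x \<le> c}"
    by (rule mset_set_Union) blast
  moreover have "{x. 0 \<le> T x \<and> x \<le> c} \<union> {x. 0 \<le> T x \<and> \<not> x \<le> c} = {x. 0 \<le> T x}" by blast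
  ultimately show ?thesis
    unfolding weight_def by (simp only: image_mset_union)
qed

text \<open>The contents up to the cut stay in place and those after it are permuted among the
  indices.\<close>

lemma weight_swap_tails:
  assumes fin: "\<And>l. l \<in> I \<Longrightarrow> finite {c. 0 \<le> F l c}" and ij: "i \<in> I" "j \<in> I"
  shows "(\<Sum>l\<in>I. weight (swap_tails c i j F l)) = (\<Sum>l\<in>I. weight (F l))"
proof -
  let ?\<tau> = "Transposition.transpose i j"
  let ?le = "\<lambda>T. image_mset (\<lambda>x. nat (T x :: int)) (mset_set {x. 0 \<le> T x \<and> x \<le> c})"
  let ?gt = "\<lambda>T. image_mset (\<lambda>x. nat (T x :: int)) (mset_set {x. 0 \<le> T x \<and> \<not> x \<le> c})"
  have \<tau>: "?\<tau> permutes I" using ij by (rule permutes_swap_id)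
  have 1: "weight (swap_tails c i j F l) = ?le (F l) + ?gt (F (?\<tau> l))" if l: "l \<in> I" for l
  proof -
    let ?S = "swap_tails c i j F l"
    have "?\<tau> l \<in> I" using l \<tau> permutes_in_image by metis
    then have "finite ({c. 0 \<le> F l c} \<union> {c. 0 \<le> F (?\<tau> l) c})" using fin l by auto
    then have "finite {c. 0 \<le> ?S c}"
      by (rule rev_finite_subset) (auto simp: swap_tails_def splice_def split: if_splits)
    then have "weight ?S = ?le ?S + ?gt ?S" by (rule weight_split)
    moreover have "?le ?S = ?le (F l)"
    proof (rule multiset.map_cong)
      show "mset_set {x. 0 \<le> ?S x \<and> x \<le> c} = mset_set {x. 0 \<le> F l x \<and> x \<le> c}"
        by (intro arg_cong[of _ _ mset_set]) (auto simp: swap_tails_def splice_def)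
      show "nat (?S x) = nat (F l x)" if "x \<in># mset_set {x. 0 \<le> F l x \<and> x \<le> c}" for x
        using that by (cases "finite {x. 0 \<le> F l x \<and> x \<le> c}")
          (auto simp: swap_tails_def splice_def)
    qed
    moreover have "?gt ?S = ?gt (F (?\<tau> l))"
    proof (rule multiset.map_cong)
      show "mset_set {x. 0 \<le> ?S x \<and> \<not> x \<le> c} = mset_set {x. 0 \<le> F (?\<tau> l) x \<and> \<not> x \<le> c}"
        by (intro arg_cong[of _ _ mset_set]) (auto simp: swap_tails_def splice_def)
      show "nat (?S x) = nat (F (?\<tau> l) x)" if "x \<in># mset_set {x. 0 \<le> F (?\<tau> l) x \<and> \<not> x \<le> c}" for x
        using that by (cases "finite {x. 0 \<le> F (?\<tau> l) x \<and> \<not> x \<le> c}")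
          (auto simp: swap_tails_def splice_def)
    qed
    ultimately show ?thesis by simp
  qed
  have "(\<Sum>l\<in>I. weight (swap_tails c i j F l)) = (\<Sum>l\<in>I. ?le (F l)) + (\<Sum>l\<in>I. ?gt (F (?\<tau> l)))"
    using 1 by (simp add: sum.distrib)
  also have "(\<Sum>l\<in>I. ?gt (F (?\<tau> l))) = (\<Sum>l\<in>I. ?gt (F l))"
    using sum.permute[OF \<tau>, of "\<lambda>l. ?gt (F l)"] by (simp add: o_def)
  also have "(\<Sum>l\<in>I. ?le (F l)) + (\<Sum>l\<in>I. ?gt (F l)) = (\<Sum>l\<in>I. weight (F l))"
    using weight_split[OF fin, of _ c] by (simp add: sum.distrib)
  finally show ?thesis .
qed

lemma families_support_finite:
  "F \<in> families s I lo hi M \<Longrightarrow> l \<in> I \<Longrightarrow> finite {c. 0 \<le> F l c}"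
  using lattice_path_support by (fastforce simp: families_def)

text \<open>Positions are confined by the end points, and every entry must occur in
  \<open>M\<close>.\<close>

lemma finite_families:
  assumes "finite I"
  shows "finite (families s I lo hi M)"
proof -
  let ?V = "insert (-1) (int ` set_mset M)" and ?C = "\<Union>i\<in>I. {lo i..hi i}"
  let ?P = "{f. \<forall>x. (x \<in> ?C \<longrightarrow> f x \<in> ?V) \<and> (x \<notin> ?C \<longrightarrow> f x = -1)}"
  have "finite ?P" by (rule finite_set_of_finite_funs) (use assms in auto)
  then have "finite {F. \<forall>i. (i \<in> I \<longrightarrow> F i \<in> ?P) \<and> (i \<notin> I \<longrightarrow> F i = (\<lambda>_. -1))}"
    by (rule finite_set_of_finite_funs[OF assms])
  moreover have "F i \<in> ?P" if F: "F \<in> families s I lo hi M" and i: "i \<in> I" for F i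
  proof -
    have path: "lattice_path s (lo i) (hi i) (F i)" using F i by (auto simp: families_def)
    have "F i x = -1" if "x \<notin> ?C" for x
      using lattice_path_outside[OF path, of x] that i by auto
    moreover have "F i x \<in> ?V" for x
    proof (cases "0 \<le> F i x")
      case True
      then have "nat (F i x) \<in># weight (F i)"
        using families_support_finite[OF F i] by (auto simp: weight_def)
      then have "nat (F i x) \<in># (\<Sum>i\<in>I. weight (F i))"
        using i assms by (subst sum.remove[OF assms i]) simp
      then show ?thesis using F True by (auto simp: families_def intro!: image_eqI[of _ _ "nat (F i x)"])
    next
      case False
      then show ?thesis using lattice_path_ge[OF path, of x] by simp
    qed
    ultimately show ?thesis by blast
  qed
  then have "families s I lo hi M \<subseteq> {F. \<forall>i. (i \<in> I \<longrightarrow> F i \<in> ?P) \<and> (i \<notin> I \<longrightarrow> F i = (\<lambda>_. -1))}"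
    unfolding families_def by blast
  ultimately show ?thesis by (rule finite_subset[rotated])
qed

text \<open>The coefficient of the monomial \<open>M\<close> in the determinant whose entry at
  \<open>(i, j)\<close> is the generating function of the paths from \<open>lo i\<close> to
  \<open>hi j\<close>. Expanding the determinant and fixing \<open>M\<close> replaces power series
  by finite cardinalities.\<close>

definition signed_count ::
    "(int \<Rightarrow> bool) \<Rightarrow> int set \<Rightarrow> (int \<Rightarrow> int) \<Rightarrow> (int \<Rightarrow> int) \<Rightarrow> nat multiset \<Rightarrow> int" where
  "signed_count s I lo hi M =
     (\<Sum>\<pi> | \<pi> permutes I. sign \<pi> * int (card (families s I lo (hi \<circ> \<pi>) M)))"

section \<open>The sign-reversing involution\<close>

lemma families_swap_tails:
  assumes F: "F \<in> families s I lo (hi \<circ> \<pi>) M"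
    and ij: "i \<in> I" "j \<in> I" "passes s (F i) c k" "passes s (F j) c k"
  shows "swap_tails c i j F \<in> families s I lo (hi \<circ> (\<pi> \<circ> Transposition.transpose i j)) M"
proof -
  let ?\<tau> = "Transposition.transpose i j"
  have path: "lattice_path s (lo l) (hi (\<pi> l)) (F l)" if "l \<in> I" for l
    using F that by (auto simp: families_def)
  have "lattice_path s (lo l) (hi (\<pi> (?\<tau> l))) (swap_tails c i j F l)" if "l \<in> I" for l
  proof (cases "l = i \<or> l = j")
    case True
    then show ?thesis unfolding swap_tails_def
      using lattice_path_splice[OF path path ij(3,4)] lattice_path_splice[OF path path ij(4,3)] ij(1,2)
      by auto
  next
    case False
    then have "swap_tails c i j F l = F l" by (auto simp: swap_tails_def splice_def)
    then show ?thesis using False path[OF that] by simp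
  qed
  moreover have "swap_tails c i j F l = (\<lambda>_. -1)" if "l \<notin> I" for l
  proof -
    have "?\<tau> l = l" using that ij by (auto simp: transpose_def)
    then show ?thesis using F that by (auto simp: swap_tails_def splice_def families_def)
  qed
  moreover have "(\<Sum>l\<in>I. weight (swap_tails c i j F l)) = M"
    using weight_swap_tails[OF families_support_finite[OF F] ij(1,2)] F
    by (auto simp: families_def)
  ultimately show ?thesis unfolding families_def by simp
qed

text \<open>Exchanging two tails at the first crossing keeps both that crossing and the set of paths
  through it, so a second exchange undoes the first, and the transposition flips the sign. Which
  permutations survive is settled later, in \<open>nonintersecting_runs\<close>.\<close>

theorem lindstroem_gessel_viennot:
  assumes fin: "finite I"
  shows "signed_count s I lo hi M =
    (\<Sum>\<pi> | \<pi> permutes I. sign \<pi> * int (card {F \<in> families s I lo (hi \<circ> \<pi>) M. nonintersecting s I F}))"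
proof -
  let ?P = "{\<pi>. \<pi> permutes I}"
  let ?fam = "\<lambda>\<pi>. families s I lo (hi \<circ> \<pi>) M"
  define bad where "bad \<pi> = {F \<in> ?fam \<pi>. \<not> nonintersecting s I F}" for \<pi>
  define X where "X = Sigma ?P bad"
  have finP: "finite ?P" by (rule finite_permutations[OF fin])
  have finbad: "finite (bad \<pi>)" for \<pi> using finite_families[OF fin] by (auto simp: bad_def)
  have "card (?fam \<pi>) = card {F \<in> ?fam \<pi>. nonintersecting s I F} + card (bad \<pi>)" for \<pi>
    unfolding bad_def by (subst card_Un_disjoint[symmetric])
      (auto simp: finite_families[OF fin] intro: arg_cong[of _ _ card])
  then have "signed_count s I lo hi M =
    (\<Sum>\<pi>\<in>?P. sign \<pi> * int (card {F \<in> ?fam \<pi>. nonintersecting s I F})) +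
    (\<Sum>\<pi>\<in>?P. sign \<pi> * int (card (bad \<pi>)))"
    by (simp add: signed_count_def sum.distrib[symmetric] algebra_simps)
  also have "(\<Sum>\<pi>\<in>?P. sign \<pi> * int (card (bad \<pi>))) = (\<Sum>(\<pi>, F)\<in>X. sign \<pi>)"
    unfolding X_def by (subst sum.Sigma[symmetric]) (auto simp: finP finbad mult.commute)
  also have "(\<Sum>(\<pi>, F)\<in>X. sign \<pi>) = 0"
  proof -
    define pt where "pt F = (SOME p. first_crossing s I F (fst p) (snd p))" for F
    define on where "on F = {i \<in> I. passes s (F i) (fst (pt F)) (snd (pt F))}" for F
    \<comment> \<open>More than two paths may share the first crossing. Taking the two least indices
      makes the choice a function of the set \<open>on F\<close>, which the exchange
      preserves.\<close>
    define i1 where "i1 F = Min (on F)" for F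
    define i2 where "i2 F = Min (on F - {i1 F})" for F
    define \<phi> where "\<phi> = (\<lambda>(\<pi> :: int \<Rightarrow> int, F).
      (\<pi> \<circ> Transposition.transpose (i1 F) (i2 F), swap_tails (fst (pt F)) (i1 F) (i2 F) F))"
    have main: "\<phi> (\<pi>, F) \<in> X \<and> \<phi> (\<phi> (\<pi>, F)) = (\<pi>, F) \<and> sign (fst (\<phi> (\<pi>, F))) = - sign \<pi>"
      if "(\<pi>, F) \<in> X" for \<pi> F
    proof -
      have \<pi>: "\<pi> permutes I" and F: "F \<in> ?fam \<pi>" and ni: "\<not> nonintersecting s I F"
        using that by (auto simp: X_def bad_def)
      obtain c k where "first_crossing s I F c k"
        using ni first_crossing_exists[OF fin, of s lo "hi \<circ> \<pi>" F] F
        unfolding nonintersecting_def families_def by blast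
      then have "first_crossing s I F (fst (c, k)) (snd (c, k))" by simp
      then have pt: "first_crossing s I F (fst (pt F)) (snd (pt F))" unfolding pt_def by (rule someI)
      then obtain i j where ij: "i \<in> on F" "j \<in> on F" "i \<noteq> j"
        unfolding first_crossing_def crossing_def on_def by blast
      have finon: "finite (on F)" using fin by (simp add: on_def)
      have i1: "i1 F \<in> on F" unfolding i1_def using ij finon by (intro Min_in) auto
      have "on F - {i1 F} \<noteq> {}" using ij by blast
      then have i2: "i2 F \<in> on F - {i1 F}" unfolding i2_def using finon by (intro Min_in) auto
      let ?F = "swap_tails (fst (pt F)) (i1 F) (i2 F) F"
      let ?\<tau> = "Transposition.transpose (i1 F) (i2 F)"
      have pass: "passes s (F (i1 F)) (fst (pt F)) (snd (pt F))" "passes s (F (i2 F)) (fst (pt F)) (snd (pt F))"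
        and mem: "i1 F \<in> I" "i2 F \<in> I" "i1 F \<noteq> i2 F"
        using i1 i2 by (auto simp: on_def)
      have fc: "first_crossing s I ?F (fst (pt F)) (snd (pt F))"
        using first_crossing_swap_tails[OF pt mem pass] .
      have "first_crossing s I ?F (fst (pt ?F)) (snd (pt ?F))"
        unfolding pt_def[of ?F] using fc by (rule someI)
      then have pteq: "pt ?F = pt F"
        using first_crossing_unique[OF fc] by (metis prod.collapse)
      have oneq: "on ?F = on F" unfolding on_def pteq
        using passes_swap_tails[of s F "i1 F" "fst (pt F)" "snd (pt F)" "i2 F", OF pass] by auto
      have i1eq: "i1 ?F = i1 F"
        by (rule trans[OF trans[OF i1_def[of ?F] arg_cong[OF oneq, of Min]] i1_def[symmetric]])
      have i2eq: "i2 ?F = i2 F"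
        by (rule trans[OF trans[OF i2_def[of ?F] arg_cong[OF arg_cong2[OF oneq i1eq, of "\<lambda>A a. A - {a}"], of Min]] i2_def[symmetric]])
      have \<tau>: "?\<tau> permutes I" by (rule permutes_swap_id[OF mem(1,2)])
      have "(\<pi> \<circ> ?\<tau>) permutes I" by (rule permutes_compose[OF \<tau> \<pi>])
      moreover have "?F \<in> ?fam (\<pi> \<circ> ?\<tau>)" by (rule families_swap_tails[OF F mem(1,2) pass])
      moreover have "\<not> nonintersecting s I ?F"
        using fc unfolding nonintersecting_def first_crossing_def by blast
      ultimately have "\<phi> (\<pi>, F) \<in> X" by (simp add: X_def bad_def \<phi>_def)
      moreover have "\<phi> (\<phi> (\<pi>, F)) = (\<pi>, F)"
        unfolding \<phi>_def prod.case i1eq i2eq pteq swap_tails_involution by (simp add: comp_assoc)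
      moreover have "sign (\<pi> \<circ> ?\<tau>) = - sign \<pi>"
        using sign_compose[OF permutes_imp_permutation[OF fin \<pi>] permutes_imp_permutation[OF fin \<tau>]]
          mem(3) by (simp add: sign_swap_id)
      ultimately show ?thesis by (simp add: \<phi>_def)
    qed
    have "\<phi> p \<in> X \<and> \<phi> (\<phi> p) = p \<and> sign (fst (\<phi> p)) = - sign (fst p)" if "p \<in> X" for p
      using main[of "fst p" "snd p"] that by simp
    then have "(\<Sum>p\<in>X. sign (fst p)) = (\<Sum>p\<in>X. - sign (fst p))"
      by (intro sum.reindex_bij_witness[of X \<phi> \<phi>]) auto
    then show ?thesis by (simp add: split_beta sum_negf)
  qed
  finally show ?thesis by (simp only: add_0_right)
qed

section \<open>Transposition\<close>

lemma lattice_path_translate: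
  assumes "lattice_path s p q T" "\<And>c. p \<le> c \<Longrightarrow> c < q \<Longrightarrow> s' (c + v) = s c"
  shows "lattice_path s' (p + v) (q + v) (\<lambda>c. T (c - v))"
proof -
  have "(if s' c then T (c - v) \<le> T (c + 1 - v) else T (c + 1 - v) < T (c - v))"
    if "p + v \<le> c" "c < q + v" for c
  proof -
    have "c - v + 1 = c + 1 - v" by simp
    then show ?thesis
      using lattice_path_step[OF assms(1), of "c - v"] assms(2)[of "c - v"] that by (smt (verit))
  qed
  then show ?thesis using assms(1) unfolding lattice_path_def by auto
qed

lemma weight_translate: "weight (\<lambda>c. T (c - v)) = weight T"
proof -
  have "{c. 0 \<le> T (c - v)} = (\<lambda>c. c + v) ` {c. 0 \<le> T c}"
    by (auto intro!: image_eqI[of _ _ "_ - v"])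
  then have "mset_set {c. 0 \<le> T (c - v)} = image_mset (\<lambda>c. c + v) (mset_set {c. 0 \<le> T c})"
    by (simp add: image_mset_mset_set)
  then show ?thesis unfolding weight_def by (simp add: image_mset.compositionality o_def)
qed

text \<open>Only contents are recorded and not positions, so each path may be moved by its own
  amount \<open>v i\<close>. The paths of a family then change their relative position, which is
  harmless here because crossings are not excluded.\<close>

lemma card_families_le:
  assumes fin: "finite I'" and \<beta>: "bij_betw \<beta> I I'"
    and lo: "\<And>i. i \<in> I \<Longrightarrow> lo' (\<beta> i) = lo i + v i" and hi: "\<And>i. i \<in> I \<Longrightarrow> hi' (\<beta> i) = hi i + v i"
    and s: "\<And>i c. i \<in> I \<Longrightarrow> lo i \<le> c \<Longrightarrow> c < hi i \<Longrightarrow> s' (c + v i) = s c"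
  shows "card (families s I lo hi M) \<le> card (families s' I' lo' hi' M)"
proof -
  define \<gamma> where "\<gamma> = inv_into I \<beta>"
  have \<gamma>: "\<gamma> j \<in> I" "\<beta> (\<gamma> j) = j" if "j \<in> I'" for j
    using that \<beta> unfolding \<gamma>_def bij_betw_def by (auto intro: inv_into_into f_inv_into_f)
  have \<gamma>\<beta>: "\<gamma> (\<beta> i) = i" "\<beta> i \<in> I'" if "i \<in> I" for i
    using that \<beta> unfolding \<gamma>_def bij_betw_def by auto
  define \<Phi> where "\<Phi> F = (\<lambda>j. if j \<in> I' then (\<lambda>c. F (\<gamma> j) (c - v (\<gamma> j))) else (\<lambda>_. -1))"
    for F :: "int \<Rightarrow> int \<Rightarrow> int"
  show ?thesis
  proof (rule card_inj_on_le)
    show "finite (families s' I' lo' hi' M)" by (rule finite_families[OF fin])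
    show "inj_on \<Phi> (families s I lo hi M)"
    proof (rule inj_onI)
      fix F G assume F: "F \<in> families s I lo hi M" and G: "G \<in> families s I lo hi M" and eq: "\<Phi> F = \<Phi> G"
      have "F i c = G i c" if i: "i \<in> I" for i c
        using fun_cong[OF fun_cong[OF eq, of "\<beta> i"], of "c + v i"] \<gamma>\<beta>[OF i] by (simp add: \<Phi>_def)
      moreover have "F i c = G i c" if "i \<notin> I" for i c using F G that by (simp add: families_def)
      ultimately show "F = G" by blast
    qed
    show "\<Phi> ` families s I lo hi M \<subseteq> families s' I' lo' hi' M"
    proof safe
      fix F assume F: "F \<in> families s I lo hi M"
      have "lattice_path s' (lo' j) (hi' j) (\<Phi> F j)" if j: "j \<in> I'" for j
      proof -
        have "lattice_path s (lo (\<gamma> j)) (hi (\<gamma> j)) (F (\<gamma> j))" using F \<gamma>[OF j] by (auto simp: families_def)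
        from lattice_path_translate[OF this, of s' "v (\<gamma> j)"] show ?thesis
          using lo[OF \<gamma>(1)[OF j]] hi[OF \<gamma>(1)[OF j]] s[OF \<gamma>(1)[OF j]] \<gamma>[OF j] j by (simp add: \<Phi>_def)
      qed
      moreover have "(\<Sum>j\<in>I'. weight (\<Phi> F j)) = M"
      proof -
        have "(\<Sum>j\<in>I'. weight (\<Phi> F j)) = (\<Sum>j\<in>I'. weight (F (\<gamma> j)))"
          by (rule sum.cong) (auto simp: \<Phi>_def weight_translate)
        also have "\<dots> = (\<Sum>i\<in>I. weight (F i))"
          by (rule sum.reindex_bij_witness[of _ \<beta> \<gamma>]) (auto simp: \<gamma> \<gamma>\<beta>)
        finally show ?thesis using F by (simp add: families_def)
      qed
      ultimately show "\<Phi> F \<in> families s' I' lo' hi' M" by (simp add: families_def \<Phi>_def)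
    qed
  qed
qed

lemma card_families_eq:
  assumes fin: "finite I" and \<beta>: "bij_betw \<beta> I I'"
    and lo: "\<And>i. i \<in> I \<Longrightarrow> lo' (\<beta> i) = lo i + v i" and hi: "\<And>i. i \<in> I \<Longrightarrow> hi' (\<beta> i) = hi i + v i"
    and s: "\<And>i c. i \<in> I \<Longrightarrow> lo i \<le> c \<Longrightarrow> c < hi i \<Longrightarrow> s' (c + v i) = s c"
  shows "card (families s I lo hi M) = card (families s' I' lo' hi' M)"
proof (rule antisym)
  have fin': "finite I'" using fin \<beta> bij_betw_finite by blast
  show "card (families s I lo hi M) \<le> card (families s' I' lo' hi' M)"
    using card_families_le[OF fin' \<beta>, of lo' lo v hi' hi s' s M] lo hi s by blast
  define \<gamma> where "\<gamma> = inv_into I \<beta>"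
  have \<gamma>: "\<gamma> j \<in> I" "\<beta> (\<gamma> j) = j" if "j \<in> I'" for j
    using that \<beta> unfolding \<gamma>_def bij_betw_def by (auto intro: inv_into_into f_inv_into_f)
  have bij: "bij_betw \<gamma> I' I" unfolding \<gamma>_def by (rule bij_betw_inv_into[OF \<beta>])
  show "card (families s' I' lo' hi' M) \<le> card (families s I lo hi M)"
  proof (rule card_families_le[OF fin bij, where v = "\<lambda>j. - v (\<gamma> j)"])
    fix j assume j: "j \<in> I'"
    show "lo (\<gamma> j) = lo' j + - v (\<gamma> j)" using lo[OF \<gamma>(1)[OF j]] \<gamma>(2)[OF j] by simp
    show "hi (\<gamma> j) = hi' j + - v (\<gamma> j)" using hi[OF \<gamma>(1)[OF j]] \<gamma>(2)[OF j] by simp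
    fix c assume "lo' j \<le> c" "c < hi' j"
    then show "s (c + - v (\<gamma> j)) = s' c"
      using s[OF \<gamma>(1)[OF j], of "c - v (\<gamma> j)"] lo[OF \<gamma>(1)[OF j]] hi[OF \<gamma>(1)[OF j]] \<gamma>(2)[OF j] by simp
  qed
qed

text \<open>Reflecting the endpoints turns the matrix of path counts into its transpose, up to a
  permutation of its rows.\<close>

lemma signed_count_reflect:
  fixes A B :: "int set"
  assumes fin: "finite A" and q: "bij_betw q A B"
    and q': "bij_betw q' A ((\<lambda>x. \<kappa> - x) ` A)"
    and s: "\<And>a b c. a \<in> A \<Longrightarrow> b \<in> B \<Longrightarrow> a \<le> c \<Longrightarrow> c < b \<Longrightarrow> s' (c + (\<kappa> - a - b)) = s c"
  shows "\<bar>signed_count s A id q M\<bar> = \<bar>signed_count s' A (\<lambda>a. \<kappa> - q a) q' M\<bar>"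
proof -
  let ?lo = "\<lambda>a. \<kappa> - q a"
  \<comment> \<open>The map \<open>q'\<close> lists the reflected starts in an order of its own. The
    permutation \<open>\<zeta>\<close> records this order, and its sign is all that remains of the
    matching.\<close>
  define \<zeta> where "\<zeta> a = (if a \<in> A then \<kappa> - q' a else a)" for a
  have "bij_betw (\<lambda>a. \<kappa> - q' a) A A"
  proof -
    have "bij_betw (\<lambda>x. \<kappa> - x) ((\<lambda>x. \<kappa> - x) ` A) A"
      by (rule bij_betw_byWitness[where f' = "\<lambda>x. \<kappa> - x"]) auto
    from bij_betw_trans[OF q' this] show ?thesis by (simp add: o_def)
  qed
  then have "bij_betw \<zeta> A A" by (rule bij_betw_cong[THEN iffD1, rotated]) (simp add: \<zeta>_def)
  then have \<zeta>: "\<zeta> permutes A" by (rule bij_imp_permutes) (simp add: \<zeta>_def)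
  \<comment> \<open>The path from \<open>a\<close> to \<open>q (\<pi> a)\<close>, moved by
    \<open>\<kappa> - a - q (\<pi> a)\<close>, runs from a reflected end to a reflected start and is
    filed under the index \<open>\<pi> a\<close>. Seen from that index it ends at the reflection of
    \<open>inv \<pi>\<close> of the index, so the permutation is inverted.\<close>
  have fam: "card (families s A id (q \<circ> \<pi>) M) = card (families s' A ?lo ((\<lambda>x. \<kappa> - x) \<circ> inv \<pi>) M)"
    if \<pi>: "\<pi> permutes A" for \<pi>
  proof (rule card_families_eq[OF fin permutes_imp_bij[OF \<pi>], where v = "\<lambda>a. \<kappa> - a - q (\<pi> a)"])
    fix a assume a: "a \<in> A"
    show "((\<lambda>x. \<kappa> - x) \<circ> inv \<pi>) (\<pi> a) = (q \<circ> \<pi>) a + (\<kappa> - a - q (\<pi> a))"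
      using permutes_inverses(2)[OF \<pi>] by simp
    fix c assume "id a \<le> c" "c < (q \<circ> \<pi>) a"
    moreover have "q (\<pi> a) \<in> B" using a \<pi> q permutes_in_image[OF \<pi>] by (auto simp: bij_betw_def)
    ultimately show "s' (c + (\<kappa> - a - q (\<pi> a))) = s c" using s[OF a] by simp
  qed simp
  have q'\<zeta>: "families s' A ?lo ((\<lambda>x. \<kappa> - x) \<circ> (\<zeta> \<circ> \<pi>)) M = families s' A ?lo (q' \<circ> \<pi>) M"
    if \<pi>: "\<pi> permutes A" for \<pi>
  proof -
    have "\<kappa> - \<zeta> (\<pi> i) = q' (\<pi> i)" if "i \<in> A" for i
      using permutes_in_image[OF \<pi>] that by (simp add: \<zeta>_def)
    then show ?thesis unfolding families_def by simp
  qed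
  have "signed_count s A id q M =
      (\<Sum>\<pi> | \<pi> permutes A. sign \<pi> * int (card (families s' A ?lo ((\<lambda>x. \<kappa> - x) \<circ> inv \<pi>) M)))"
    unfolding signed_count_def using fam by simp
  also have "\<dots> = (\<Sum>\<pi> | \<pi> permutes A. sign (inv \<pi>) *
      int (card (families s' A ?lo ((\<lambda>x. \<kappa> - x) \<circ> \<pi>) M)))"
    by (subst sum_permutations_inverse) (auto intro!: sum.cong simp: permutes_inv_inv)
  also have "\<dots> = (\<Sum>\<pi> | \<pi> permutes A. sign \<pi> *
      int (card (families s' A ?lo ((\<lambda>x. \<kappa> - x) \<circ> \<pi>) M)))"
    using permutes_imp_permutation[OF fin] by (intro sum.cong) (auto simp: sign_inverse)
  also have "\<dots> = (\<Sum>\<pi> | \<pi> permutes A. sign (\<zeta> \<circ> \<pi>) *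
      int (card (families s' A ?lo ((\<lambda>x. \<kappa> - x) \<circ> (\<zeta> \<circ> \<pi>)) M)))"
    by (rule setum_permutations_compose_left[OF \<zeta>])
  also have "\<dots> = (\<Sum>\<pi> | \<pi> permutes A. sign \<zeta> * (sign \<pi> * int (card (families s' A ?lo (q' \<circ> \<pi>) M))))"
    using q'\<zeta> permutes_imp_permutation[OF fin] \<zeta> by (intro sum.cong) (auto simp: sign_compose)
  also have "\<dots> = sign \<zeta> * signed_count s' A ?lo q' M"
    unfolding signed_count_def by (simp add: sum_distrib_left)
  finally show ?thesis by (simp add: abs_mult)
qed

section \<open>Profiles\<close>

text \<open>An abstraction of a connected shape: \<open>n c\<close> stands for the number of cells
  on diagonal \<open>c\<close>, and \<open>s c\<close> says that the southeast border goes east from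
  there. A diagonal can gain a cell only on an east step and lose one only on a north step.\<close>

locale profile =
  fixes n :: "int \<Rightarrow> nat" and s :: "int \<Rightarrow> bool" and L R :: int
  assumes outside: "c < L \<or> R < c \<Longrightarrow> n c = 0"
    and up_right: "s c \<Longrightarrow> n (c + 1) = n c \<or> n (c + 1) = n c + 1"
    and up_left: "\<not> s c \<Longrightarrow> n c = n (c + 1) \<or> n c = n (c + 1) + 1"
begin

definition run_starts :: "int set" where
  "run_starts = {c. n (c - 1) < n c}"

definition run_ends :: "int set" where
  "run_ends = {c. n (c + 1) < n c}"

text \<open>A run extends from a rise of \<open>n\<close> until \<open>n\<close> first falls below
  the level reached there, so starts and ends pair like brackets.\<close>

definition run_end :: "int \<Rightarrow> int" where
  "run_end a = Min {c \<in> {a..R}. n (c + 1) < n a}"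

definition active :: "int \<Rightarrow> int \<Rightarrow> bool" where
  "active a c \<longleftrightarrow> a \<in> run_starts \<and> a \<le> c \<and> c \<le> run_end a"

text \<open>Together with \<open>end_props\<close> this shows that no end \<open>b\<close> is
  directly followed by a start \<open>b + 1\<close>, since one asks for a north step at
  \<open>b\<close> and the other for an east step. The determinant therefore has no entry for an
  empty path.\<close>

lemma start_props:
  assumes "a \<in> run_starts"
  shows "s (a - 1)" "n a = n (a - 1) + 1" "L \<le> a" "a \<le> R"
proof -
  have lt: "n (a - 1) < n a" using assms by (simp add: run_starts_def)
  then show "L \<le> a" "a \<le> R" using outside[of a] by force+
  show s: "s (a - 1)" using up_left[of "a - 1"] lt by force
  show "n a = n (a - 1) + 1" using up_right[OF s] lt by force
qed

lemma end_props:
  assumes "b \<in> run_ends"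
  shows "\<not> s b" "n b = n (b + 1) + 1" "L \<le> b" "b \<le> R"
proof -
  have lt: "n (b + 1) < n b" using assms by (simp add: run_ends_def)
  then show "L \<le> b" "b \<le> R" using outside[of b] by force+
  show s: "\<not> s b" using up_right[of b] lt by force
  show "n b = n (b + 1) + 1" using up_left[OF s] lt by force
qed

lemma finite_run_starts: "finite run_starts"
  by (rule finite_subset[of _ "{L..R}"]) (auto dest: start_props)

lemma run_end_props:
  assumes a: "a \<in> run_starts"
  shows "a \<le> run_end a" "run_end a \<le> R" "n (run_end a + 1) < n a"
    "\<And>x. a \<le> x \<Longrightarrow> x < run_end a \<Longrightarrow> n a \<le> n (x + 1)"
    "\<And>x. a \<le> x \<Longrightarrow> x \<le> run_end a \<Longrightarrow> n a \<le> n x"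
    "run_end a \<in> run_ends" "n (run_end a) = n a"
proof -
  let ?S = "{c \<in> {a..R}. n (c + 1) < n a}"
  have fin: "finite ?S" by (rule finite_subset[of _ "{a..R}"]) auto
  have "n a > 0" using a by (simp add: run_starts_def)
  then have "R \<in> ?S" using start_props[OF a] outside[of "R + 1"] by simp
  then have "run_end a \<in> ?S" unfolding run_end_def using fin by (intro Min_in) auto
  then show e: "a \<le> run_end a" "run_end a \<le> R" "n (run_end a + 1) < n a" by auto
  show nxt: "n a \<le> n (x + 1)" if x: "a \<le> x" "x < run_end a" for x
  proof (rule ccontr)
    assume "\<not> n a \<le> n (x + 1)"
    then have "x \<in> ?S" using x e by auto
    then have "run_end a \<le> x" unfolding run_end_def using fin by (intro Min_le) auto
    then show False using x by simp
  qed
  show ge: "n a \<le> n x" if x: "a \<le> x" "x \<le> run_end a" for x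
    using nxt[of "x - 1"] x by (cases "x = a") auto
  have "n a \<le> n (run_end a)" using ge e by simp
  then show "run_end a \<in> run_ends" using e by (simp add: run_ends_def)
  then show "n (run_end a) = n a" using end_props(2) e(3) \<open>n a \<le> n (run_end a)\<close> by fastforce
qed

lemma active_le: "active a c \<Longrightarrow> n a \<le> n c"
  using run_end_props(5) by (simp add: active_def)

lemma active_next: "active a c \<Longrightarrow> n a \<le> n (c + 1) \<Longrightarrow> active a (c + 1)"
  using run_end_props(1,3)[of a] by (cases "c = run_end a") (auto simp: active_def)

text \<open>Just before a later start of the same level, \<open>n\<close> is below that level, and
  this would already have ended the earlier run.\<close>

lemma active_inj:
  assumes "active a c" "active a' c" "n a = n a'"
  shows "a = a'"
proof -
  have False if a: "active a c" "active a' c" "n a = n a'" "a < a'" for a a'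
  proof -
    have "n (a' - 1) + 1 = n a'" using a start_props(2)[of a'] by (simp add: active_def)
    moreover have "n a \<le> n (a' - 1)" using a run_end_props(5)[of a "a' - 1"] by (simp add: active_def)
    ultimately show False using a by simp
  qed
  then show ?thesis using assms by (metis linorder_neqE_linordered_idom)
qed

lemma ex_active:
  assumes t: "t < n c"
  shows "\<exists>a. active a c \<and> n a = t + 1"
proof -
  \<comment> \<open>After the maximum of this set, \<open>n\<close> does not return to
    \<open>t\<close> before \<open>c\<close>; that maximum is the start sought.\<close>
  let ?S = "{a \<in> {L..c}. n (a - 1) \<le> t}"
  have fin: "finite ?S" by (rule finite_subset[of _ "{L..c}"]) auto
  have "L \<le> c" using t outside[of c] by force
  then have "L \<in> ?S" using outside[of "L - 1"] by simp
  then have "Max ?S \<in> ?S" using fin by (intro Max_in) auto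
  moreover define a where "a = Max ?S"
  ultimately have a: "L \<le> a" "a \<le> c" "n (a - 1) \<le> t" by auto
  have gt: "t < n x" if x: "a \<le> x" "x \<le> c" for x
  proof (cases "x = c")
    case False
    show ?thesis
    proof (rule ccontr)
      assume "\<not> t < n x"
      then have "x + 1 \<in> ?S" using x a False by auto
      then have "x + 1 \<le> a" unfolding a_def using fin by (intro Max_ge) auto
      then show False using x by simp
    qed
  qed (use t in simp)
  have "t < n a" using gt a by simp
  then have start: "a \<in> run_starts" using a by (simp add: run_starts_def)
  then have na: "n a = t + 1" using start_props(2) \<open>t < n a\<close> a by fastforce
  have "c \<le> run_end a"
  proof (rule ccontr)
    assume "\<not> c \<le> run_end a"
    then have "t < n (run_end a + 1)" using gt run_end_props(1)[OF start] by simp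
    then show False using run_end_props(3)[OF start] na by simp
  qed
  then show ?thesis using start a na by (auto simp: active_def)
qed

lemma inj_run_end: "inj_on run_end run_starts"
  using active_inj run_end_props(1,7) by (intro inj_onI) (metis active_def order_refl)

lemma bij_run_end: "bij_betw run_end run_starts run_ends"
  unfolding bij_betw_def
proof (intro conjI inj_run_end subset_antisym subsetI)
  fix b assume "b \<in> run_end ` run_starts"
  then show "b \<in> run_ends" using run_end_props(6) by auto
next
  fix b assume b: "b \<in> run_ends"
  then have "n (b + 1) < n b" by (simp add: run_ends_def)
  then obtain a where a: "active a b" "n a = n (b + 1) + 1" using ex_active by blast
  then have "\<not> b < run_end a" using run_end_props(4)[of a b] by (auto simp: active_def)
  then have "b = run_end a" using a by (simp add: active_def)
  then show "b \<in> run_end ` run_starts" using a by (auto simp: active_def)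
qed

lemma active_prev: "active a (c + 1) \<Longrightarrow> a \<noteq> c + 1 \<Longrightarrow> active a c"
  by (auto simp: active_def)

lemma active_nonstart: "\<not> s c \<Longrightarrow> active a (c + 1) \<Longrightarrow> active a c"
  using start_props(1)[of a] by (cases "a = c + 1") (auto simp: active_def)

text \<open>Runs behave like a stack: in an order-preserving family only the deepest active run can end,
  so the paths must pair starts with ends exactly as the runs do.\<close>

lemma nonintersecting_runs:
  assumes lo: "bij_betw lo I run_starts" and \<pi>: "\<pi> permutes I"
    and paths: "\<And>i. i \<in> I \<Longrightarrow> lattice_path s (lo i) (run_end (lo (\<pi> i))) (F i)"
    and ni: "nonintersecting s I F"
  shows "\<pi> = id"
    and "\<And>i j c. i \<in> I \<Longrightarrow> j \<in> I \<Longrightarrow> active (lo i) c \<Longrightarrow> active (lo j) c \<Longrightarrow> n (lo i) < n (lo j) \<Longrightarrow>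
      F j c < F i c"
proof -
  define e where "e i = run_end (lo i)" for i
  have start: "lo i \<in> run_starts" if "i \<in> I" for i using lo that by (auto simp: bij_betw_def)
  have \<pi>I: "\<pi> i \<in> I" if "i \<in> I" for i using \<pi> that permutes_in_image by metis
  have e_inj: "i = j" if "i \<in> I" "j \<in> I" "e i = e j" for i j
    using that inj_on_eq_iff[OF inj_run_end start start] lo unfolding e_def bij_betw_def inj_on_def by blast
  have nn: "0 \<le> F i c \<longleftrightarrow> lo i \<le> c \<and> c \<le> e (\<pi> i)" if "i \<in> I" for i c
    using lattice_path_nonneg_iff[OF paths[OF that]] by (simp add: e_def)
  have out: "F i c = -1" if "i \<in> I" "\<not> (lo i \<le> c \<and> c \<le> e (\<pi> i))" for i c
    using lattice_path_outside[OF paths[OF that(1)]] that(2) by (simp add: e_def)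
  have path_step: "if s c then F i c \<le> F i (c + 1) else F i (c + 1) < F i c"
    if "i \<in> I" "lo i \<le> c" "c < e (\<pi> i)" for i c
    using lattice_path_step[OF paths[OF that(1)]] that by (simp add: e_def)
  have cross: False if "i \<in> I" "j \<in> I" "i \<noteq> j" "passes s (F i) c k" "passes s (F j) c k" for i j c k
    using ni that unfolding nonintersecting_def crossing_def by blast
  have le_e: "lo i \<le> e i" "lo i \<le> e (\<pi> i)" if "i \<in> I" for i
    using run_end_props(1)[OF start[OF that]] paths[OF that] by (auto simp: e_def lattice_path_def)
  have e_end: "e i \<in> run_ends" if "i \<in> I" for i
    using run_end_props(6)[OF start[OF that]] by (simp add: e_def)
  \<comment> \<open>\<open>same\<close> says that a path that has started is still under way exactly
    when its run is; \<open>ordered\<close> says that deeper runs carry smaller heights. They are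
    proved together, because an end can be matched only if the lowest path is known to be the
    deepest run.\<close>
  define same where "same c \<longleftrightarrow> (\<forall>i\<in>I. lo i \<le> c \<longrightarrow> (c \<le> e (\<pi> i) \<longleftrightarrow> c \<le> e i))" for c
  define ordered where "ordered c \<longleftrightarrow> (\<forall>i\<in>I. \<forall>j\<in>I. active (lo i) c \<longrightarrow> active (lo j) c \<longrightarrow>
    n (lo i) < n (lo j) \<longrightarrow> F j c < F i c)" for c
  have ind: "same c \<and> ordered c" if "L - 1 \<le> c" for c
    using that
  proof (induction c rule: int_ge_induct)
    case base
    then show ?case using start start_props(3) unfolding same_def ordered_def active_def by force
  next
    case (step c)
    then have same: "same c" and ord: "ordered c" by auto
    have stay: "lo i \<le> c \<and> c \<le> e (\<pi> i)" if "i \<in> I" "active (lo i) c" for i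
      using same that by (auto simp: same_def active_def e_def)
    show ?case
    proof (cases "s c")
      case True
      have ne: "e i \<noteq> c" if "i \<in> I" for i using e_end[OF that] end_props(1) True by blast
      have same': "same (c + 1)" unfolding same_def
      proof safe
        fix i assume i: "i \<in> I" "lo i \<le> c + 1"
        have "c + 1 \<le> e (\<pi> i) \<longleftrightarrow> c + 1 \<le> e i"
        proof (cases "lo i = c + 1")
          case True then show ?thesis using le_e[OF i(1)] by simp
        next
          case False
          then have "lo i \<le> c" using i by simp
          then show ?thesis using same i ne[OF i(1)] ne[OF \<pi>I[OF i(1)]] unfolding same_def by force
        qed
        then show "c + 1 \<le> e (\<pi> i) \<Longrightarrow> c + 1 \<le> e i" "c + 1 \<le> e i \<Longrightarrow> c + 1 \<le> e (\<pi> i)" by auto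
      qed
      have "ordered (c + 1)" unfolding ordered_def
      proof (intro ballI impI)
        fix i j assume ij: "i \<in> I" "j \<in> I" and act: "active (lo i) (c + 1)" "active (lo j) (c + 1)"
          and lt: "n (lo i) < n (lo j)"
        have on: "lo i \<le> c + 1" "c + 1 \<le> e (\<pi> i)" "lo j \<le> c + 1" "c + 1 \<le> e (\<pi> j)"
          using same' ij act unfolding same_def active_def e_def by auto
        have "lo i \<noteq> c + 1" using active_le[OF act(2)] lt by auto
        then have acti: "active (lo i) c" using act active_prev by blast
        then have i1: "F i c \<le> F i (c + 1)" "0 \<le> F i c"
          using path_step[OF ij(1), of c] nn[OF ij(1), of c] on True \<open>lo i \<noteq> c + 1\<close> by auto
        have j1: "F j c \<le> F j (c + 1)" "0 \<le> F j (c + 1)"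
          using path_step[OF ij(2), of c] nn[OF ij(2), of "c + 1"] out[OF ij(2), of c] on True
          by (cases "lo j = c + 1"; force)+
        \<comment> \<open>A path that starts at \<open>c + 1\<close> has the value -1 at
          \<open>c\<close> and is already below path \<open>i\<close> there.\<close>
        have j2: "F j c < F i c"
        proof (cases "lo j = c + 1")
          case True
          then show ?thesis using out[OF ij(2), of c] i1 by simp
        next
          case False
          then show ?thesis using ord ij acti active_prev[OF act(2)] lt unfolding ordered_def by blast
        qed
        show "F j (c + 1) < F i (c + 1)"
        proof (rule ccontr)
          assume "\<not> ?thesis"
          \<comment> \<open>Path \<open>j\<close> would sweep over the height at which path
            \<open>i\<close> arrives in the same step.\<close>
          then have "passes s (F i) c (F i (c + 1))" "passes s (F j) c (F i (c + 1))"
            using i1 j1 j2 True by (auto simp: passes_def)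
          then show False using cross ij lt by blast
        qed
      qed
      then show ?thesis using same' by simp
    next
      case False
      have none: "lo i \<noteq> c + 1" if "i \<in> I" for i
        using start_props(1)[OF start[OF that]] False by auto
      \<comment> \<open>A run \<open>b\<close> that ends at \<open>c\<close> is the deepest active
        one, so its path is the lowest. If another path \<open>b'\<close> ended here instead, it
        would fall from above \<open>F b c\<close> to -1 and meet path \<open>b\<close> at the
        height \<open>F b c\<close>.\<close>
      have match: "e (\<pi> i) = c \<longleftrightarrow> e i = c" if i: "i \<in> I" "lo i \<le> c" for i
      proof (cases "c \<in> run_ends")
        case True
        have img: "run_ends = e ` I"
          using lo bij_run_end unfolding bij_betw_def e_def by (metis image_image)
        then obtain b where b: "b \<in> I" "e b = c" using True unfolding img by auto
        define b' where "b' = inv \<pi> b"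
        have b': "b' \<in> I" "\<pi> b' = b"
          using b permutes_in_image[OF permutes_inv[OF \<pi>], of b] permutes_inverses(1)[OF \<pi>, of b]
          by (auto simp: b'_def)
        have act: "active (lo b) c" using b le_e(1)[OF b(1)] start by (auto simp: active_def e_def)
        have lob': "lo b' \<le> c" using le_e(2)[OF b'(1)] b' b by simp
        then have act': "active (lo b') c"
          using same b b' start unfolding same_def active_def e_def by auto
        have "n c = n (lo b)" using run_end_props(7)[OF start[OF b(1)]] b by (simp add: e_def)
        have "b' = b"
        proof (rule ccontr)
          assume neq: "b' \<noteq> b"
          then have "lo b' \<noteq> lo b" using lo b b' by (auto simp: bij_betw_def inj_on_def)
          then have "n (lo b') < n (lo b)"
            using active_inj[OF act' act] active_le[OF act'] \<open>n c = n (lo b)\<close> by force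
          then have lt: "F b c < F b' c" using ord act act' b b' unfolding ordered_def by blast
          have "lo b \<le> c" "c \<le> e (\<pi> b)" using stay[OF b(1) act] by auto
          moreover have "e (\<pi> b) \<noteq> c"
            using e_inj[OF \<pi>I[OF b(1)] b(1)] b b' neq \<pi> by (metis permutes_inj injD)
          ultimately have "0 \<le> F b c" "F b (c + 1) < F b c"
            using nn[OF b(1), of c] path_step[OF b(1), of c] False by auto
          moreover have "F b' (c + 1) = -1" using out[OF b'(1), of "c + 1"] b b' by auto
          ultimately have "passes s (F b) c (- F b c)" "passes s (F b') c (- F b c)"
            using lt False by (auto simp: passes_def)
          then show False using cross b b' neq by blast
        qed
        then have "e (\<pi> i) = c \<longleftrightarrow> \<pi> i = b" "e i = c \<longleftrightarrow> i = b" "\<pi> b = b"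
          using b b' i e_inj[OF \<pi>I[OF i(1)] b(1)] e_inj[OF i(1) b(1)] by auto
        then show ?thesis using injD[OF permutes_inj[OF \<pi>], of i b] by auto
      next
        case False
        then show ?thesis using e_end i \<pi>I by blast
      qed
      have same': "same (c + 1)" unfolding same_def
      proof safe
        fix i assume i: "i \<in> I" "lo i \<le> c + 1"
        then have "lo i \<le> c" using none by force
        then have "c + 1 \<le> e (\<pi> i) \<longleftrightarrow> c + 1 \<le> e i"
          using match[OF i(1)] same i unfolding same_def by force
        then show "c + 1 \<le> e (\<pi> i) \<Longrightarrow> c + 1 \<le> e i" "c + 1 \<le> e i \<Longrightarrow> c + 1 \<le> e (\<pi> i)" by auto
      qed
      have "ordered (c + 1)" unfolding ordered_def
      proof (intro ballI impI)
        fix i j assume ij: "i \<in> I" "j \<in> I" and act: "active (lo i) (c + 1)" "active (lo j) (c + 1)"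
          and lt: "n (lo i) < n (lo j)"
        have on: "lo i \<le> c" "c + 1 \<le> e (\<pi> i)" "lo j \<le> c" "c + 1 \<le> e (\<pi> j)"
          using same' ij act none[OF ij(1)] none[OF ij(2)] unfolding same_def active_def e_def by force+
        have "F j c < F i c"
          using ord ij active_nonstart[OF False] act lt unfolding ordered_def by blast
        moreover have "F j (c + 1) < F j c" "0 \<le> F j c"
          using path_step[OF ij(2), of c] nn[OF ij(2), of c] on False by auto
        ultimately show "F j (c + 1) < F i (c + 1)"
          using cross[OF ij, of c "- F j c"] lt False by (force simp: passes_def)
      qed
      then show ?thesis using same' by simp
    qed
  qed
  show "\<pi> = id"
  proof
    fix i
    show "\<pi> i = id i"
    proof (cases "i \<in> I")
      case True
      have "c \<le> e (\<pi> i) \<longleftrightarrow> c \<le> e i" if "lo i \<le> c" for c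
        using ind[of c] that True start_props(3)[OF start[OF True]] unfolding same_def by force
      from this[of "e i"] this[of "e (\<pi> i)"] have "e (\<pi> i) = e i"
        using le_e[OF True] by simp
      then show ?thesis using e_inj True \<pi>I by simp
    next
      case False
      then show ?thesis using \<pi> by (simp add: permutes_def)
    qed
  qed
  show "F j c < F i c" if "i \<in> I" "j \<in> I" "active (lo i) c" "active (lo j) c" "n (lo i) < n (lo j)" for i j c
  proof -
    have "L - 1 \<le> c" using that start_props(3) by (force simp: active_def)
    then show ?thesis using ind that unfolding ordered_def by blast
  qed
qed

end

section \<open>The diagonals of a connected skew diagram\<close>

text \<open>Closure under intervals of the componentwise order replaces the pair of partitions
  behind a skew shape, because it visibly passes to inner layers, to components and to half
  turns.\<close>

definition order_convex :: "diagram \<Rightarrow> bool" where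
  "order_convex D \<longleftrightarrow> (\<forall>i j i' j' a b. (i, j) \<in> D \<longrightarrow> (i', j') \<in> D \<longrightarrow>
     i \<le> a \<longrightarrow> a \<le> i' \<longrightarrow> j \<le> b \<longrightarrow> b \<le> j' \<longrightarrow> (a, b) \<in> D)"

definition diag_rows :: "diagram \<Rightarrow> int \<Rightarrow> int set" where
  "diag_rows D c = {i. (i, i + c) \<in> D}"

definition diag_size :: "diagram \<Rightarrow> int \<Rightarrow> nat" where
  "diag_size D c = card (diag_rows D c)"

definition south_row :: "diagram \<Rightarrow> int \<Rightarrow> int" where
  "south_row D c = Max (diag_rows D c)"

text \<open>The values outside the range of diagonals make the border enter from the west and leave to
  the north.  Then the paths in both cases come from and go to \<open>-1\<close>.\<close>

definition east_step :: "diagram \<Rightarrow> int \<Rightarrow> bool" where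
  "east_step D c \<longleftrightarrow> c < Min (diag ` D) \<or> (c < Max (diag ` D) \<and> south_row D (c + 1) = south_row D c)"

definition diag_starts :: "diagram \<Rightarrow> int set" where
  "diag_starts D = {c. diag_size D (c - 1) < diag_size D c}"

definition diag_ends :: "diagram \<Rightarrow> int set" where
  "diag_ends D = {c. diag_size D (c + 1) < diag_size D c}"

lemma order_convexD:
  "order_convex D \<Longrightarrow> (i, j) \<in> D \<Longrightarrow> (i', j') \<in> D \<Longrightarrow> i \<le> a \<Longrightarrow> a \<le> i' \<Longrightarrow> j \<le> b \<Longrightarrow> b \<le> j' \<Longrightarrow> (a, b) \<in> D"
  unfolding order_convex_def by blast

lemma diag_pair [simp]: "diag (i, j) = j - i"
  by (simp add: diag_def)

text \<open>Unless \<open>(i2, j2)\<close> is strictly northeast of \<open>(i1, j1)\<close>, one of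
  the two cells is weakly northwest of the other, and the rectangle between them contains a step
  from diagonal \<open>c\<close> to \<open>c + 1\<close>. So a missing step at \<open>c\<close>
  splits a diagram into a direct sum.\<close>

lemma order_convex_crossing:
  assumes E: "order_convex E" and x: "(i1, j1) \<in> E" "j1 - i1 \<le> c" and y: "(i2, j2) \<in> E" "c < j2 - i2"
    and not: "\<not> (i2 < i1 \<and> j1 < j2)"
  shows "\<exists>i. (i, i + c) \<in> E \<and> ((i, i + c + 1) \<in> E \<or> (i - 1, i + c) \<in> E)"
proof (cases "i1 \<le> i2")
  case True
  have "(i1, i1 + c) \<in> E" "(i1, i1 + c + 1) \<in> E"
    by (rule order_convexD[OF E x(1) y(1)]; use True x y in linarith)+
  then show ?thesis by blast
next
  case False
  then have "j2 \<le> j1" "i2 \<le> i1" using not by auto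
  have "(j2 - c, j2) \<in> E" "(j2 - c - 1, j2) \<in> E"
    by (rule order_convexD[OF E y(1) x(1)]; use \<open>j2 \<le> j1\<close> \<open>i2 \<le> i1\<close> x y in linarith)+
  then have "(j2 - c, (j2 - c) + c) \<in> E" "((j2 - c) - 1, (j2 - c) + c) \<in> E" by auto
  then show ?thesis by blast
qed

locale connected_shape =
  fixes D :: diagram
  assumes finite: "finite D" and convex: "order_convex D" and connected: "connected_diagram D"
    and nonempty: "D \<noteq> {}"
begin

definition L :: int where "L = Min (diag ` D)"
definition R :: int where "R = Max (diag ` D)"
abbreviation "r \<equiv> south_row D"
abbreviation "n \<equiv> diag_size D"

lemma LR: "L \<le> R" "x \<in> D \<Longrightarrow> L \<le> diag x" "x \<in> D \<Longrightarrow> diag x \<le> R" "L \<in> diag ` D" "R \<in> diag ` D"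
proof -
  have fin: "finite (diag ` D)" "diag ` D \<noteq> {}" using finite nonempty by auto
  show "L \<in> diag ` D" "R \<in> diag ` D" using fin unfolding L_def R_def by (auto intro!: Min_in Max_in)
  show "x \<in> D \<Longrightarrow> L \<le> diag x" "x \<in> D \<Longrightarrow> diag x \<le> R" for x
    using fin unfolding L_def R_def by auto
  then show "L \<le> R" using nonempty by fastforce
qed

lemma adjacent_exists:
  assumes c: "L \<le> c" "c < R"
  shows "\<exists>i. (i, i + c) \<in> D \<and> ((i, i + c + 1) \<in> D \<or> (i - 1, i + c) \<in> D)"
proof (rule ccontr)
  assume no: "\<not> ?thesis"
  let ?A = "{x \<in> D. diag x \<le> c}" and ?B = "{x \<in> D. c < diag x}"
  have "?A \<noteq> {}" "?B \<noteq> {}" using LR(4,5) c by fastforce+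
  moreover have "i2 < i1 \<and> j1 < j2" if "(i1, j1) \<in> ?A" "(i2, j2) \<in> ?B" for i1 j1 i2 j2
    using order_convex_crossing[OF convex, of i1 j1 c i2 j2] that no by auto
  moreover have "D = ?A \<union> ?B" by auto
  ultimately have "is_direct_sum D ?A ?B" unfolding is_direct_sum_def by blast
  then show False using connected unfolding connected_diagram_def by blast
qed

lemma diag_image: "diag ` D = {L..R}"
proof (intro subset_antisym subsetI)
  fix c assume "c \<in> diag ` D" then show "c \<in> {L..R}" using LR by auto
next
  fix c assume c: "c \<in> {L..R}"
  show "c \<in> diag ` D"
  proof (cases "c = R")
    case False
    then obtain i where "(i, i + c) \<in> D" using adjacent_exists[of c] c by auto
    then have "diag (i, i + c) \<in> diag ` D" by blast
    then show ?thesis by simp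
  qed (use LR in simp)
qed

lemma finite_rows: "finite (diag_rows D c)"
proof -
  have "(\<lambda>i. (i, i + c)) ` diag_rows D c \<subseteq> D" by (auto simp: diag_rows_def)
  then have "finite ((\<lambda>i. (i, i + c)) ` diag_rows D c)" using finite finite_subset by blast
  then show ?thesis by (rule finite_imageD) (auto simp: inj_on_def)
qed

lemma rows_nonempty_iff: "diag_rows D c \<noteq> {} \<longleftrightarrow> L \<le> c \<and> c \<le> R"
proof -
  have "diag_rows D c \<noteq> {} \<longleftrightarrow> c \<in> diag ` D"
  proof
    assume "diag_rows D c \<noteq> {}"
    then obtain i where "(i, i + c) \<in> D" by (auto simp: diag_rows_def)
    then have "diag (i, i + c) \<in> diag ` D" by blast
    then show "c \<in> diag ` D" by simp
  next
    assume "c \<in> diag ` D"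
    then obtain i j where "(i, j) \<in> D" "c = j - i" by (auto simp: diag_def)
    then have "i \<in> diag_rows D c" by (simp add: diag_rows_def)
    then show "diag_rows D c \<noteq> {}" by blast
  qed
  then show ?thesis using diag_image by simp
qed

lemma rows_eq:
  assumes c: "L \<le> c" "c \<le> R"
  shows "diag_rows D c = {r c - int (n c) + 1..r c}" "n c > 0"
proof -
  let ?S = "diag_rows D c"
  have S: "?S \<noteq> {}" "finite ?S" using rows_nonempty_iff c finite_rows by auto
  then show "n c > 0" by (simp add: diag_size_def card_gt_0_iff)
  have eq: "?S = {Min ?S..Max ?S}"
  proof (intro subset_antisym subsetI)
    fix i assume i: "i \<in> {Min ?S..Max ?S}"
    have m: "(Min ?S, Min ?S + c) \<in> D" "(Max ?S, Max ?S + c) \<in> D"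
      using Min_in[OF S(2,1)] Max_in[OF S(2,1)] by (auto simp: diag_rows_def)
    have "(i, i + c) \<in> D" by (rule order_convexD[OF convex m]) (use i in auto)
    then show "i \<in> ?S" by (simp add: diag_rows_def)
  qed (use S in auto)
  have "int (n c) = Max ?S - Min ?S + 1"
    unfolding diag_size_def using arg_cong[OF eq, of card] S by simp
  then have "r c - int (n c) + 1 = Min ?S" "r c = Max ?S" by (auto simp: south_row_def)
  then show "?S = {r c - int (n c) + 1..r c}" using eq by (simp only:)
qed

lemma size_outside: "c < L \<or> R < c \<Longrightarrow> n c = 0"
  using rows_nonempty_iff[of c] by (auto simp: diag_size_def)

lemma cell_iff: "(i, j) \<in> D \<longleftrightarrow> r (j - i) - int (n (j - i)) < i \<and> i \<le> r (j - i)"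
proof (cases "L \<le> j - i \<and> j - i \<le> R")
  case True
  have "(i, j) \<in> D \<longleftrightarrow> i \<in> diag_rows D (j - i)" by (simp add: diag_rows_def)
  then show ?thesis using rows_eq(1)[of "j - i"] True by auto
next
  case False
  then have "n (j - i) = 0" using size_outside[of "j - i"] by force
  moreover have "(i, j) \<notin> D" using LR(2,3)[of "(i, j)"] False by auto
  ultimately show ?thesis by simp
qed

lemma cell_diag_iff: "(i, i + c) \<in> D \<longleftrightarrow> r c - int (n c) < i \<and> i \<le> r c"
  using cell_iff[of i "i + c"] by simp

text \<open>Two adjacent cells on the diagonals bound both bottom rows from below. A larger jump of
  \<open>r\<close> would then by convexity produce a cell below one of the bottoms.\<close>

lemma row_step:
  assumes c: "L \<le> c" "c < R"
  shows "r (c + 1) = r c \<or> r (c + 1) = r c - 1"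
proof -
  define I where "I = r c"
  define I' where "I' = r (c + 1)"
  have bot: "(I, I + c) \<in> D" "(I + 1, I + 1 + c) \<notin> D" "(I', I' + (c + 1)) \<in> D" "(I' + 1, I' + 1 + (c + 1)) \<notin> D"
    using rows_eq(2)[of c] rows_eq(2)[of "c + 1"] c unfolding I_def I'_def cell_diag_iff by auto
  obtain i where i: "(i, i + c) \<in> D" "(i, i + c + 1) \<in> D \<or> (i - 1, i + c) \<in> D"
    using adjacent_exists c by blast
  have "(i, i + (c + 1)) \<in> D \<or> (i - 1, (i - 1) + (c + 1)) \<in> D" using i(2) by (simp add: algebra_simps)
  then have le: "i \<le> I" "i \<le> I' + 1" using i(1) unfolding I_def I'_def cell_diag_iff by auto
  have "I' \<le> I"
  proof (rule ccontr)
    assume "\<not> I' \<le> I"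
    then have "(I + 1, I + 1 + c) \<in> D"
      by (intro order_convexD[OF convex i(1) bot(3)]) (use le in auto)
    then show False using bot by simp
  qed
  moreover have "I - 1 \<le> I'"
  proof (rule ccontr)
    assume "\<not> I - 1 \<le> I'"
    then have h: "I' + 2 \<le> I" by simp
    have "(I' + 1, I' + 1 + (c + 1)) \<in> D"
    proof (cases "(i, i + c + 1) \<in> D")
      case True
      then show ?thesis by (rule order_convexD[OF convex _ bot(1)]) (use le h in auto)
    next
      case False
      then have "(i - 1, i + c) \<in> D" using i by simp
      then show ?thesis by (rule order_convexD[OF convex _ bot(1)]) (use le h in auto)
    qed
    then show False using bot by simp
  qed
  ultimately show ?thesis unfolding I_def I'_def by linarith
qed

text \<open>Two consecutive cells of an extreme diagonal span a square with a corner on a diagonal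
  beyond it.\<close>

lemma size_ends: "n L = 1" "n R = 1"
proof -
  show "n L = 1"
  proof (rule ccontr)
    assume "n L \<noteq> 1"
    then have "n L \<ge> 2" using rows_eq(2)[of L] LR(1) by simp
    then have a: "(r L, r L + L) \<in> D" "(r L - 1, (r L - 1) + L) \<in> D" unfolding cell_diag_iff by auto
    have "(r L, r L + (L - 1)) \<in> D"
      by (rule order_convexD[OF convex a(2,1)]) auto
    then show False using LR(2) by fastforce
  qed
  show "n R = 1"
  proof (rule ccontr)
    assume "n R \<noteq> 1"
    then have "n R \<ge> 2" using rows_eq(2)[of R] LR(1) by simp
    then have a: "(r R, r R + R) \<in> D" "(r R - 1, (r R - 1) + R) \<in> D" unfolding cell_diag_iff by auto
    have "(r R - 1, (r R - 1) + (R + 1)) \<in> D"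
      by (rule order_convexD[OF convex a(2,1)]) auto
    then show False using LR(3) by fastforce
  qed
qed

text \<open>Convexity applied to the top rows \<open>a\<close> and \<open>b\<close> of the two
  diagonals shows that the northwest border, too, moves by a single step.\<close>

lemma size_east:
  assumes c: "L \<le> c" "c < R" and "r (c + 1) = r c"
  shows "n (c + 1) = n c \<or> n (c + 1) = n c + 1"
proof -
  define a where "a = r c - int (n c) + 1"
  define b where "b = r c - int (n (c + 1)) + 1"
  have pos: "n c > 0" "n (c + 1) > 0" using rows_eq(2) c by auto
  have cells: "(a, a + c) \<in> D" "(r c, r c + (c + 1)) \<in> D" "(b, b + (c + 1)) \<in> D" "(r c, r c + c) \<in> D"
    using pos assms(3) unfolding cell_diag_iff a_def b_def by auto
  have ab: "a \<le> r c" "b \<le> r c" using pos by (auto simp: a_def b_def)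
  have "(a, a + (c + 1)) \<in> D" by (rule order_convexD[OF convex cells(1,2)]) (use ab in auto)
  then have "b \<le> a" using assms(3) unfolding cell_diag_iff by (simp add: b_def)
  moreover have "a \<le> b + 1"
  proof (cases "b < r c")
    case True
    have "(b + 1, b + 1 + c) \<in> D" by (rule order_convexD[OF convex cells(3,4)]) (use True in auto)
    then show ?thesis unfolding cell_diag_iff by (simp add: a_def)
  qed (use ab in simp)
  ultimately show ?thesis by (simp add: a_def b_def) linarith
qed

lemma size_north:
  assumes c: "L \<le> c" "c < R" and "r (c + 1) = r c - 1"
  shows "n c = n (c + 1) \<or> n c = n (c + 1) + 1"
proof -
  define a where "a = r c - int (n c) + 1"
  define b where "b = r c - int (n (c + 1))"
  have pos: "n c > 0" "n (c + 1) > 0" using rows_eq(2) c by auto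
  have cells: "(a, a + c) \<in> D" "(r c - 1, (r c - 1) + (c + 1)) \<in> D" "(b, b + (c + 1)) \<in> D" "(r c, r c + c) \<in> D"
    using pos assms(3) unfolding cell_diag_iff a_def b_def by auto
  have ab: "a \<le> r c" "b \<le> r c - 1" using pos by (auto simp: a_def b_def)
  have "(b + 1, b + 1 + c) \<in> D" by (rule order_convexD[OF convex cells(3,4)]) (use ab in auto)
  then have "a \<le> b + 1" unfolding cell_diag_iff by (simp add: a_def)
  moreover have "b \<le> a"
  proof (cases "a \<le> r c - 1")
    case True
    have "(a, a + (c + 1)) \<in> D" by (rule order_convexD[OF convex cells(1,2)]) (use True in auto)
    then show ?thesis using assms(3) unfolding cell_diag_iff by (simp add: b_def)
  qed (use ab in simp)
  ultimately show ?thesis by (simp add: a_def b_def) linarith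
qed

lemma east_step_row: "east_step D c \<Longrightarrow> L \<le> c \<Longrightarrow> c < R \<and> r (c + 1) = r c"
  by (auto simp: east_step_def L_def R_def)

lemma north_step_row: "\<not> east_step D c \<Longrightarrow> c < R \<Longrightarrow> L \<le> c \<and> r (c + 1) = r c - 1"
  using row_step[of c] by (auto simp: east_step_def L_def R_def)

text \<open>At the artificial steps into \<open>L\<close> and out of \<open>R\<close> the size goes
  from 0 to 1 and back; this is where \<open>size_ends\<close> enters.\<close>

sublocale profile n "east_step D" L R
proof
  show "n c = 0" if "c < L \<or> R < c" for c using size_outside[OF that] .
  show "n (c + 1) = n c \<or> n (c + 1) = n c + 1" if "east_step D c" for c
  proof (cases "L \<le> c")
    case True then show ?thesis using size_east east_step_row[OF that] by simp
  next
    case False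
    then have "n c = 0" "n (c + 1) = 0 \<or> c + 1 = L" using size_outside[of c] size_outside[of "c + 1"] by auto
    then show ?thesis using size_ends by auto
  qed
  show "n c = n (c + 1) \<or> n c = n (c + 1) + 1" if "\<not> east_step D c" for c
  proof (cases "c < R")
    case True then show ?thesis using size_north north_step_row[OF that True] by simp
  next
    case False
    then have "n (c + 1) = 0" "n c = 0 \<or> c = R" using size_outside[of c] size_outside[of "c + 1"] by auto
    then show ?thesis using size_ends by auto
  qed
qed

lemma run_starts_eq: "run_starts = diag_starts D" and run_ends_eq: "run_ends = diag_ends D"
  by (simp_all add: run_starts_def run_ends_def diag_starts_def diag_ends_def)

section \<open>Column-strict fillings as nonintersecting families\<close>

text \<open>The \<open>k\<close>-th cell of diagonal \<open>c\<close>, counted from 1 at the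
  southeast border. For fixed \<open>k\<close> these cells follow the border moved
  \<open>k - 1\<close> places to the northwest, so all runs take the same kind of step at the same
  diagonal.\<close>

definition cell_of :: "int \<Rightarrow> nat \<Rightarrow> cell" where
  "cell_of c k = (r c - (int k - 1), r c - (int k - 1) + c)"

definition run_cells :: "int \<Rightarrow> cell set" where
  "run_cells a = (\<lambda>c. cell_of c (n a)) ` {a..run_end a}"

lemma diag_cell_of [simp]: "diag (cell_of c k) = c"
  by (simp add: cell_of_def)

lemma cell_of_mem: "1 \<le> k \<Longrightarrow> k \<le> n c \<Longrightarrow> cell_of c k \<in> D"
  unfolding cell_of_def cell_diag_iff by simp

lemma active_mem:
  assumes "active a c"
  shows "cell_of c (n a) \<in> D"
proof (rule cell_of_mem)
  show "n a \<le> n c" by (rule active_le[OF assms])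
  show "1 \<le> n a" using assms start_props(2) by (force simp: active_def)
qed

lemma cell_has_run:
  assumes "x \<in> D"
  shows "\<exists>a. active a (diag x) \<and> x = cell_of (diag x) (n a)"
proof -
  obtain i j where x: "x = (i, j)" by fastforce
  let ?c = "j - i"
  define t where "t = nat (r ?c - i)"
  have "r ?c - int (n ?c) < i" "i \<le> r ?c" using assms x cell_iff by auto
  then have t: "t < n ?c" "int t = r ?c - i" by (auto simp: t_def)
  then obtain a where "active a ?c" "n a = t + 1" using ex_active by blast
  then show ?thesis using t x by (intro exI[of _ a]) (simp add: cell_of_def)
qed

lemma disjoint_runs:
  assumes "a \<in> run_starts" "a' \<in> run_starts" "a \<noteq> a'"
  shows "run_cells a \<inter> run_cells a' = {}"
proof (rule ccontr)
  assume "run_cells a \<inter> run_cells a' \<noteq> {}"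
  then obtain x where "x \<in> run_cells a" "x \<in> run_cells a'" by blast
  then obtain c c' where c: "c \<in> {a..run_end a}" "c' \<in> {a'..run_end a'}" "cell_of c (n a) = cell_of c' (n a')"
    unfolding run_cells_def by (elim imageE) simp
  then have "c = c'" using diag_cell_of by metis
  then have "n a = n a'" using c by (simp add: cell_of_def)
  moreover have "active a c" "active a' c" using c assms \<open>c = c'\<close> by (auto simp: active_def)
  ultimately show False using active_inj assms by blast
qed

lemma union_runs: "D = (\<Union>a\<in>run_starts. run_cells a)"
proof (intro subset_antisym subsetI)
  fix x assume "x \<in> D"
  then obtain a where a: "active a (diag x)" "x = cell_of (diag x) (n a)" using cell_has_run by blast
  then have "x \<in> run_cells a" unfolding run_cells_def active_def by (intro image_eqI[of _ _ "diag x"]) auto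
  then show "x \<in> (\<Union>a\<in>run_starts. run_cells a)" using a by (auto simp: active_def)
next
  fix x assume "x \<in> (\<Union>a\<in>run_starts. run_cells a)"
  then show "x \<in> D" using active_mem by (auto simp: run_cells_def active_def)
qed

lemma image_mset_Union_disjoint:
  assumes "finite I" "\<And>i. i \<in> I \<Longrightarrow> finite (B i)" "\<And>i j. i \<in> I \<Longrightarrow> j \<in> I \<Longrightarrow> i \<noteq> j \<Longrightarrow> B i \<inter> B j = {}"
  shows "image_mset f (mset_set (\<Union>i\<in>I. B i)) = (\<Sum>i\<in>I. image_mset f (mset_set (B i)))"
  using assms
proof (induction I rule: finite_induct)
  case (insert i I)
  have "B i \<inter> (\<Union>i\<in>I. B i) = {}" using insert by blast
  then have "mset_set (B i \<union> (\<Union>i\<in>I. B i)) = mset_set (B i) + mset_set (\<Union>i\<in>I. B i)"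
    using insert by (intro mset_set_Union) auto
  then show ?case using insert by simp
qed simp

lemma content_runs:
  assumes lo: "bij_betw lo I run_starts"
  shows "image_mset T (mset_set D) =
    (\<Sum>i\<in>I. image_mset (\<lambda>c. T (cell_of c (n (lo i)))) (mset_set {lo i..run_end (lo i)}))"
proof -
  have "image_mset T (mset_set D) = (\<Sum>a\<in>run_starts. image_mset T (mset_set (run_cells a)))"
    by (subst union_runs, rule image_mset_Union_disjoint)
      (use finite_run_starts disjoint_runs in \<open>auto simp: run_cells_def\<close>)
  also have "\<dots> = (\<Sum>i\<in>I. image_mset T (mset_set (run_cells (lo i))))"
    by (rule sum.reindex_bij_betw[OF lo, symmetric])
  also have "\<dots> = (\<Sum>i\<in>I. image_mset (\<lambda>c. T (cell_of c (n (lo i)))) (mset_set {lo i..run_end (lo i)}))"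
  proof (rule sum.cong)
    fix i
    have "inj_on (\<lambda>c. cell_of c (n (lo i))) {lo i..run_end (lo i)}"
      by (rule inj_onI) (metis diag_cell_of)
    then have "mset_set (run_cells (lo i)) =
        image_mset (\<lambda>c. cell_of c (n (lo i))) (mset_set {lo i..run_end (lo i)})"
      unfolding run_cells_def by (simp add: image_mset_mset_set)
    then show "image_mset T (mset_set (run_cells (lo i))) =
        image_mset (\<lambda>c. T (cell_of c (n (lo i)))) (mset_set {lo i..run_end (lo i)})"
      by (simp add: image_mset.compositionality o_def)
  qed simp
  finally show ?thesis .
qed

lemma column_strict_mono:
  assumes T: "T \<in> column_strict_fillings D" and x: "(i, j) \<in> D" and y: "(i', j') \<in> D"
    and le: "i \<le> i'" "j \<le> j'"
  shows "T (i, j) \<le> T (i', j')" "i < i' \<Longrightarrow> T (i, j) < T (i', j')"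
proof -
  have z: "(i', j) \<in> D" by (rule order_convexD[OF convex x y]) (use le in auto)
  have rows: "T (i', j) \<le> T (i', j')"
    using T z y le unfolding column_strict_fillings_def by blast
  have cols: "i < i' \<Longrightarrow> T (i, j) < T (i', j)"
    using T x z unfolding column_strict_fillings_def by blast
  show "i < i' \<Longrightarrow> T (i, j) < T (i', j')" using rows cols by simp
  then show "T (i, j) \<le> T (i', j')" using rows le by (cases "i = i'") auto
qed

text \<open>By convexity the cells between two cells of a row or column belong to \<open>D\<close>,
  so comparisons of neighbours chain up.\<close>

lemma column_strictI:
  assumes ext: "T \<in> extensional D"
    and rows: "\<And>i j. (i, j) \<in> D \<Longrightarrow> (i, j + 1) \<in> D \<Longrightarrow> T (i, j) \<le> T (i, j + 1)"
    and cols: "\<And>i j. (i, j) \<in> D \<Longrightarrow> (i + 1, j) \<in> D \<Longrightarrow> T (i, j) < T (i + 1, j)"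
  shows "T \<in> column_strict_fillings D"
proof -
  have R: "T (i, j) \<le> T (i, j + int k)" if "(i, j) \<in> D" "(i, j + int k) \<in> D" for i j k
    using that(2)
  proof (induction k)
    case (Suc k)
    have "(i, j + int k) \<in> D" by (rule order_convexD[OF convex that(1) Suc.prems]) auto
    then show ?case using Suc.IH Suc.prems rows[of i "j + int k"] by (simp add: algebra_simps)
  qed simp
  have C: "T (i, j) < T (i + int k + 1, j)" if "(i, j) \<in> D" "(i + int k + 1, j) \<in> D" for i j k
    using that(2)
  proof (induction k)
    case 0
    then show ?case using cols that by simp
  next
    case (Suc k)
    have "(i + int k + 1, j) \<in> D" by (rule order_convexD[OF convex that(1) Suc.prems]) auto
    then show ?case using Suc.IH Suc.prems cols[of "i + int k + 1" j] by (simp add: algebra_simps)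
  qed
  have "T (i, j) \<le> T (i, j')" if "(i, j) \<in> D" "(i, j') \<in> D" "j \<le> j'" for i j j'
    using R[of i j "nat (j' - j)"] that by simp
  moreover have "T (i, j) < T (i', j)" if "(i, j) \<in> D" "(i', j) \<in> D" "i < i'" for i i' j
    using C[of i j "nat (i' - i - 1)"] that by simp
  ultimately show ?thesis using ext unfolding column_strict_fillings_def by blast
qed

definition family_of :: "(int \<Rightarrow> int) \<Rightarrow> int set \<Rightarrow> (cell \<Rightarrow> nat) \<Rightarrow> int \<Rightarrow> int \<Rightarrow> int" where
  "family_of lo I T = (\<lambda>i c. if i \<in> I \<and> active (lo i) c then int (T (cell_of c (n (lo i)))) else -1)"

lemma east_cells:
  assumes "east_step D c" "L \<le> c"
  shows "cell_of (c + 1) k = (fst (cell_of c k), snd (cell_of c k) + 1)"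
  using east_step_row[OF assms] by (simp add: cell_of_def)

lemma north_cells:
  assumes "\<not> east_step D c" "c < R"
  shows "cell_of (c + 1) k = (fst (cell_of c k) - 1, snd (cell_of c k))"
  using north_step_row[OF assms] by (simp add: cell_of_def)

lemma active_range: "active a c \<Longrightarrow> L \<le> c \<and> c \<le> R"
  using start_props(3)[of a] run_end_props(2)[of a] by (auto simp: active_def)

lemma family_of_path:
  assumes T: "T \<in> column_strict_fillings D" and i: "i \<in> I" and start: "lo i \<in> run_starts"
  shows "lattice_path (east_step D) (lo i) (run_end (lo i)) (family_of lo I T i)"
  unfolding lattice_path_def
proof (intro conjI allI impI)
  let ?F = "family_of lo I T i"
  show "lo i \<le> run_end (lo i)" by (rule run_end_props(1)[OF start])
  show "if lo i \<le> c \<and> c \<le> run_end (lo i) then 0 \<le> ?F c else ?F c = -1" for c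
    using i start by (auto simp: family_of_def active_def)
  fix c assume c: "lo i \<le> c \<and> c < run_end (lo i)"
  then have act: "active (lo i) c" "active (lo i) (c + 1)" using start by (auto simp: active_def)
  have mem: "cell_of c (n (lo i)) \<in> D" "cell_of (c + 1) (n (lo i)) \<in> D" by (rule active_mem[OF act(1)], rule active_mem[OF act(2)])
  have range: "L \<le> c" "c < R" using active_range[OF act(1)] active_range[OF act(2)] by auto
  obtain a b where ab: "cell_of c (n (lo i)) = (a, b)" by fastforce
  show "if east_step D c then ?F c \<le> ?F (c + 1) else ?F (c + 1) < ?F c"
  proof (cases "east_step D c")
    case True
    then show ?thesis
      using east_cells[OF True range(1), of "n (lo i)"] mem ab act i column_strict_mono(1)[OF T, of a b a "b + 1"]
      by (simp add: family_of_def)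
  next
    case False
    then show ?thesis
      using north_cells[OF False range(2), of "n (lo i)"] mem ab act i column_strict_mono(2)[OF T, of "a - 1" b a b]
      by (simp add: family_of_def)
  qed
qed

text \<open>Let run \<open>j\<close> be deeper than run \<open>i\<close>. On an east step the next
  cell of \<open>j\<close> is weakly northwest of the current cell of \<open>i\<close> and in a
  higher row, hence has a smaller entry. On a north step the current cell of \<open>j\<close> is
  weakly northwest of the next cell of \<open>i\<close>. Either way the two height ranges are
  disjoint.\<close>

lemma family_of_nonintersecting:
  assumes T: "T \<in> column_strict_fillings D" and lo: "bij_betw lo I run_starts"
  shows "nonintersecting (east_step D) I (family_of lo I T)"
proof -
  let ?F = "family_of lo I T"
  have False if ij: "i \<in> I" "j \<in> I" and p: "passes (east_step D) (?F i) c k" "passes (east_step D) (?F j) c k"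
    and lt: "n (lo i) < n (lo j)" for i j c k
  proof (cases "east_step D c")
    case True
    then have "0 \<le> ?F i (c + 1)" "0 \<le> ?F j (c + 1)" using p by (auto simp: passes_def)
    then have act: "active (lo i) (c + 1)" "active (lo j) (c + 1)" by (auto simp: family_of_def split: if_splits)
    have "lo i \<noteq> c + 1" using active_le[OF act(2)] lt by auto
    then have act': "active (lo i) c" using active_prev act by blast
    have mem: "cell_of c (n (lo i)) \<in> D" "cell_of (c + 1) (n (lo j)) \<in> D" by (rule active_mem[OF act'], rule active_mem[OF act(2)])
    have "r (c + 1) = r c" using east_step_row[OF True] active_range[OF act'] by simp
    then have "T (cell_of (c + 1) (n (lo j))) < T (cell_of c (n (lo i)))"
      using column_strict_mono(2)[OF T] mem lt unfolding cell_of_def by simp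
    then show False using p True ij act act' by (auto simp: passes_def family_of_def)
  next
    case False
    then have "0 \<le> ?F i c" "0 \<le> ?F j c" using p by (auto simp: passes_def)
    then have act: "active (lo i) c" "active (lo j) c" by (auto simp: family_of_def split: if_splits)
    have "n c \<le> n (c + 1) + 1" using up_left[OF False] by auto
    then have "n (lo i) \<le> n (c + 1)" using active_le[OF act(2)] lt by simp
    then have act': "active (lo i) (c + 1)" using active_next[OF act(1)] by simp
    have mem: "cell_of (c + 1) (n (lo i)) \<in> D" "cell_of c (n (lo j)) \<in> D" by (rule active_mem[OF act'], rule active_mem[OF act(2)])
    have "r (c + 1) = r c - 1" using north_step_row[OF False] active_range[OF act'] by simp
    then have "T (cell_of c (n (lo j))) \<le> T (cell_of (c + 1) (n (lo i)))"
      using column_strict_mono(1)[OF T] mem lt unfolding cell_of_def by simp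
    then show False using p False ij act act' by (auto simp: passes_def family_of_def)
  qed
  then have cross: False if "i \<in> I" "j \<in> I" "passes (east_step D) (?F i) c k" "passes (east_step D) (?F j) c k"
      "n (lo i) \<noteq> n (lo j)" for i j c k
    using that by (metis linorder_neqE_nat)
  show ?thesis
    unfolding nonintersecting_def crossing_def
  proof safe
    fix c k i j assume ij: "i \<in> I" "j \<in> I" "i \<noteq> j"
      and p: "passes (east_step D) (?F i) c k" "passes (east_step D) (?F j) c k"
    have "\<exists>x. active (lo i) x \<and> active (lo j) x"
    proof (cases "east_step D c")
      case True
      then have "0 \<le> ?F i (c + 1)" "0 \<le> ?F j (c + 1)" using p by (auto simp: passes_def)
      then show ?thesis by (intro exI[of _ "c + 1"]) (auto simp: family_of_def split: if_splits)
    next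
      case False
      then have "0 \<le> ?F i c" "0 \<le> ?F j c" using p by (auto simp: passes_def)
      then show ?thesis by (intro exI[of _ c]) (auto simp: family_of_def split: if_splits)
    qed
    then have "n (lo i) = n (lo j) \<Longrightarrow> lo i = lo j" using active_inj by blast
    then have "n (lo i) \<noteq> n (lo j)" using ij lo by (auto simp: bij_betw_def inj_on_def)
    then show False using cross[OF ij(1,2) p] by blast
  qed
qed

lemma family_of_weight:
  assumes lo: "bij_betw lo I run_starts"
  shows "(\<Sum>i\<in>I. weight (family_of lo I T i)) = image_mset T (mset_set D)"
  unfolding content_runs[OF lo]
proof (rule sum.cong)
  fix i assume i: "i \<in> I"
  then have "lo i \<in> run_starts" using lo by (auto simp: bij_betw_def)
  then have act: "active (lo i) c \<longleftrightarrow> c \<in> {lo i..run_end (lo i)}" for c by (auto simp: active_def)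
  have supp: "{c. 0 \<le> family_of lo I T i c} = {lo i..run_end (lo i)}"
  proof (rule set_eqI)
    show "c \<in> {c. 0 \<le> family_of lo I T i c} \<longleftrightarrow> c \<in> {lo i..run_end (lo i)}" for c
      using act[of c] i by (simp add: family_of_def)
  qed
  show "weight (family_of lo I T i) =
      image_mset (\<lambda>c. T (cell_of c (n (lo i)))) (mset_set {lo i..run_end (lo i)})"
    unfolding weight_def supp
  proof (rule image_mset_cong)
    fix c assume "c \<in># mset_set {lo i..run_end (lo i)}"
    then have "active (lo i) c" using act by simp
    then show "nat (family_of lo I T i c) = T (cell_of c (n (lo i)))" using i by (simp add: family_of_def)
  qed
qed simp

text \<open>Neighbouring cells of one run are compared by a step of its path. Neighbouring cells of
  two runs have consecutive levels, and their comparison follows from nonintersection and the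
  ordering in \<open>nonintersecting_runs\<close>.\<close>

lemma family_of_surj:
  assumes lo: "bij_betw lo I run_starts"
    and paths: "\<And>i. i \<in> I \<Longrightarrow> lattice_path (east_step D) (lo i) (run_end (lo i)) (F i)"
    and out: "\<And>i. i \<notin> I \<Longrightarrow> F i = (\<lambda>_. -1)"
    and ni: "nonintersecting (east_step D) I F"
  shows "\<exists>T \<in> column_strict_fillings D. F = family_of lo I T"
proof -
  have start: "lo i \<in> run_starts" if "i \<in> I" for i using lo that by (auto simp: bij_betw_def)
  have nn: "0 \<le> F i c \<longleftrightarrow> active (lo i) c" if "i \<in> I" for i c
    using lattice_path_nonneg_iff[OF paths[OF that]] start[OF that] by (simp add: active_def)
  have ge: "-1 \<le> F i c" if "i \<in> I" for i c by (rule lattice_path_ge[OF paths[OF that]])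
  have step: "if east_step D c then F i c \<le> F i (c + 1) else F i (c + 1) < F i c"
    if "i \<in> I" "active (lo i) c" "active (lo i) (c + 1)" for i c
    using lattice_path_step[OF paths[OF that(1)]] that(2,3) by (simp add: active_def)
  have cross: False if "i \<in> I" "j \<in> I" "i \<noteq> j" "passes (east_step D) (F i) c k" "passes (east_step D) (F j) c k"
    for i j c k
    using ni that unfolding nonintersecting_def crossing_def by blast
  have ord: "F j c < F i c"
    if "i \<in> I" "j \<in> I" "active (lo i) c" "active (lo j) c" "n (lo i) < n (lo j)" for i j c
    using nonintersecting_runs(2)[OF lo permutes_id _ ni, of i j c] paths that by simp
  define idx where "idx x = (SOME i. i \<in> I \<and> active (lo i) (diag x) \<and> x = cell_of (diag x) (n (lo i)))" for x
  have idx: "idx x \<in> I \<and> active (lo (idx x)) (diag x) \<and> x = cell_of (diag x) (n (lo (idx x)))"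
    if x: "x \<in> D" for x
  proof -
    obtain a where a: "active a (diag x)" "x = cell_of (diag x) (n a)" using cell_has_run[OF x] by blast
    moreover have "a \<in> lo ` I" using lo a by (simp add: bij_betw_def active_def)
    ultimately have "\<exists>i. i \<in> I \<and> active (lo i) (diag x) \<and> x = cell_of (diag x) (n (lo i))" by blast
    then show ?thesis unfolding idx_def by (rule someI_ex)
  qed
  have idx_unique: "idx (cell_of c (n (lo i))) = i" if i: "i \<in> I" "active (lo i) c" for i c
  proof -
    let ?x = "cell_of c (n (lo i))"
    have x: "idx ?x \<in> I" "active (lo (idx ?x)) c" "?x = cell_of c (n (lo (idx ?x)))"
      using idx[OF active_mem[OF i(2)]] by auto
    then have "n (lo (idx ?x)) = n (lo i)" by (simp add: cell_of_def)
    then have "lo (idx ?x) = lo i" using active_inj x(2) i(2) by blast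
    then show ?thesis using lo x(1) i(1) by (auto simp: bij_betw_def inj_on_def)
  qed
  define T where "T = restrict (\<lambda>x. nat (F (idx x) (diag x))) D"
  have T_cell: "int (T (cell_of c (n (lo i)))) = F i c" if i: "i \<in> I" "active (lo i) c" for i c
    using idx_unique[OF i] active_mem[OF i(2)] nn[OF i(1)] i by (simp add: T_def)
  have T_val: "\<exists>k\<in>I. active (lo k) (j - i) \<and> (i, j) = cell_of (j - i) (n (lo k)) \<and> int (T (i, j)) = F k (j - i)"
    if x: "(i, j) \<in> D" for i j
    using idx[OF x] T_cell[of "idx (i, j)" "j - i"] by auto
  have same: "active (lo k) (c + 1) \<and> l = k"
    if "k \<in> I" "active (lo k) c" "l \<in> I" "active (lo l) (c + 1)" "n (lo l) = n (lo k)" for k l c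
  proof -
    have act: "active (lo k) (c + 1)" using active_next[OF that(2)] active_le[OF that(4)] that(5) by simp
    then have "lo l = lo k" using active_inj that(4,5) by blast
    then show ?thesis using act lo that(1,3) by (auto simp: bij_betw_def inj_on_def)
  qed
  have lt1: "int (T (i, j)) \<le> int (T (i, j + 1))" if x: "(i, j) \<in> D" "(i, j + 1) \<in> D" for i j
  proof -
    define c where "c = j - i"
    obtain k where k: "k \<in> I" "active (lo k) c" "(i, j) = cell_of c (n (lo k))" "int (T (i, j)) = F k c"
      using T_val[OF x(1)] c_def by auto
    obtain l where l: "l \<in> I" "active (lo l) (c + 1)" "(i, j + 1) = cell_of (c + 1) (n (lo l))"
      "int (T (i, j + 1)) = F l (c + 1)"
      using T_val[OF x(2)] c_def by (auto simp: algebra_simps)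
    have range: "L \<le> c" "c < R" using active_range[OF k(2)] active_range[OF l(2)] by auto
    show ?thesis
    proof (cases "east_step D c")
      case True
      have "n (lo l) = n (lo k)" using k(3) l(3) east_step_row[OF True range(1)] by (simp add: cell_of_def)
      then have "active (lo k) (c + 1)" "l = k" using same[OF k(1,2) l(1,2)] by auto
      then show ?thesis using step[OF k(1,2)] True k l by simp
    next
      \<comment> \<open>On a north step the eastern neighbour lies one level closer to the border.
        If its entry were smaller, path \<open>l\<close> would fall past the height
        \<open>F k c\<close>, at which path \<open>k\<close> begins its own fall.\<close>
      case False
      have nl: "n (lo k) = n (lo l) + 1" using k(3) l(3) north_step_row[OF False range(2)] by (simp add: cell_of_def)
      have act: "active (lo l) c" by (rule active_nonstart[OF False l(2)])
      have lt: "F k c < F l c" using ord[OF l(1) k(1) act k(2)] nl by simp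
      show ?thesis
      proof (rule ccontr)
        assume "\<not> ?thesis"
        then have gt: "F l (c + 1) < F k c" using k l by simp
        have "F k (c + 1) < F k c"
        proof (cases "active (lo k) (c + 1)")
          case True then show ?thesis using step[OF k(1,2)] False by simp
        next
          case False
          then show ?thesis using nn[OF k(1), of "c + 1"] nn[OF k(1), of c] k(2) by simp
        qed
        moreover have "0 \<le> F k c" using nn k by blast
        ultimately show False using cross[OF k(1) l(1), of c "- F k c"] gt lt nl False
          by (force simp: passes_def)
      qed
    qed
  qed
  have lt2: "int (T (i, j)) < int (T (i + 1, j))" if x: "(i, j) \<in> D" "(i + 1, j) \<in> D" for i j
  proof -
    define c where "c = j - (i + 1)"
    obtain k where k: "k \<in> I" "active (lo k) c" "(i + 1, j) = cell_of c (n (lo k))" "int (T (i + 1, j)) = F k c"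
      using T_val[OF x(2)] c_def by auto
    obtain l where l: "l \<in> I" "active (lo l) (c + 1)" "(i, j) = cell_of (c + 1) (n (lo l))"
      "int (T (i, j)) = F l (c + 1)"
      using T_val[OF x(1)] c_def by (auto simp: algebra_simps)
    have range: "L \<le> c" "c < R" using active_range[OF k(2)] active_range[OF l(2)] by auto
    show ?thesis
    proof (cases "east_step D c")
      case False
      have "n (lo l) = n (lo k)" using k(3) l(3) north_step_row[OF False range(2)] by (simp add: cell_of_def)
      then have "active (lo k) (c + 1)" "l = k" using same[OF k(1,2) l(1,2)] by auto
      then show ?thesis using step[OF k(1,2)] False k l by simp
    next
      case True
      have nl: "n (lo l) = n (lo k) + 1" using k(3) l(3) east_step_row[OF True range(1)] by (simp add: cell_of_def)
      have act: "active (lo k) (c + 1)"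
        using active_next[OF k(2)] active_le[OF l(2)] nl by simp
      have lt: "F l (c + 1) < F k (c + 1)" using ord[OF k(1) l(1) act l(2)] nl by simp
      show ?thesis
      proof (rule ccontr)
        assume "\<not> ?thesis"
        then have gt: "F k c \<le> F l (c + 1)" using k l by simp
        \<comment> \<open>If run \<open>l\<close> starts only at \<open>c + 1\<close>, the value -1
          at \<open>c\<close> gives the inequality.\<close>
        have "F l c \<le> F l (c + 1)"
        proof (cases "active (lo l) c")
          case True then show ?thesis using step[OF l(1) _ l(2)] \<open>east_step D c\<close> by simp
        next
          case False
          then show ?thesis using nn[OF l(1), of "c + 1"] nn[OF l(1), of c] l(2) by simp
        qed
        moreover have "0 \<le> F l (c + 1)" using nn l by blast
        ultimately show False using cross[OF k(1) l(1), of c "F l (c + 1)"] gt lt nl True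
          by (force simp: passes_def)
      qed
    qed
  qed
  have "T \<in> column_strict_fillings D"
  proof (rule column_strictI)
    show "T \<in> extensional D" by (simp add: T_def)
    show "T (i, j) \<le> T (i, j + 1)" if "(i, j) \<in> D" "(i, j + 1) \<in> D" for i j
      using lt1[OF that] by simp
    show "T (i, j) < T (i + 1, j)" if "(i, j) \<in> D" "(i + 1, j) \<in> D" for i j
      using lt2[OF that] by simp
  qed
  moreover have "F i c = family_of lo I T i c" for i c
  proof (cases "i \<in> I \<and> active (lo i) c")
    case True
    then show ?thesis using T_cell by (simp add: family_of_def)
  next
    case False
    then show ?thesis using out[of i] nn[of i c] ge[of i c] by (cases "i \<in> I") (auto simp: family_of_def)
  qed
  ultimately show ?thesis by blast
qed

text \<open>By \<open>nonintersecting_runs\<close> only the identity contributes, and it counts the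
  fillings. The indexing \<open>lo\<close> is left free because the reflected diagram will be
  indexed by the starts of the original one.\<close>

theorem signed_count_skew_schur:
  assumes lo: "bij_betw lo I run_starts"
  shows "signed_count (east_step D) I lo (run_end \<circ> lo) M = int (skew_schur D M)"
proof -
  let ?s = "east_step D" and ?hi = "run_end \<circ> lo"
  have fin: "Finite_Set.finite I" using lo finite_run_starts bij_betw_finite by blast
  have start: "lo i \<in> run_starts" if "i \<in> I" for i using lo that by (auto simp: bij_betw_def)
  let ?N = "\<lambda>\<pi>. {F \<in> families ?s I lo (?hi \<circ> \<pi>) M. nonintersecting ?s I F}"
  have empty: "?N \<pi> = {}" if "\<pi> permutes I" "\<pi> \<noteq> id" for \<pi>
  proof -
    have False if "F \<in> ?N \<pi>" for F
      using nonintersecting_runs(1)[OF lo \<open>\<pi> permutes I\<close>, of F] that \<open>\<pi> \<noteq> id\<close> by (simp add: families_def)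
    then show ?thesis by blast
  qed
  have "signed_count ?s I lo ?hi M = (\<Sum>\<pi>\<in>{id}. sign \<pi> * int (card (?N \<pi>)))"
    unfolding lindstroem_gessel_viennot[OF fin]
  proof (intro sum.mono_neutral_right finite_permutations[OF fin] ballI)
    fix \<pi> assume "\<pi> \<in> {\<pi>. \<pi> permutes I} - {id}"
    then have "?N \<pi> = {}" by (intro empty) auto
    then show "sign \<pi> * int (card (?N \<pi>)) = 0" by (simp only: card.empty)
  qed (simp add: permutes_id)
  also have "\<dots> = int (card (?N id))" by simp
  also have "card (?N id) = skew_schur D M"
  proof -
    let ?A = "{T \<in> column_strict_fillings D. image_mset T (mset_set D) = M}"
    have "bij_betw (family_of lo I) ?A (?N id)"
      unfolding bij_betw_def
    proof (intro conjI subset_antisym subsetI)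
      show "inj_on (family_of lo I) ?A"
      proof (rule inj_onI)
        fix T U assume T: "T \<in> ?A" and U: "U \<in> ?A" and eq: "family_of lo I T = family_of lo I U"
        show "T = U"
        proof (rule extensionalityI)
          show "T \<in> extensional D" "U \<in> extensional D" using T U by (auto simp: column_strict_fillings_def)
          fix x assume "x \<in> D"
          then obtain a where a: "active a (diag x)" "x = cell_of (diag x) (n a)" using cell_has_run by blast
          then have "a \<in> lo ` I" using lo by (simp add: bij_betw_def active_def)
          then obtain i where "i \<in> I" "a = lo i" by blast
          then show "T x = U x" using fun_cong[OF fun_cong[OF eq, of i], of "diag x"] a
            by (simp add: family_of_def)
        qed
      qed
      fix F assume "F \<in> family_of lo I ` ?A"
      then obtain T where T: "T \<in> ?A" "F = family_of lo I T" by blast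
      then show "F \<in> ?N id"
        using family_of_path[of T _ I lo] start family_of_nonintersecting[OF _ lo] family_of_weight[OF lo, of T]
        by (auto simp: families_def) (auto simp: family_of_def)
    next
      fix F assume F: "F \<in> ?N id"
      then obtain T where T: "T \<in> column_strict_fillings D" "F = family_of lo I T"
        using family_of_surj[OF lo, of F] by (auto simp: families_def)
      moreover have "image_mset T (mset_set D) = M"
        using F family_of_weight[OF lo, of T] T by (simp add: families_def)
      ultimately show "F \<in> family_of lo I ` ?A" by blast
    qed
    then show ?thesis unfolding skew_schur_def by (rule bij_betw_same_card[symmetric])
  qed
  finally show ?thesis .
qed

end

theorem skew_schur_reflect:
  assumes "connected_shape D" "connected_shape D'"
    and starts: "diag_starts D' = (\<lambda>x. \<kappa> - x) ` diag_ends D"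
    and ends: "diag_ends D' = (\<lambda>x. \<kappa> - x) ` diag_starts D"
    and steps: "\<And>a b c. a \<in> diag_starts D \<Longrightarrow> b \<in> diag_ends D \<Longrightarrow> a \<le> c \<Longrightarrow> c < b \<Longrightarrow>
      east_step D' (c + (\<kappa> - a - b)) = east_step D c"
  shows "D \<sim> D'"
proof -
  interpret D: connected_shape D by fact
  interpret D': connected_shape D' by fact
  let ?A = "D.run_starts"
  \<comment> \<open>The starts of \<open>D'\<close> are indexed by the starts of \<open>D\<close>:
    follow the run to its end and reflect.\<close>
  have bij: "bij_betw (\<lambda>a. \<kappa> - D.run_end a) ?A D'.run_starts"
  proof -
    have "bij_betw (\<lambda>x. \<kappa> - x) (diag_ends D) (diag_starts D')"
      unfolding starts by (rule inj_on_imp_bij_betw) (simp add: inj_on_def)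
    from bij_betw_trans[OF D.bij_run_end[unfolded D.run_ends_eq] this] show ?thesis
      by (simp add: o_def D'.run_starts_eq)
  qed
  have bij': "bij_betw (D'.run_end \<circ> (\<lambda>a. \<kappa> - D.run_end a)) ?A ((\<lambda>x. \<kappa> - x) ` ?A)"
    using bij_betw_trans[OF bij D'.bij_run_end] by (simp add: D.run_starts_eq D'.run_ends_eq ends)
  have "\<bar>int (skew_schur D M)\<bar> = \<bar>int (skew_schur D' M)\<bar>" for M
  proof -
    have "bij_betw id ?A ?A" by simp
    from D.signed_count_skew_schur[OF this]
    have "int (skew_schur D M) = signed_count (east_step D) ?A id D.run_end M" by simp
    moreover have "int (skew_schur D' M) = signed_count (east_step D') ?A (\<lambda>a. \<kappa> - D.run_end a)
        (D'.run_end \<circ> (\<lambda>a. \<kappa> - D.run_end a)) M"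
      by (rule D'.signed_count_skew_schur[OF bij, symmetric])
    moreover have "\<bar>signed_count (east_step D) ?A id D.run_end M\<bar> =
        \<bar>signed_count (east_step D') ?A (\<lambda>a. \<kappa> - D.run_end a) (D'.run_end \<circ> (\<lambda>a. \<kappa> - D.run_end a)) M\<bar>"
      by (rule signed_count_reflect[OF D.finite_run_starts D.bij_run_end bij'])
        (use steps in \<open>simp add: D.run_starts_eq D.run_ends_eq\<close>)
    ultimately show ?thesis by simp
  qed
  then show ?thesis unfolding schur_equivalent_def by auto
qed

section \<open>Diagonal ranges of the decomposition ribbons\<close>

lemma skew_diagram_finite: "skew_diagram D \<Longrightarrow> finite D"
proof -
  have fin: "finite (ferrers p)" if p: "is_partition p" for p
  proof -
    have "ferrers p \<subseteq> (\<Union>i \<in> {i. p i \<noteq> 0}. (\<lambda>j. (int i, int j)) ` {..<p i})"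
    proof
      fix x assume "x \<in> ferrers p"
      then obtain i j where "x = (int i, int j)" "j < p i" by (auto simp: ferrers_def)
      then show "x \<in> (\<Union>i \<in> {i. p i \<noteq> 0}. (\<lambda>j. (int i, int j)) ` {..<p i})"
        by (intro UN_I[of i]) auto
    qed
    then show ?thesis by (rule finite_subset) (use p in \<open>auto simp: is_partition_def\<close>)
  qed
  assume "skew_diagram D"
  then show "finite D" unfolding skew_diagram_def translate_def using fin by blast
qed

lemma skew_diagram_convex:
  assumes "skew_diagram D"
  shows "order_convex D"
proof -
  obtain p q v where p: "is_partition p" and q: "is_partition q"
    and D: "D = translate v (ferrers p - ferrers q)"
    using assms by (auto simp: skew_diagram_def)
  have mem: "(i, j) \<in> D \<longleftrightarrow> (i - fst v, j - snd v) \<in> ferrers p - ferrers q" for i j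
    unfolding D translate_def by (force simp: image_iff)
  have ferr: "(i, j) \<in> ferrers p \<longleftrightarrow> 0 \<le> i \<and> 0 \<le> j \<and> j < int (p (nat i))" for i j p
  proof
    assume h: "0 \<le> i \<and> 0 \<le> j \<and> j < int (p (nat i))"
    then have "i = int (nat i)" "j = int (nat j)" "nat j < p (nat i)" by auto
    then show "(i, j) \<in> ferrers p" unfolding ferrers_def by blast
  qed (auto simp: ferrers_def)
  have mono: "p i \<ge> p j" if "is_partition p" "i \<le> j" for p :: "nat \<Rightarrow> nat" and i j
    using that by (auto simp: is_partition_def antimono_def)
  show ?thesis
    unfolding order_convex_def
  proof (intro allI impI)
    fix i j i' j' a b
    assume h: "(i, j) \<in> D" "(i', j') \<in> D" "i \<le> a" "a \<le> i'" "j \<le> b" "b \<le> j'"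
    have "p (nat (i' - fst v)) \<le> p (nat (a - fst v))" by (rule mono[OF p]) (use h in auto)
    moreover have "q (nat (a - fst v)) \<le> q (nat (i - fst v))" by (rule mono[OF q]) (use h in auto)
    ultimately show "(a, b) \<in> D" using h unfolding mem Diff_iff ferr by auto
  qed
qed

text \<open>The cells that can be reached from \<open>x\<close> without passing an empty diagonal.
  In a \<open>layered\<close> diagram these are the connected components, by
  \<open>components_eq\<close>.\<close>

definition diag_component :: "diagram \<Rightarrow> cell \<Rightarrow> diagram" where
  "diag_component E x = {y \<in> E. \<forall>c. (diag x \<le> c \<and> c \<le> diag y) \<or> (diag y \<le> c \<and> c \<le> diag x) \<longrightarrow> c \<in> diag ` E}"

text \<open>What is left of a connected shape after peeling may fall apart. The assumption
  \<open>adjacent\<close> says that occupied neighbouring diagonals still touch, so a component can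
  end only at an empty diagonal.\<close>

locale layered =
  fixes E :: diagram
  assumes convex: "order_convex E"
    and adjacent: "c \<in> diag ` E \<Longrightarrow> c + 1 \<in> diag ` E \<Longrightarrow>
      \<exists>i. (i, i + c) \<in> E \<and> ((i, i + c + 1) \<in> E \<or> (i - 1, i + c) \<in> E)"
    and finite: "finite E"
begin

lemma connected_no_gap:
  assumes C: "C \<subseteq> E" "connected_diagram C" and x: "x \<in> C" "y \<in> C" and c: "diag x \<le> c" "c \<le> diag y"
  shows "c \<in> diag ` E"
proof (rule ccontr)
  assume no: "c \<notin> diag ` E"
  let ?A = "{z \<in> C. diag z < c}" and ?B = "{z \<in> C. c < diag z}"
  have "diag x \<noteq> c" "diag y \<noteq> c" using no x C by auto
  then have "?A \<noteq> {}" "?B \<noteq> {}" using x c by fastforce+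
  moreover have "C = ?A \<union> ?B" using no C by force
  moreover have "i2 < i1 \<and> j1 < j2" if "(i1, j1) \<in> ?A" "(i2, j2) \<in> ?B" for i1 j1 i2 j2
  proof (rule ccontr)
    assume not: "\<not> ?thesis"
    have "\<exists>i. (i, i + c) \<in> E \<and> ((i, i + c + 1) \<in> E \<or> (i - 1, i + c) \<in> E)"
      using order_convex_crossing[OF convex _ _ _ _ not, of c] that C(1) by auto
    then obtain i where "(i, i + c) \<in> E" by blast
    then have "diag (i, i + c) \<in> diag ` E" by blast
    then show False using no by simp
  qed
  ultimately have "is_direct_sum C ?A ?B" unfolding is_direct_sum_def by blast
  then show False using C(2) unfolding connected_diagram_def by blast
qed

lemma component_between:
  assumes "y \<in> diag_component E x" "z \<in> diag_component E x" "diag y \<le> c" "c \<le> diag z"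
  shows "c \<in> diag ` E"
proof -
  have y: "\<forall>c. (diag x \<le> c \<and> c \<le> diag y) \<or> (diag y \<le> c \<and> c \<le> diag x) \<longrightarrow> c \<in> diag ` E"
    and z: "\<forall>c. (diag x \<le> c \<and> c \<le> diag z) \<or> (diag z \<le> c \<and> c \<le> diag x) \<longrightarrow> c \<in> diag ` E"
    using assms(1,2) unfolding diag_component_def by auto
  show ?thesis
  proof (cases "c \<le> diag x")
    case True then show ?thesis using y assms(3) by blast
  next
    case False
    then have "diag x \<le> c" by simp
    then show ?thesis using z assms(4) by blast
  qed
qed

lemma component_extend:
  assumes y: "y \<in> diag_component E x" and z: "z \<in> E"
    and between: "\<And>c. (diag y \<le> c \<and> c \<le> diag z) \<or> (diag z \<le> c \<and> c \<le> diag y) \<Longrightarrow> c \<in> diag ` E"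
  shows "z \<in> diag_component E x"
proof -
  have y': "\<And>c. (diag x \<le> c \<and> c \<le> diag y) \<or> (diag y \<le> c \<and> c \<le> diag x) \<Longrightarrow> c \<in> diag ` E"
    using y unfolding diag_component_def by blast
  have "c \<in> diag ` E" if "(diag x \<le> c \<and> c \<le> diag z) \<or> (diag z \<le> c \<and> c \<le> diag x)" for c
    using y'[of c] between[of c] that by linarith
  then show ?thesis using z unfolding diag_component_def by blast
qed

lemma component_convex: "order_convex (diag_component E x)"
  unfolding order_convex_def
proof (intro allI impI)
  fix i j i' j' a b
  assume h: "(i, j) \<in> diag_component E x" "(i', j') \<in> diag_component E x"
    "i \<le> a" "a \<le> i'" "j \<le> b" "b \<le> j'"
  have E: "(i, j) \<in> E" "(i', j') \<in> E" using h by (auto simp: diag_component_def)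
  have ab: "(a, b) \<in> E" by (rule order_convexD[OF convex E h(3-6)])
  show "(a, b) \<in> diag_component E x"
  proof (rule component_extend[OF h(1) ab])
    fix c assume "(diag (i, j) \<le> c \<and> c \<le> diag (a, b)) \<or> (diag (a, b) \<le> c \<and> c \<le> diag (i, j))"
    then consider "j - i \<le> c" "c \<le> b - a" | "b - a \<le> c" "c \<le> j - i" by auto
    then show "c \<in> diag ` E"
    proof cases
      case 1
      have "(i, i + c) \<in> E" by (rule order_convexD[OF convex E(1) ab]) (use 1 h in auto)
      then have "diag (i, i + c) \<in> diag ` E" by blast
      then show ?thesis by simp
    next
      case 2
      have "(j - c, j) \<in> E" by (rule order_convexD[OF convex E(1) ab]) (use 2 h in auto)
      then have "diag (j - c, j) \<in> diag ` E" by blast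
      then show ?thesis by simp
    qed
  qed
qed

lemma component_connected: "connected_diagram (diag_component E x)"
  unfolding connected_diagram_def
proof safe
  fix A B assume sum: "is_direct_sum (diag_component E x) A B"
  then have C: "diag_component E x = A \<union> B" and ne: "A \<noteq> {}" "B \<noteq> {}"
    and AB: "\<And>i1 j1 i2 j2. (i1, j1) \<in> A \<Longrightarrow> (i2, j2) \<in> B \<Longrightarrow> i2 < i1 \<and> j1 < j2"
    unfolding is_direct_sum_def by blast+
  have "A \<subseteq> E" using C by (auto simp: diag_component_def)
  then have fin: "finite (diag ` A)" using finite finite_subset by blast
  \<comment> \<open>The last diagonal \<open>m\<close> of the southwestern summand touches diagonal
    \<open>m + 1\<close>, whose cells must lie in \<open>B\<close>; but a cell of \<open>A\<close>
    and a cell of \<open>B\<close> are never neighbours.\<close>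
  define m where "m = Max (diag ` A)"
  have "m \<in> diag ` A" unfolding m_def using fin ne by (intro Max_in) auto
  then obtain a where a: "a \<in> A" "diag a = m" by auto
  obtain b where b: "b \<in> B" using ne by blast
  have lt: "diag a + 1 < diag b'" if "b' \<in> B" for b'
    using AB[of "fst a" "snd a" "fst b'" "snd b'"] a that by (simp add: diag_def)
  have "m \<in> diag ` E" "m + 1 \<in> diag ` E"
    by (rule component_between[of a x b]; use a b lt[OF b] C in simp)+
  from adjacent[OF this] obtain i where i: "(i, i + m) \<in> E" "(i, i + m + 1) \<in> E \<or> (i - 1, i + m) \<in> E"
    by blast
  have mem: "z \<in> diag_component E x" if "z \<in> E" "diag z = m \<or> diag z = m + 1" for z
  proof (rule component_extend[of a, OF _ that(1)])
    show "a \<in> diag_component E x" using a C by simp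
    show "c \<in> diag ` E" if "(diag a \<le> c \<and> c \<le> diag z) \<or> (diag z \<le> c \<and> c \<le> diag a)" for c
      using that \<open>diag z = m \<or> diag z = m + 1\<close> a(2) \<open>m \<in> diag ` E\<close> \<open>m + 1 \<in> diag ` E\<close>
      by (metis order_antisym zle_add1_eq_le order_le_less)
  qed
  have A1: "(i, i + m) \<in> A"
  proof (rule ccontr)
    assume "\<not> ?thesis"
    then have "(i, i + m) \<in> B" using mem[OF i(1)] C by auto
    then show False using lt[of "(i, i + m)"] a by simp
  qed
  have B1: "z \<in> B" if "z \<in> E" "diag z = m + 1" for z
  proof (rule ccontr)
    assume "z \<notin> B"
    then have "z \<in> A" using mem[OF that(1)] that C by auto
    then have "m + 1 \<le> m" using fin that(2) unfolding m_def by (metis Max_ge imageI)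
    then show False by simp
  qed
  from i(2) show False
  proof
    assume "(i, i + m + 1) \<in> E"
    then show False using B1[of "(i, i + m + 1)"] AB[OF A1] by fastforce
  next
    assume "(i - 1, i + m) \<in> E"
    then show False using B1[of "(i - 1, i + m)"] AB[OF A1] by fastforce
  qed
qed

lemma connected_subset_component:
  assumes "C \<subseteq> E" "connected_diagram C" "x \<in> C"
  shows "C \<subseteq> diag_component E x"
  using connected_no_gap[OF assms(1,2)] assms unfolding diag_component_def by blast

lemma component_subset: "diag_component E x \<subseteq> E"
  by (auto simp: diag_component_def)

lemma component_self: "x \<in> E \<Longrightarrow> x \<in> diag_component E x"
  unfolding diag_component_def by auto

lemma components_eq: "components E = diag_component E ` E"
proof (intro subset_antisym subsetI)
  fix C assume "C \<in> components E"
  then have C: "C \<noteq> {}" "C \<subseteq> E" "connected_diagram C"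
    and max: "\<And>C'. C \<subseteq> C' \<Longrightarrow> C' \<subseteq> E \<Longrightarrow> connected_diagram C' \<Longrightarrow> C' = C"
    unfolding components_def by blast+
  obtain x where x: "x \<in> C" using C by blast
  have "diag_component E x = C"
    by (rule max[OF connected_subset_component[OF C(2,3) x] _ component_connected])
      (auto simp: diag_component_def)
  then show "C \<in> diag_component E ` E" using x C by blast
next
  fix C assume "C \<in> diag_component E ` E"
  then obtain x where x: "x \<in> E" "C = diag_component E x" by blast
  have "C' = C" if "C \<subseteq> C'" "C' \<subseteq> E" "connected_diagram C'" for C'
  proof -
    have "x \<in> C'" using component_self x that by blast
    then show ?thesis using connected_subset_component[OF that(2,3)] that(1) x by blast
  qed
  then show "C \<in> components E"
    unfolding components_def using x component_connected component_self[OF x(1)] component_subset by blast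
qed

lemma component_shape: "C \<in> components E \<Longrightarrow> connected_shape C"
  unfolding components_eq
  using component_convex component_connected component_self finite
  by unfold_locales (auto simp: diag_component_def)

text \<open>The diagonals next to that of \<open>y\<close> are included since each is either part of
  the component or empty in both diagrams. Rises and falls of the sizes can then be read off
  componentwise.\<close>

lemma component_size:
  assumes y: "y \<in> diag_component E x" and c: "diag y - 1 \<le> c" "c \<le> diag y + 1"
  shows "diag_size (diag_component E x) c = diag_size E c"
proof -
  have "(i, i + c) \<in> diag_component E x" if "(i, i + c) \<in> E" for i
  proof (rule component_extend[OF y that])
    fix d assume d: "(diag y \<le> d \<and> d \<le> diag (i, i + c)) \<or> (diag (i, i + c) \<le> d \<and> d \<le> diag y)"
    then have "d = diag y \<or> d = c" using c by auto
    moreover have "diag (i, i + c) \<in> diag ` E" using that by blast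
    moreover have "diag y \<in> diag ` E" using y by (auto simp: diag_component_def)
    ultimately show "d \<in> diag ` E" by auto
  qed
  then have "diag_rows (diag_component E x) c = diag_rows E c"
    by (auto simp: diag_rows_def diag_component_def)
  then show ?thesis by (simp add: diag_size_def)
qed

lemma diag_size_pos: "0 < diag_size E c \<Longrightarrow> \<exists>y\<in>E. diag y = c"
proof -
  assume "0 < diag_size E c"
  then have "diag_rows E c \<noteq> {}" by (auto simp: diag_size_def)
  then obtain i where "(i, i + c) \<in> E" by (auto simp: diag_rows_def)
  then show "\<exists>y\<in>E. diag y = c" by (intro bexI[of _ "(i, i + c)"]) auto
qed

lemma component_size_pos: "0 < diag_size (diag_component E x) c \<Longrightarrow> \<exists>y\<in>diag_component E x. diag y = c"
proof -
  assume "0 < diag_size (diag_component E x) c"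
  then have "diag_rows (diag_component E x) c \<noteq> {}" by (auto simp: diag_size_def)
  then obtain i where "(i, i + c) \<in> diag_component E x" by (auto simp: diag_rows_def)
  then show ?thesis by (intro bexI[of _ "(i, i + c)"]) auto
qed

lemma diag_starts_components: "diag_starts E = (\<Union>C\<in>components E. diag_starts C)"
  and diag_ends_components: "diag_ends E = (\<Union>C\<in>components E. diag_ends C)"
proof -
  have "diag_size E d < diag_size E c \<longleftrightarrow> (\<exists>C\<in>components E. diag_size C d < diag_size C c)"
    if d: "d = c - 1 \<or> d = c + 1" for c d
  proof
    assume lt: "diag_size E d < diag_size E c"
    then obtain y where y: "y \<in> E" "diag y = c" using diag_size_pos[of c] by auto
    then have "diag_size (diag_component E y) d < diag_size (diag_component E y) c"
      using component_size[OF component_self[OF y(1)], of d] component_size[OF component_self[OF y(1)], of c] d lt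
      by auto
    then show "\<exists>C\<in>components E. diag_size C d < diag_size C c" using y unfolding components_eq by blast
  next
    assume "\<exists>C\<in>components E. diag_size C d < diag_size C c"
    then obtain x where x: "diag_size (diag_component E x) d < diag_size (diag_component E x) c"
      unfolding components_eq by blast
    then obtain y where "y \<in> diag_component E x" "diag y = c" using component_size_pos[of x c] by auto
    then show "diag_size E d < diag_size E c"
      using component_size[of y x c] component_size[of y x d] x d by auto
  qed
  then show "diag_starts E = (\<Union>C\<in>components E. diag_starts C)" "diag_ends E = (\<Union>C\<in>components E. diag_ends C)"
    unfolding diag_starts_def diag_ends_def by auto
qed

end

section \<open>Peeling off the border\<close>

lemma border_subset: "border x D \<subseteq> D"
  by (cases x) auto

lemma mem_border_SE: "(i, j) \<in> border SE D \<longleftrightarrow> (i, j) \<in> D \<and> (i + 1, j + 1) \<notin> D"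
  and mem_border_NW: "(i, j) \<in> border NW D \<longleftrightarrow> (i, j) \<in> D \<and> (i - 1, j - 1) \<notin> D"
  by auto

declare border.simps [simp del]

context connected_shape
begin

lemma border_SE_iff: "(i, j) \<in> border SE D \<longleftrightarrow> (i, j) \<in> D \<and> i = r (j - i)"
  using cell_iff[of i j] cell_iff[of "i + 1" "j + 1"] by (auto simp: mem_border_SE)

lemma south_cell: "L \<le> c \<Longrightarrow> c \<le> R \<Longrightarrow> (r c, r c + c) \<in> border SE D"
  using rows_eq(2)[of c] unfolding border_SE_iff cell_diag_iff by simp

lemma diag_border_SE: "diag ` border SE D = {L..R}"
proof (intro subset_antisym subsetI)
  fix c assume "c \<in> diag ` border SE D"
  then show "c \<in> {L..R}" using diag_image image_mono[OF border_subset, of diag SE D] by blast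
next
  fix c assume "c \<in> {L..R}"
  then have "diag (r c, r c + c) \<in> diag ` border SE D" using south_cell by (intro imageI) auto
  then show "c \<in> diag ` border SE D" by simp
qed

lemma inner_iff: "(i, i + c) \<in> D - border SE D \<longleftrightarrow> r c - int (n c) < i \<and> i < r c"
  unfolding Diff_iff border_SE_iff cell_diag_iff by auto

lemma inner_size: "diag_size (D - border SE D) c = n c - 1"
proof -
  have "diag_rows (D - border SE D) c = {r c - int (n c) <..< r c}"
    unfolding diag_rows_def inner_iff by auto
  then show ?thesis by (simp add: diag_size_def nat_diff_distrib)
qed

lemma inner_mem: "(i, j) \<in> D - border SE D \<longleftrightarrow> (i, j) \<in> D \<and> (i + 1, j + 1) \<in> D"
  by (auto simp: mem_border_SE)

text \<open>The cells just northwest of the border repeat its steps, so they touch on neighbouring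
  diagonals that are both still occupied.\<close>

lemma inner_layered: "layered (D - border SE D)"
proof
  show "Finite_Set.finite (D - border SE D)" using finite by simp
  show "order_convex (D - border SE D)"
    unfolding order_convex_def inner_mem
  proof (intro allI impI conjI; elim conjE)
    fix i j i' j' a b
    assume h: "i \<le> a" "a \<le> i'" "j \<le> b" "b \<le> j'" and m: "(i, j) \<in> D" "(i + 1, j + 1) \<in> D" "(i', j') \<in> D" "(i' + 1, j' + 1) \<in> D"
    show "(a, b) \<in> D" by (rule order_convexD[OF convex m(1,3) h])
    show "(a + 1, b + 1) \<in> D" by (rule order_convexD[OF convex m(2,4)]) (use h in auto)
  qed
  fix c assume c: "c \<in> diag ` (D - border SE D)" "c + 1 \<in> diag ` (D - border SE D)"
  have pos: "1 < n d" "L \<le> d" "d \<le> R" if d: "d \<in> diag ` (D - border SE D)" for d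
  proof -
    from d obtain x where x: "x \<in> D - border SE D" "d = diag x" by blast
    moreover obtain i j where "x = (i, j)" by fastforce
    ultimately have "(i, j) \<in> D - border SE D" "d = j - i" by simp_all
    then have "(i, i + d) \<in> D - border SE D" by simp
    then show "1 < n d" unfolding inner_iff by simp
    then show "L \<le> d" "d \<le> R" using size_outside[of d] by force+
  qed
  let ?E = "D - border SE D"
  have cells: "(r c - 1, (r c - 1) + c) \<in> ?E" "(r (c + 1) - 1, (r (c + 1) - 1) + (c + 1)) \<in> ?E"
    unfolding inner_iff using pos(1)[OF c(1)] pos(1)[OF c(2)] by auto
  have "r (c + 1) = r c \<or> r (c + 1) = r c - 1" using row_step[of c] pos c by force
  then show "\<exists>i. (i, i + c) \<in> ?E \<and> ((i, i + c + 1) \<in> ?E \<or> (i - 1, i + c) \<in> ?E)"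
  proof
    assume "r (c + 1) = r c"
    then show ?thesis using cells by (intro exI[of _ "r c - 1"]) (simp add: algebra_simps)
  next
    assume north: "r (c + 1) = r c - 1"
    have "(r c - 1 - 1) + (c + 1) = (r c - 1) + c" by simp
    then have "(r c - 1 - 1, (r c - 1) + c) \<in> ?E" using cells(2) unfolding north by (simp only:)
    then show ?thesis using cells(1) by blast
  qed
qed

text \<open>Every positive size drops by one and the sizes outside stay 0. A comparison of
  neighbouring diagonals can change only between an empty and an occupied one, that is, at the rise
  at \<open>L\<close> and the fall at \<open>R\<close>.\<close>

lemma diag_starts_inner: "diag_starts D = insert L (diag_starts (D - border SE D))"
  and diag_ends_inner: "diag_ends D = insert R (diag_ends (D - border SE D))"
proof -
  have pos: "0 < n c \<longleftrightarrow> L \<le> c \<and> c \<le> R" for c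
    using rows_eq(2)[of c] size_outside[of c] by force
  have "n (c - 1) < n c \<longleftrightarrow> c = L \<or> n (c - 1) - 1 < n c - 1" for c
    using pos[of c] pos[of "c - 1"] size_ends(1) by (cases "c = L") auto
  then show "diag_starts D = insert L (diag_starts (D - border SE D))"
    unfolding diag_starts_def inner_size by auto
  have "n (c + 1) < n c \<longleftrightarrow> c = R \<or> n (c + 1) - 1 < n c - 1" for c
    using pos[of c] pos[of "c + 1"] size_ends(2) by (cases "c = R") auto
  then show "diag_ends D = insert R (diag_ends (D - border SE D))"
    unfolding diag_ends_def inner_size by auto
qed

lemma decomposition_unfold:
  "decomposition x D = insert (border x D) (\<Union>C\<in>components (D - border x D). decomposition x C)"
proof (intro subset_antisym subsetI)
  fix \<rho> assume "\<rho> \<in> decomposition x D"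
  then have "decomposition_ribbon x D \<rho>" by (simp add: decomposition_def)
  then show "\<rho> \<in> insert (border x D) (\<Union>C\<in>components (D - border x D). decomposition x C)"
    by cases (auto simp: decomposition_def)
next
  fix \<rho> assume "\<rho> \<in> insert (border x D) (\<Union>C\<in>components (D - border x D). decomposition x C)"
  then show "\<rho> \<in> decomposition x D"
    using decomposition_ribbon.first[OF nonempty connected] decomposition_ribbon.iterate[OF connected]
    by (auto simp: decomposition_def)
qed

end

text \<open>Each peeled ribbon accounts for one rise and one fall of the sizes. Only the sets of
  first and of last diagonals are compared; which of them belong to the same ribbon is left
  open.\<close>

lemma decomposition_SE_range:
  assumes "connected_shape D"
  shows "(\<lambda>\<rho>. Min (diag ` \<rho>)) ` decomposition SE D = diag_starts D" (is "?P D")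
    "(\<lambda>\<rho>. Max (diag ` \<rho>)) ` decomposition SE D = diag_ends D" (is "?Q D")
proof -
  have "?P D \<and> ?Q D"
    using assms
  proof (induction "card D" arbitrary: D rule: less_induct)
    case less
    interpret connected_shape D by fact
    let ?E = "D - border SE D"
    interpret E: layered ?E by (rule inner_layered)
    have "border SE D \<noteq> {}" using south_cell[of L] LR(1) by blast
    moreover have "border SE D \<subseteq> D" by (rule border_subset)
    ultimately have "card ?E < card D" using finite by (intro psubset_card_mono) auto
    then have IH: "?P C" "?Q C" if "C \<in> components ?E" for C
    proof -
      have "C \<subseteq> ?E" using that by (simp add: components_def)
      then have "card C \<le> card ?E" using E.finite by (intro card_mono)
      then show "?P C" "?Q C"
        using less.hyps[of C] E.component_shape[OF that] \<open>card ?E < card D\<close> by simp_all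
    qed
    have "Min {L..R} = L" "Max {L..R} = R" using LR(1) by (auto intro!: Min_eqI Max_eqI)
    then show ?case
      unfolding decomposition_unfold diag_starts_inner diag_ends_inner
        E.diag_starts_components E.diag_ends_components image_insert image_UN diag_border_SE
      using IH by simp
  qed
  then show "?P D" "?Q D" by auto
qed

section \<open>Rotation by a half turn\<close>

definition rot :: "diagram \<Rightarrow> diagram" where
  "rot D = (\<lambda>(i, j). (- i, - j)) ` D"

fun opposite :: "side \<Rightarrow> side" where
  "opposite SE = NW"
| "opposite NW = SE"

lemma mem_rot: "(i, j) \<in> rot D \<longleftrightarrow> (- i, - j) \<in> D"
  unfolding rot_def by (force simp: image_iff)

lemma rot_rot [simp]: "rot (rot D) = D"
  by (auto simp: mem_rot)

lemma rot_Diff: "rot (A - B) = rot A - rot B"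
  by (auto simp: mem_rot)

lemma rot_subset_iff: "rot A \<subseteq> rot B \<longleftrightarrow> A \<subseteq> B"
proof -
  have "rot A \<subseteq> rot B" if "A \<subseteq> B" for A B using that by (auto simp: rot_def)
  from this[of A B] this[of "rot A" "rot B"] show ?thesis by auto
qed

lemma rot_empty_iff [simp]: "rot A = {} \<longleftrightarrow> A = {}"
  by (simp add: rot_def)

lemma diag_rot: "diag ` rot D = uminus ` diag ` D"
  unfolding rot_def by (force simp: image_iff diag_def)

lemma connected_rot: "connected_diagram D \<Longrightarrow> connected_diagram (rot D)"
proof -
  assume D: "connected_diagram D"
  have "is_direct_sum D (rot B) (rot A)" if "is_direct_sum (rot D) A B" for A B
  proof -
    from that have s: "rot D = A \<union> B" "A \<noteq> {}" "B \<noteq> {}"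
      and AB: "\<And>i1 j1 i2 j2. (i1, j1) \<in> A \<Longrightarrow> (i2, j2) \<in> B \<Longrightarrow> i2 < i1 \<and> j1 < j2"
      unfolding is_direct_sum_def by blast+
    have "rot (rot D) = rot A \<union> rot B" unfolding s(1) by (auto simp: mem_rot)
    then have "D = rot B \<union> rot A" by auto
    moreover have "i2 < i1 \<and> j1 < j2" if "(i1, j1) \<in> rot B" "(i2, j2) \<in> rot A" for i1 j1 i2 j2
      using AB[of "- i2" "- j2" "- i1" "- j1"] that by (simp add: mem_rot)
    ultimately show ?thesis using s(2,3) unfolding is_direct_sum_def by auto
  qed
  then show "connected_diagram (rot D)" using D unfolding connected_diagram_def by blast
qed

lemma border_rot: "border (opposite x) (rot D) = rot (border x D)"
  by (cases x) (auto simp: mem_rot mem_border_SE mem_border_NW)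

lemma components_rot: "C \<in> components D \<Longrightarrow> rot C \<in> components (rot D)"
proof -
  assume "C \<in> components D"
  then have C: "C \<noteq> {}" "C \<subseteq> D" "connected_diagram C"
    and max: "\<And>C'. C \<subseteq> C' \<Longrightarrow> C' \<subseteq> D \<Longrightarrow> connected_diagram C' \<Longrightarrow> C' = C"
    unfolding components_def by blast+
  have "C' = rot C" if "rot C \<subseteq> C'" "C' \<subseteq> rot D" "connected_diagram C'" for C'
  proof -
    have "rot C' = C"
      by (rule max) (use that rot_subset_iff[of "rot C" C'] rot_subset_iff[of C' "rot D"] connected_rot in auto)
    then show ?thesis by auto
  qed
  then show "rot C \<in> components (rot D)"
    unfolding components_def using C connected_rot by (auto simp: rot_subset_iff)
qed

lemma decomposition_ribbon_rot:
  "decomposition_ribbon x D \<rho> \<Longrightarrow> decomposition_ribbon (opposite x) (rot D) (rot \<rho>)"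
proof (induction rule: decomposition_ribbon.induct)
  case (first D)
  then show ?case
    unfolding border_rot[symmetric] by (intro decomposition_ribbon.first connected_rot) auto
next
  case (iterate D C \<rho>)
  have "rot C \<in> components (rot D - border (opposite x) (rot D))"
    using components_rot[OF iterate(2)] by (simp add: border_rot rot_Diff)
  then show ?case using decomposition_ribbon.iterate connected_rot[OF iterate(1)] iterate.IH by blast
qed

lemma decomposition_rot: "decomposition (opposite x) (rot D) = rot ` decomposition x D"
proof (intro subset_antisym subsetI)
  fix \<rho> assume "\<rho> \<in> decomposition (opposite x) (rot D)"
  then have "decomposition_ribbon (opposite (opposite x)) (rot (rot D)) (rot \<rho>)"
    using decomposition_ribbon_rot unfolding decomposition_def by blast
  then have "rot \<rho> \<in> decomposition x D" by (cases x) (auto simp: decomposition_def)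
  then show "\<rho> \<in> rot ` decomposition x D" by (intro image_eqI[of _ _ "rot \<rho>"]) auto
qed (use decomposition_ribbon_rot in \<open>auto simp: decomposition_def\<close>)

lemma connected_shape_rot: "connected_shape D \<Longrightarrow> connected_shape (rot D)"
proof -
  assume "connected_shape D"
  then interpret connected_shape D .
  show ?thesis
  proof
    show "Finite_Set.finite (rot D)" using finite by (simp add: rot_def)
    show "connected_diagram (rot D)" by (rule connected_rot[OF connected])
    show "rot D \<noteq> {}" using nonempty by simp
    show "order_convex (rot D)"
      unfolding order_convex_def mem_rot
    proof (intro allI impI)
      fix i j i' j' a b
      assume h: "(- i, - j) \<in> D" "(- i', - j') \<in> D" "i \<le> a" "a \<le> i'" "j \<le> b" "b \<le> j'"
      show "(- a, - b) \<in> D" by (rule order_convexD[OF convex h(2,1)]) (use h in auto)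
    qed
  qed
qed

lemma diag_size_rot: "diag_size (rot D) c = diag_size D (- c)"
proof -
  have "diag_rows (rot D) c = uminus ` diag_rows D (- c)"
    unfolding diag_rows_def mem_rot by (auto intro!: image_eqI[of _ _ "- _"])
  then show ?thesis unfolding diag_size_def by (simp add: card_image)
qed

lemma diag_starts_rot: "diag_starts (rot D) = uminus ` diag_ends D"
  and diag_ends_rot: "diag_ends (rot D) = uminus ` diag_starts D"
proof -
  have *: "A = uminus ` B" if "\<And>c. c \<in> A \<longleftrightarrow> - c \<in> B" for A B :: "int set"
  proof (rule set_eqI)
    fix c
    have "c \<in> uminus ` B \<longleftrightarrow> - c \<in> B" by (metis (no_types) imageE imageI minus_minus)
    then show "c \<in> A \<longleftrightarrow> c \<in> uminus ` B" using that by simp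
  qed
  have e: "- (c - 1) = - c + 1" "- (c + 1) = - c - 1" for c :: int by simp_all
  show "diag_starts (rot D) = uminus ` diag_ends D"
    by (rule *) (simp only: diag_starts_def diag_ends_def diag_size_rot mem_Collect_eq e)
  show "diag_ends (rot D) = uminus ` diag_starts D"
    by (rule *) (simp only: diag_starts_def diag_ends_def diag_size_rot mem_Collect_eq e)
qed

lemma border_nonempty:
  assumes "finite D" "D \<noteq> {}"
  shows "border x D \<noteq> {}"
proof -
  have SE: "border SE D \<noteq> {}" if "finite D" "D \<noteq> {}" for D
  proof -
    have fin: "finite (fst ` D)" "fst ` D \<noteq> {}" using that by auto
    then have "Max (fst ` D) \<in> fst ` D" by (rule Max_in)
    then obtain j where j: "(Max (fst ` D), j) \<in> D" by force
    have "(Max (fst ` D) + 1, j + 1) \<notin> D"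
    proof
      assume "(Max (fst ` D) + 1, j + 1) \<in> D"
      then have "fst (Max (fst ` D) + 1, j + 1) \<le> Max (fst ` D)" using fin by (intro Max_ge imageI)
      then show False by simp
    qed
    then show ?thesis using j mem_border_SE by blast
  qed
  show ?thesis
  proof (cases x)
    case NW
    have "border SE (rot D) \<noteq> {}" using assms by (intro SE) (auto simp: rot_def)
    then show ?thesis using border_rot[of NW D] NW by simp
  qed (use SE assms in simp)
qed

lemma decomposition_ribbon_nonempty:
  "decomposition_ribbon x D \<rho> \<Longrightarrow> finite D \<Longrightarrow> finite \<rho> \<and> \<rho> \<noteq> {} \<and> \<rho> \<subseteq> D"
proof (induction rule: decomposition_ribbon.induct)
  case (first D)
  then show ?case using border_nonempty[of D x] border_subset[of x D] finite_subset by blast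
next
  case (iterate D C \<rho>)
  then have "C \<subseteq> D" by (auto simp: components_def)
  then show ?case using iterate finite_subset by blast
qed

text \<open>The sizes of the diagonals do not refer to a side, so both decompositions have the same
  first and last diagonals. In the northwest case a half turn negates the diagonals and exchanges
  minima with maxima.\<close>

lemma decomposition_range:
  assumes D: "connected_shape D"
  shows "(\<lambda>\<rho>. Min (diag ` \<rho>)) ` decomposition x D = diag_starts D" (is ?P)
    "(\<lambda>\<rho>. Max (diag ` \<rho>)) ` decomposition x D = diag_ends D" (is ?Q)
proof -
  have "?P \<and> ?Q"
  proof (cases x)
    case SE
    then show ?thesis using decomposition_SE_range[OF D] by simp
  next
    case NW
    have D': "connected_shape (rot D)" by (rule connected_shape_rot[OF D])
    have dec: "decomposition SE (rot D) = rot ` decomposition NW D"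
      using decomposition_rot[of NW D] by simp
    have mm: "Min (diag ` rot \<rho>) = - Max (diag ` \<rho>)" "Max (diag ` rot \<rho>) = - Min (diag ` \<rho>)"
      if "\<rho> \<in> decomposition NW D" for \<rho>
    proof -
      have "finite \<rho> \<and> \<rho> \<noteq> {}"
        using decomposition_ribbon_nonempty that D by (auto simp: decomposition_def connected_shape_def)
      then have "finite (diag ` \<rho>)" "diag ` \<rho> \<noteq> {}" by auto
      then show "Min (diag ` rot \<rho>) = - Max (diag ` \<rho>)" "Max (diag ` rot \<rho>) = - Min (diag ` \<rho>)"
        unfolding diag_rot by (auto intro!: Min_eqI Max_eqI)
    qed
    have neg: "uminus ` A = uminus ` B \<Longrightarrow> A = B" for A B :: "int set"
      using inj_image_eq_iff[of uminus A B] by (simp add: inj_def)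
    have ends: "uminus ` (\<lambda>\<rho>. Max (diag ` \<rho>)) ` decomposition NW D = uminus ` diag_ends D"
      using decomposition_SE_range(1)[OF D'] unfolding dec diag_starts_rot image_image by (simp add: mm)
    have starts: "uminus ` (\<lambda>\<rho>. Min (diag ` \<rho>)) ` decomposition NW D = uminus ` diag_starts D"
      using decomposition_SE_range(2)[OF D'] unfolding dec diag_ends_rot image_image by (simp add: mm)
    show ?thesis unfolding NW by (intro conjI neg[OF starts] neg[OF ends])
  qed
  then show ?P ?Q by auto
qed


section \<open>Fillings under a half turn\<close>

lemma skew_schur_rot:
  assumes fin: "finite D" and N: "\<And>v. v \<in># M \<Longrightarrow> v \<le> N"
  shows "skew_schur D M \<le> skew_schur (rot D) (image_mset (\<lambda>v. N - v) M)"
proof -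
  \<comment> \<open>The half turn reverses rows and columns, and complementing the entries restores
    both monotonicity conditions. Since \<open>N\<close> bounds the entries of \<open>M\<close>, the
    subtraction is never truncated and strictness survives.\<close>
  define \<Phi> where "\<Phi> T = restrict (\<lambda>(i, j). N - T (- i, - j)) (rot D)" for T :: "cell \<Rightarrow> nat"
  let ?A = "{T \<in> column_strict_fillings D. image_mset T (mset_set D) = M}"
  let ?B = "{T \<in> column_strict_fillings (rot D). image_mset T (mset_set (rot D)) = image_mset (\<lambda>v. N - v) M}"
  have bound: "T x \<le> N" if "T \<in> ?A" "x \<in> D" for T x
    using that N fin by force
  have finB: "finite ?B"
  proof (rule finite_subset)
    show "?B \<subseteq> (rot D \<rightarrow>\<^sub>E (\<lambda>v. N - v) ` set_mset M)"
    proof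
      fix T assume T: "T \<in> ?B"
      have "T x \<in> (\<lambda>v. N - v) ` set_mset M" if "x \<in> rot D" for x
      proof -
        have "T x \<in># image_mset T (mset_set (rot D))" using that fin by (auto simp: rot_def)
        moreover have "image_mset T (mset_set (rot D)) = image_mset (\<lambda>v. N - v) M" using T by simp
        ultimately have "T x \<in># image_mset (\<lambda>v. N - v) M" by (simp only:)
        then show ?thesis by simp
      qed
      then show "T \<in> rot D \<rightarrow>\<^sub>E (\<lambda>v. N - v) ` set_mset M"
        using T by (auto simp: PiE_def column_strict_fillings_def)
    qed
    show "finite (rot D \<rightarrow>\<^sub>E (\<lambda>v. N - v) ` set_mset M)"
      using fin by (intro finite_PiE) (auto simp: rot_def)
  qed
  have "card ?A \<le> card ?B"
  proof (rule card_inj_on_le[OF _ _ finB])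
    show "inj_on \<Phi> ?A"
    proof (rule inj_onI)
      fix T U assume T: "T \<in> ?A" and U: "U \<in> ?A" and eq: "\<Phi> T = \<Phi> U"
      show "T = U"
      proof (rule extensionalityI)
        show "T \<in> extensional D" "U \<in> extensional D" using T U by (auto simp: column_strict_fillings_def)
        fix x assume x: "x \<in> D"
        obtain i j where ij: "x = (i, j)" by fastforce
        have "N - T x = N - U x" using fun_cong[OF eq, of "(- i, - j)"] x ij by (simp add: \<Phi>_def mem_rot)
        then show "T x = U x" using bound[OF T x] bound[OF U x] by simp
      qed
    qed
    show "\<Phi> ` ?A \<subseteq> ?B"
    proof
      fix U assume "U \<in> \<Phi> ` ?A"
      then obtain T where T: "T \<in> ?A" "U = \<Phi> T" by blast
      then have cs: "T \<in> column_strict_fillings D" by simp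
      have val: "U (i, j) = N - T (- i, - j)" if "(i, j) \<in> rot D" for i j using that T by (simp add: \<Phi>_def)
      have "U \<in> column_strict_fillings (rot D)"
        unfolding column_strict_fillings_def mem_Collect_eq
      proof (intro conjI allI impI)
        show "U \<in> extensional (rot D)" using T by (simp add: \<Phi>_def)
        fix i j j' assume h: "(i, j) \<in> rot D \<and> (i, j') \<in> rot D \<and> j \<le> j'"
        then have "T (- i, - j') \<le> T (- i, - j)" using cs unfolding column_strict_fillings_def mem_rot by simp
        then show "U (i, j) \<le> U (i, j')" using h val by simp
      next
        fix i i' j assume h: "(i, j) \<in> rot D \<and> (i', j) \<in> rot D \<and> i < i'"
        then have "T (- i', - j) < T (- i, - j)" using cs unfolding column_strict_fillings_def mem_rot by simp
        moreover have "T (- i, - j) \<le> N" using bound[OF T(1), of "(- i, - j)"] h by (simp add: mem_rot)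
        ultimately show "U (i, j) < U (i', j)" using h val by simp
      qed
      moreover have "image_mset U (mset_set (rot D)) = image_mset (\<lambda>v. N - v) M"
      proof -
        have "inj_on (\<lambda>(i, j). (- i :: int, - j :: int)) D" by (auto simp: inj_on_def)
        then have "mset_set (rot D) = image_mset (\<lambda>(i, j). (- i, - j)) (mset_set D)"
          unfolding rot_def by (simp add: image_mset_mset_set)
        then have "image_mset U (mset_set (rot D)) = image_mset (\<lambda>x. U (case x of (i, j) \<Rightarrow> (- i, - j))) (mset_set D)"
          by (simp add: image_mset.compositionality o_def)
        also have "\<dots> = image_mset (\<lambda>x. N - T x) (mset_set D)"
          by (rule image_mset_cong) (use fin val in \<open>auto simp: mem_rot\<close>)
        also have "\<dots> = image_mset (\<lambda>v. N - v) (image_mset T (mset_set D))"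
          by (simp add: image_mset.compositionality o_def)
        finally show ?thesis using T by simp
      qed
      ultimately show "U \<in> ?B" by blast
    qed
  qed
  then show ?thesis by (simp add: skew_schur_def)
qed

text \<open>Complementing twice restores \<open>M\<close>, so the injection can be used in both
  directions.\<close>

lemma skew_schur_rot_eq:
  assumes fin: "finite D" and N: "\<And>v. v \<in># M \<Longrightarrow> v \<le> N"
  shows "skew_schur (rot D) (image_mset (\<lambda>v. N - v) M) = skew_schur D M"
proof (rule antisym)
  have "skew_schur (rot D) (image_mset (\<lambda>v. N - v) M) \<le>
      skew_schur (rot (rot D)) (image_mset (\<lambda>v. N - v) (image_mset (\<lambda>v. N - v) M))"
    by (rule skew_schur_rot) (use fin in \<open>auto simp: rot_def\<close>)
  also have "image_mset (\<lambda>v. N - v) (image_mset (\<lambda>v. N - v) M) = image_mset (\<lambda>v. v) M"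
    unfolding image_mset.compositionality by (rule image_mset_cong) (use N in auto)
  finally show "skew_schur (rot D) (image_mset (\<lambda>v. N - v) M) \<le> skew_schur D M" by simp
  show "skew_schur D M \<le> skew_schur (rot D) (image_mset (\<lambda>v. N - v) M)"
    by (rule skew_schur_rot[OF assms])
qed

lemma schur_equivalent_rot:
  assumes "finite D" "finite D'" "rot D \<sim> rot D'"
  shows "D \<sim> D'"
  unfolding schur_equivalent_def
proof
  fix M :: "nat multiset"
  have N: "v \<le> Max (set_mset M)" if "v \<in># M" for v using that by simp
  show "skew_schur D M = skew_schur D' M"
    using skew_schur_rot_eq[OF assms(1) N] skew_schur_rot_eq[OF assms(2) N] assms(3)
    by (simp add: schur_equivalent_def)
qed

text \<open>Reads a step off the ribbon itself and so makes sense for either border, whereas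
  \<open>east_step\<close> refers to the southernmost rows.\<close>

definition goes_east :: "diagram \<Rightarrow> int \<Rightarrow> bool" where
  "goes_east \<theta> c \<longleftrightarrow> (\<exists>i. (i, i + c) \<in> \<theta> \<and> (i, i + c + 1) \<in> \<theta>)"

text \<open>The step from \<open>c\<close> to \<open>c + 1\<close> turns into the one between
  \<open>- c - 1\<close> and \<open>- c\<close>, hence the shift by one.\<close>

lemma goes_east_rot: "goes_east (rot \<theta>) c \<longleftrightarrow> goes_east \<theta> (- c - 1)"
proof -
  have e: "- i + (- c - 1) = - (i + c + 1)" "- (i + c + 1) + 1 = - (i + c)" for i by simp_all
  have e3: "i + (- c - 1) = i - c - 1" for i by simp
  show ?thesis
  proof
    assume "goes_east (rot \<theta>) c"
    then obtain i where "(- i, - (i + c)) \<in> \<theta>" "(- i, - (i + c + 1)) \<in> \<theta>"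
      unfolding goes_east_def mem_rot by blast
    then show "goes_east \<theta> (- c - 1)"
      unfolding goes_east_def by (intro exI[of _ "- i"]) (simp only: e simp_thms)
  next
    assume "goes_east \<theta> (- c - 1)"
    then obtain i where "(i, i + (- c - 1)) \<in> \<theta>" "(i, i + (- c - 1) + 1) \<in> \<theta>"
      unfolding goes_east_def by blast
    then show "goes_east (rot \<theta>) c"
      using e3[of i] unfolding goes_east_def mem_rot by (intro exI[of _ "- i"]) simp
  qed
qed

context connected_shape
begin

lemma east_step_border:
  assumes "L \<le> c" "c < R"
  shows "east_step D c \<longleftrightarrow> goes_east (border SE D) c"
proof -
  have "goes_east (border SE D) c \<longleftrightarrow> r (c + 1) = r c"
  proof
    assume "goes_east (border SE D) c"
    then obtain i where "(i, i + c) \<in> border SE D" "(i, i + c + 1) \<in> border SE D" by (auto simp: goes_east_def)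
    then have "i = r (i + c - i)" "i = r (i + c + 1 - i)" unfolding border_SE_iff by blast+
    then show "r (c + 1) = r c" by simp
  next
    assume "r (c + 1) = r c"
    then show "goes_east (border SE D) c"
      using south_cell[of c] south_cell[of "c + 1"] assms unfolding goes_east_def
      by (intro exI[of _ "r c"]) (simp add: algebra_simps)
  qed
  then show ?thesis using assms by (simp add: east_step_def flip: L_def R_def)
qed

end

lemma schur_equivalent_reflect_SE:
  assumes D: "connected_shape D" and D': "connected_shape D'"
    and starts: "diag_starts D' = (\<lambda>x. \<kappa> - x) ` diag_ends D"
    and ends: "diag_ends D' = (\<lambda>x. \<kappa> - x) ` diag_starts D"
    and steps: "\<And>a b c. a \<in> diag_starts D \<Longrightarrow> b \<in> diag_ends D \<Longrightarrow> a \<le> c \<Longrightarrow> c < b \<Longrightarrow>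
      goes_east (border SE D') (c + (\<kappa> - a - b)) = goes_east (border SE D) c"
  shows "D \<sim> D'"
proof (rule skew_schur_reflect[OF D D' starts ends])
  interpret D: connected_shape D by fact
  interpret D': connected_shape D' by fact
  fix a b c assume h: "a \<in> diag_starts D" "b \<in> diag_ends D" "a \<le> c" "c < b"
  have "D.L \<le> c" "c < D.R"
    using h D.start_props(3)[of a] D.end_props(4)[of b] by (auto simp: D.run_starts_eq D.run_ends_eq)
  moreover have "\<kappa> - b \<in> diag_starts D'" "\<kappa> - a \<in> diag_ends D'" using starts ends h by auto
  then have "D'.L \<le> c + (\<kappa> - a - b)" "c + (\<kappa> - a - b) < D'.R"
    using h D'.start_props(3)[of "\<kappa> - b"] D'.end_props(4)[of "\<kappa> - a"] by (auto simp: D'.run_starts_eq D'.run_ends_eq)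
  ultimately show "east_step D' (c + (\<kappa> - a - b)) = east_step D c"
    using D.east_step_border D'.east_step_border steps[OF h] by simp
qed

theorem schur_equivalent_reflect:
  assumes D: "connected_shape D" and D': "connected_shape D'"
    and starts: "diag_starts D' = (\<lambda>x. \<kappa> - x) ` diag_ends D"
    and ends: "diag_ends D' = (\<lambda>x. \<kappa> - x) ` diag_starts D"
    and steps: "\<And>a b c. a \<in> diag_starts D \<Longrightarrow> b \<in> diag_ends D \<Longrightarrow> a \<le> c \<Longrightarrow> c < b \<Longrightarrow>
      goes_east (border x D') (c + (\<kappa> - a - b)) = goes_east (border x D) c"
  shows "D \<sim> D'"
proof (cases x)
  case SE
  then show ?thesis using schur_equivalent_reflect_SE[OF D D' starts ends] steps by blast
next
  case NW
  have "rot D \<sim> rot D'"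
  \<comment> \<open>Negating the diagonals exchanges starts with ends and turns the reflection with
    constant \<open>\<kappa>\<close> into the one with constant \<open>- \<kappa>\<close>.\<close>
  proof (rule schur_equivalent_reflect_SE[where \<kappa> = "- \<kappa>"])
    show "connected_shape (rot D)" "connected_shape (rot D')" using D D' connected_shape_rot by auto
    show "diag_starts (rot D') = (\<lambda>x. - \<kappa> - x) ` diag_ends (rot D)"
      "diag_ends (rot D') = (\<lambda>x. - \<kappa> - x) ` diag_starts (rot D)"
      by (simp_all add: diag_starts_rot diag_ends_rot starts ends image_image algebra_simps)
    fix a b c assume h: "a \<in> diag_starts (rot D)" "b \<in> diag_ends (rot D)" "a \<le> c" "c < b"
    then have m: "- b \<in> diag_starts D" "- a \<in> diag_ends D" by (auto simp: diag_starts_rot diag_ends_rot)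
    have shift: "- (c + (- \<kappa> - a - b)) - 1 = (- c - 1) + (\<kappa> - (- b) - (- a))" by simp
    have "goes_east (border NW D') ((- c - 1) + (\<kappa> - (- b) - (- a))) = goes_east (border NW D) (- c - 1)"
      using steps[OF m, of "- c - 1"] h unfolding NW by linarith
    then show "goes_east (border SE (rot D')) (c + (- \<kappa> - a - b)) = goes_east (border SE (rot D)) c"
      unfolding border_rot[of NW, unfolded opposite.simps] goes_east_rot shift .
  qed
  then show ?thesis
    using schur_equivalent_rot connected_shape.finite[OF D] connected_shape.finite[OF D'] by blast
qed

section \<open>Ribbons as paths\<close>

text \<open>A ribbon has one cell on each of its diagonals, so it is the image of an interval under
  such a map. The map is total so that a single one can carry all powers of a ribbon.\<close>

definition diag_path :: "(int \<Rightarrow> cell) \<Rightarrow> bool" where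
  "diag_path G \<longleftrightarrow> (\<forall>c. diag (G c) = c)"

definition scale :: "int \<Rightarrow> cell \<Rightarrow> cell" where
  "scale e v = (e * fst v, e * snd v)"

lemma translate_eq: "translate v D = (\<lambda>x. x + v) ` D"
  unfolding translate_def by (intro image_cong) (auto simp: prod_eq_iff)

lemma diag_add [simp]: "diag (x + v) = diag x + diag v"
  by (simp add: diag_def)

lemma diag_scale [simp]: "diag (scale e v) = e * diag v"
  by (simp add: diag_def scale_def algebra_simps)

lemma scale_add: "scale (e + f) v = scale e v + scale f v"
  by (simp add: scale_def algebra_simps)

lemma scale_one [simp]: "scale 1 v = v"
  by (simp add: scale_def)

lemma same_shape_sym: "D \<simeq> E \<Longrightarrow> E \<simeq> D"
proof -
  assume "D \<simeq> E"
  then obtain v where "E = translate v D" by (auto simp: same_shape_def)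
  then have "D = translate (- v) E" by (simp add: translate_eq image_image)
  then show "E \<simeq> D" unfolding same_shape_def by blast
qed

lemma diag_path_inj: "diag_path G \<Longrightarrow> inj G"
  unfolding diag_path_def by (metis injI)

lemma diag_path_image: "diag_path G \<Longrightarrow> diag ` (G ` A) = A"
  by (simp add: diag_path_def image_image)

lemma diag_path_card: "diag_path G \<Longrightarrow> card (G ` {p..q}) = nat (q - p + 1)"
  using diag_path_inj by (subst card_image) (auto intro: inj_on_subset)

lemma diag_path_mem: "diag_path G \<Longrightarrow> x \<in> G ` A \<longleftrightarrow> diag x \<in> A \<and> x = G (diag x)"
  unfolding diag_path_def by force

lemma diag_path_translate: "diag_path G \<Longrightarrow> diag_path (\<lambda>c. G (c - diag u) + u)"
  by (simp add: diag_path_def)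

lemma translate_path:
  "translate u (G ` {p..q}) = (\<lambda>c. G (c - diag u) + u) ` {p + diag u..q + diag u}"
proof -
  have "{p + diag u..q + diag u} = (\<lambda>c. c + diag u) ` {p..q}" by simp
  then show ?thesis unfolding translate_eq by (simp only: image_image add_diff_cancel_right')
qed

text \<open>The diagonal of a cell recovers its parameter, which turns an equality of sets of cells
  into a pointwise equality of maps.\<close>

lemma translate_path_eqD:
  assumes G: "diag_path G" and H: "diag_path H" and le: "p \<le> q"
    and eq: "translate u (G ` {p..q}) = H ` {p'..q'}"
  shows "p' = p + diag u" "q' = q + diag u" "\<And>c. p \<le> c \<Longrightarrow> c \<le> q \<Longrightarrow> H (c + diag u) = G c + u"
proof -
  have K: "diag_path (\<lambda>c. G (c - diag u) + u)" by (rule diag_path_translate[OF G])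
  have eq': "(\<lambda>c. G (c - diag u) + u) ` {p + diag u..q + diag u} = H ` {p'..q'}"
    using eq unfolding translate_path .
  have "{p + diag u..q + diag u} = {p'..q'}"
    using arg_cong[OF eq', of "image diag"] unfolding diag_path_image[OF K] diag_path_image[OF H] .
  then show r: "p' = p + diag u" "q' = q + diag u" using le by (auto simp: Icc_eq_Icc)
  fix c assume c: "p \<le> c" "c \<le> q"
  have "G c + u \<in> H ` {p'..q'}" unfolding eq[symmetric] translate_eq using c by auto
  then show "H (c + diag u) = G c + u"
    unfolding diag_path_mem[OF H] using G by (simp add: diag_path_def)
qed

lemma sw_part_path:
  assumes G: "diag_path G"
  shows "sw_part N (G ` {p..q}) = G ` {p..min q (p + int N - 1)}"
proof -
  have "card {d \<in> {p..q}. d < c} < N \<longleftrightarrow> c \<le> p + int N - 1" if "p \<le> c" "c \<le> q" for c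
  proof -
    have eq: "{d \<in> {p..q}. d < c} = {p..<c}" using that by auto
    show ?thesis unfolding eq card_atLeastLessThan_int using that by linarith
  qed
  then show ?thesis
    unfolding sw_part_def diag_path_image[OF G] using G by (auto simp: diag_path_def)
qed

lemma ne_part_path:
  assumes G: "diag_path G"
  shows "ne_part N (G ` {p..q}) = G ` {max p (q - int N + 1)..q}"
proof -
  have "card {d \<in> {p..q}. c < d} < N \<longleftrightarrow> q - int N + 1 \<le> c" if "p \<le> c" "c \<le> q" for c
  proof -
    have eq: "{d \<in> {p..q}. c < d} = {c<..q}" using that by auto
    show ?thesis unfolding eq card_greaterThanAtMost_int using that by linarith
  qed
  then show ?thesis
    unfolding ne_part_def diag_path_image[OF G] using G by (auto simp: diag_path_def)
qed

lemma skew_diagram_shape: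
  "skew_diagram D \<Longrightarrow> connected_diagram D \<Longrightarrow> D \<noteq> {} \<Longrightarrow> connected_shape D"
  using skew_diagram_finite skew_diagram_convex by unfold_locales

text \<open>Two cells on one diagonal would by convexity fill a 2 by 2 block.\<close>

lemma ribbon_path:
  assumes "ribbon \<alpha>"
  obtains g p q where "diag_path g" "p \<le> q" "\<alpha> = g ` {p..q}"
    "\<And>c. p \<le> c \<Longrightarrow> c < q \<Longrightarrow> fst (g (c + 1)) = fst (g c) \<or> fst (g (c + 1)) = fst (g c) - 1"
proof -
  have "connected_shape \<alpha>" using assms skew_diagram_shape by (auto simp: ribbon_def)
  then interpret connected_shape \<alpha> .
  have no: "\<not> {(i, j), (i, j + 1), (i + 1, j), (i + 1, j + 1)} \<subseteq> \<alpha>" for i j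
    using assms unfolding ribbon_def by blast
  have size: "n c \<le> 1" for c
  proof (rule ccontr)
    assume "\<not> n c \<le> 1"
    then have c: "(r c, r c + c) \<in> \<alpha>" "(r c - 1, (r c - 1) + c) \<in> \<alpha>" unfolding cell_diag_iff by auto
    have "(a, b) \<in> \<alpha>" if "r c - 1 \<le> a" "a \<le> r c" "r c - 1 + c \<le> b" "b \<le> r c + c" for a b
      by (rule order_convexD[OF convex c(2,1) that])
    then show False using no[of "r c - 1" "r c - 1 + c"] by auto
  qed
  show ?thesis
  proof (rule that[of "\<lambda>c. (r c, r c + c)" L R])
    show "diag_path (\<lambda>c. (r c, r c + c))" by (simp add: diag_path_def)
    show "L \<le> R" by (rule LR(1))
    show "fst (r (c + 1), r (c + 1) + (c + 1)) = fst (r c, r c + c) \<or>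
        fst (r (c + 1), r (c + 1) + (c + 1)) = fst (r c, r c + c) - 1" if "L \<le> c" "c < R" for c
      using row_step[OF that] by simp
    show "\<alpha> = (\<lambda>c. (r c, r c + c)) ` {L..R}"
    proof (intro subset_antisym subsetI)
      fix x assume x: "x \<in> \<alpha>"
      obtain i j where ij: "x = (i, j)" by fastforce
      have "i = r (j - i)" using x size[of "j - i"] unfolding ij cell_iff by linarith
      moreover have "L \<le> j - i" "j - i \<le> R" using LR(2,3)[OF x] ij by auto
      ultimately show "x \<in> (\<lambda>c. (r c, r c + c)) ` {L..R}"
        unfolding ij by (intro image_eqI[of _ _ "j - i"]) auto
    next
      fix x assume "x \<in> (\<lambda>c. (r c, r c + c)) ` {L..R}"
      then obtain c where c: "c \<in> {L..R}" "x = (r c, r c + c)" by blast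
      then show "x \<in> \<alpha>" using rows_eq(2)[of c] by (simp add: cell_diag_iff)
    qed
  qed
qed

lemma ribbon_translate:
  assumes "ribbon \<alpha>"
  shows "ribbon (translate u \<alpha>)"
proof -
  have mem: "(i, j) \<in> translate t D \<longleftrightarrow> (i - fst t, j - snd t) \<in> D" for i j t D
    unfolding translate_def by (force simp: image_iff)
  have "skew_diagram (translate u \<alpha>)"
  proof -
    obtain p q v where "is_partition p" "is_partition q" "ferrers q \<subseteq> ferrers p"
        "\<alpha> = translate v (ferrers p - ferrers q)"
      using assms by (auto simp: ribbon_def skew_diagram_def)
    moreover have "translate u (translate v X) = translate (v + u) X" for X
      by (simp add: translate_eq image_image add.assoc)
    ultimately show ?thesis unfolding skew_diagram_def by metis
  qed
  moreover have "connected_diagram (translate u \<alpha>)"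
    unfolding connected_diagram_def
  proof safe
    fix A B assume sum: "is_direct_sum (translate u \<alpha>) A B"
    then have s: "translate u \<alpha> = A \<union> B" "A \<noteq> {}" "B \<noteq> {}"
      and AB: "\<And>i1 j1 i2 j2. (i1, j1) \<in> A \<Longrightarrow> (i2, j2) \<in> B \<Longrightarrow> i2 < i1 \<and> j1 < j2"
      unfolding is_direct_sum_def by blast+
    have "\<alpha> = translate (- u) (translate u \<alpha>)" by (simp add: translate_eq image_image)
    then have "\<alpha> = translate (- u) A \<union> translate (- u) B" unfolding s(1) by (simp add: translate_eq image_Un)
    moreover have "i2 < i1 \<and> j1 < j2" if "(i1, j1) \<in> translate (- u) A" "(i2, j2) \<in> translate (- u) B" for i1 j1 i2 j2
      using AB[of "i1 + fst u" "j1 + snd u" "i2 + fst u" "j2 + snd u"] that unfolding mem by simp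
    moreover have "translate (- u) A \<noteq> {}" "translate (- u) B \<noteq> {}" using s by (auto simp: translate_eq)
    ultimately have "is_direct_sum \<alpha> (translate (- u) A) (translate (- u) B)"
      unfolding is_direct_sum_def by blast
    then show False using assms by (auto simp: ribbon_def connected_diagram_def)
  qed
  moreover have "translate u \<alpha> \<noteq> {}" using assms by (auto simp: ribbon_def translate_eq)
  moreover have "\<not> {(i, j), (i, j + 1), (i + 1, j), (i + 1, j + 1)} \<subseteq> translate u \<alpha>" for i j
  proof
    assume "{(i, j), (i, j + 1), (i + 1, j), (i + 1, j + 1)} \<subseteq> translate u \<alpha>"
    then have "{(i - fst u, j - snd u), (i - fst u, (j - snd u) + 1), ((i - fst u) + 1, j - snd u),
        ((i - fst u) + 1, (j - snd u) + 1)} \<subseteq> \<alpha>"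
      by (simp add: mem algebra_simps)
    then show False using assms unfolding ribbon_def by blast
  qed
  ultimately show ?thesis unfolding ribbon_def by blast
qed

lemma path_rows_antimono:
  fixes r :: "int \<Rightarrow> int"
  assumes step: "\<And>c. p \<le> c \<Longrightarrow> c < q \<Longrightarrow> r (c + 1) = r c \<or> r (c + 1) = r c - 1"
  shows "p \<le> a \<Longrightarrow> a \<le> b \<Longrightarrow> b \<le> q \<Longrightarrow> r b \<le> r a"
proof -
  assume a: "p \<le> a"
  show "a \<le> b \<Longrightarrow> b \<le> q \<Longrightarrow> r b \<le> r a"
  proof (induction b rule: int_ge_induct)
    case (step b)
    then show ?case using assms[of b] a by force
  qed simp
qed

lemma path_rows_image:
  fixes r :: "int \<Rightarrow> int"
  assumes step: "\<And>c. p \<le> c \<Longrightarrow> c < q \<Longrightarrow> r (c + 1) = r c \<or> r (c + 1) = r c - 1"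
    and le: "p \<le> q"
  shows "r ` {p..q} = {r q..r p}"
  using le step
proof (induction q rule: int_ge_induct)
  case base
  then show ?case by simp
next
  case (step q)
  have "{p..q + 1} = insert (q + 1) {p..q}" using step.hyps by auto
  then have "r ` {p..q + 1} = insert (r (q + 1)) {r q..r p}" using step.IH step.prems by simp
  moreover have "r q \<le> r p" using path_rows_antimono[of p q r p q] step by simp
  moreover have "r (q + 1) = r q \<or> r (q + 1) = r q - 1" using step by simp
  ultimately show ?case by auto
qed

lemma path_num_rows:
  assumes G: "diag_path G" and le: "p \<le> q"
    and step: "\<And>c. p \<le> c \<Longrightarrow> c < q \<Longrightarrow> fst (G (c + 1)) = fst (G c) \<or> fst (G (c + 1)) = fst (G c) - 1"
  shows "int (num_rows (G ` {p..q})) = fst (G p) - fst (G q) + 1"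
    "part (G ` {p..q}) (num_rows (G ` {p..q})) = card {c \<in> {p..q}. fst (G c) = fst (G q)}"
proof -
  have img: "fst ` G ` {p..q} = {fst (G q)..fst (G p)}"
    unfolding image_image using path_rows_image[of p q "\<lambda>c. fst (G c)"] step le by blast
  have mono: "fst (G q) \<le> fst (G p)"
    using path_rows_antimono[of p q "\<lambda>c. fst (G c)" p q] step le by simp
  show nr: "int (num_rows (G ` {p..q})) = fst (G p) - fst (G q) + 1"
    unfolding num_rows_def img using mono by simp
  have "Max (fst ` G ` {p..q}) = fst (G p)" unfolding img using mono by (auto intro!: Max_eqI)
  then have "part (G ` {p..q}) (num_rows (G ` {p..q})) = card {x \<in> G ` {p..q}. fst x = fst (G q)}"
    unfolding part_def nr by simp
  also have "{x \<in> G ` {p..q}. fst x = fst (G q)} = G ` {c \<in> {p..q}. fst (G c) = fst (G q)}" by auto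
  also have "card \<dots> = card {c \<in> {p..q}. fst (G c) = fst (G q)}"
    by (rule card_image) (use diag_path_inj[OF G] in \<open>auto intro: inj_on_subset\<close>)
  finally show "part (G ` {p..q}) (num_rows (G ` {p..q})) = card {c \<in> {p..q}. fst (G c) = fst (G q)}" .
qed

section \<open>The periodic path behind a ribbon staircase\<close>

text \<open>Moving the southwestern copy of the intersection onto the northeastern one advances by
  \<open>d\<close> diagonals along the ribbon. This is a period of the whole ribbon, even if the two
  copies overlap, and it extends to all diagonals.\<close>

lemma self_overlap_periodic:
  assumes g: "diag_path g" and d: "0 < d" and v: "diag v = d"
    and per: "\<And>c. p \<le> c \<Longrightarrow> c + d \<le> q \<Longrightarrow> g (c + d) = g c + v"
  obtains G where "diag_path G" "\<And>c. G (c + d) = G c + v" "\<And>c. p \<le> c \<Longrightarrow> c \<le> q \<Longrightarrow> G c = g c"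
proof (rule that[of "\<lambda>c. g (p + (c - p) mod d) + scale ((c - p) div d) v"])
  let ?G = "\<lambda>c. g (p + (c - p) mod d) + scale ((c - p) div d) v"
  show "diag_path ?G"
    using g v by (simp add: diag_path_def)
  show step: "?G (c + d) = ?G c + v" for c
  proof -
    have "c + d - p = (c - p) + d" by simp
    then have "(c + d - p) div d = (c - p) div d + 1" "(c + d - p) mod d = (c - p) mod d"
      using d by (simp_all only: div_add_self2 mod_add_self2)
    then show ?thesis by (simp add: scale_add add.assoc)
  qed
  have shifted: "?G (p + int k) = g (p + int k)" if "p + int k \<le> q" for k
    using that
  proof (induction k rule: less_induct)
    case (less k)
    show ?case
    proof (cases "int k < d")
      case True
      then show ?thesis by (simp add: scale_def zero_prod_def[symmetric])
    next
      case False
      define l where "l = nat (int k - d)"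
      have l: "int k = int l + d" "l < k" using False d by (auto simp: l_def)
      have "?G (p + int k) = ?G (p + int l) + v" using step[of "p + int l"] l by (simp add: add.assoc)
      also have "\<dots> = g (p + int l) + v" using less.IH[of l] less.prems l d by simp
      also have "\<dots> = g (p + int k)" using per[of "p + int l"] less.prems l by (simp add: add.assoc)
      finally show ?thesis .
    qed
  qed
  show "?G c = g c" if "p \<le> c" "c \<le> q" for c
    using shifted[of "nat (c - p)"] that by simp
qed

lemma periodic_scale:
  assumes per: "\<And>c. G (c + d) = G c + v"
  shows "G (c + e * d) = G c + scale e v"
proof (induction e rule: int_induct[of _ 0])
  case base
  then show ?case by (simp add: scale_def zero_prod_def[symmetric])
next
  case (step1 i)
  have "G (c + (i + 1) * d) = G ((c + i * d) + d)" by (simp add: algebra_simps)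
  also have "\<dots> = (G c + scale i v) + v" by (simp only: per step1.IH)
  also have "\<dots> = G c + scale (i + 1) v" by (simp add: scale_add add.assoc)
  finally show ?case .
next
  case (step2 i)
  have "G (c + i * d) = G (c + (i - 1) * d) + v" using per[of "c + (i - 1) * d"] by (simp add: algebra_simps)
  moreover have "scale i v = scale (i - 1) v + v" using scale_add[of "i - 1" 1 v] by simp
  ultimately have "G (c + (i - 1) * d) + v = (G c + scale (i - 1) v) + v" using step2 by (simp add: add.assoc)
  then show ?case by simp
qed

text \<open>Here \<open>w\<close> is the size of the self-intersection and \<open>d\<close> the
  displacement of consecutive copies, so \<open>\<alpha>\<close> covers \<open>w + d\<close>
  diagonals. The intersection is a choice up to translation, hence the vector in
  \<open>intersection_eq\<close>.\<close>

locale staircase_path =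
  fixes \<alpha> :: diagram and m :: nat and G :: "int \<Rightarrow> cell" and L d w :: int and v :: cell
  assumes path: "diag_path G" and d_pos: "0 < d" and w_pos: "0 < w"
    and rows: "fst (G (c + 1)) = fst (G c) \<or> fst (G (c + 1)) = fst (G c) - 1"
    and periodic: "G (c + d) = G c + v"
    and ribbon_eq: "\<alpha> = G ` {L..L + w + d - 1}"
    and m_pos: "1 \<le> m" and m_less: "m < num_rows \<alpha>"
    and is_intersection: "is_m_intersection m \<alpha> \<alpha> (m_intersection m \<alpha> \<alpha>)"
    and intersection_eq: "\<exists>u. m_intersection m \<alpha> \<alpha> = translate u (G ` {L..L + w - 1})"
begin

lemma diag_v: "diag v = d"
  using periodic[of 0] path unfolding diag_path_def by (metis add_0 diag_add)

lemma translate_scale: "translate (scale e v) (G ` {a..b}) = G ` {a + d * e..b + d * e}"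
proof -
  have "G (c - diag (scale e v)) + scale e v = G c" for c
    using periodic_scale[of G d v "c - e * d" e] periodic diag_v by simp
  then show ?thesis unfolding translate_path by (simp add: diag_v mult.commute)
qed

lemma translated_rows:
  assumes "a \<le> b" "X = translate u (G ` {a..b})"
  shows "int (num_rows X) = fst (G a) - fst (G b) + 1"
    "part X (num_rows X) = card {c \<in> {a..b}. fst (G c) = fst (G b)}" "int (card X) = b - a + 1"
proof -
  let ?H = "\<lambda>c. G (c - diag u) + u"
  have H: "diag_path ?H" by (rule diag_path_translate[OF path])
  have X: "X = ?H ` {a + diag u..b + diag u}" using assms(2) unfolding translate_path .
  have Hrows: "fst (?H (c + 1)) = fst (?H c) \<or> fst (?H (c + 1)) = fst (?H c) - 1" for c
    using rows[of "c - diag u"] by (auto simp: algebra_simps)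
  note H_rows = path_num_rows[OF H _ Hrows, of "a + diag u" "b + diag u", folded X]
  show "int (num_rows X) = fst (G a) - fst (G b) + 1" using H_rows(1) assms(1) by simp
  show "int (card X) = b - a + 1" unfolding X using assms(1) by (simp add: diag_path_card[OF H])
  have "{c \<in> {a + diag u..b + diag u}. fst (?H c) = fst (?H (b + diag u))} =
      (\<lambda>c. c + diag u) ` {c \<in> {a..b}. fst (G c) = fst (G b)}"
    by (auto intro!: image_eqI[of _ _ "_ - diag u"])
  then show "part X (num_rows X) = card {c \<in> {a..b}. fst (G c) = fst (G b)}"
    using H_rows(2) assms(1) by (simp add: card_image)
qed

lemma translate_zero: "translate 0 X = X"
  by (simp add: translate_eq)

text \<open>The powers amalgamate along the intersection of \<open>A\<close> with \<open>\<alpha>\<close>, not of \<open>\<alpha>\<close> with itself.  Both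
  have \<open>m < num_rows \<alpha>\<close> rows, so they only see the last copy of \<open>\<alpha>\<close> in \<open>A\<close>.\<close>

lemma card_intersection_eps:
  assumes e: "1 \<le> e" and A: "A = G ` {L..L + w + d * e - 1}"
  shows "card (m_intersection m A \<alpha>) = nat w"
proof -
  define \<omega> where "\<omega> = m_intersection m \<alpha> \<alpha>"
  have \<omega>: "is_m_intersection m \<alpha> \<alpha> \<omega>" unfolding \<omega>_def by (rule is_intersection)
  obtain u where u: "\<omega> = translate u (G ` {L..L + w - 1})" using intersection_eq \<omega>_def by blast
  have card_\<omega>: "int (card \<omega>) = w" using translated_rows(3)[OF _ u] w_pos by simp
  have rows_\<omega>: "num_rows \<omega> = m" "int m = fst (G L) - fst (G (L + w - 1)) + 1"
    "part \<omega> m = card {c \<in> {L..L + w - 1}. fst (G c) = fst (G (L + w - 1))}"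
    using translated_rows(1,2)[OF _ u] w_pos \<omega> by (simp_all add: is_m_intersection_def)
  have \<alpha>0: "\<alpha> = translate 0 (G ` {L..L + w + d - 1})" using ribbon_eq translate_zero by simp
  have mono: "fst (G b) \<le> fst (G a)" if "a \<le> b" for a b
    using path_rows_antimono[of a b "\<lambda>c. fst (G c)" a b] rows that by simp
  define f where "f = d * (e - 1)"
  have f: "0 \<le> f" "d * e = f + d" using d_pos e by (simp_all add: f_def algebra_simps)
  have A_shift: "A = G ` {L..L + w + d - 1 + f}" unfolding A f(2) by (simp add: algebra_simps)
  have Gf: "G (c + f) = G c + scale (e - 1) v" for c
    using periodic_scale[of G d v c "e - 1"] periodic by (simp add: f_def mult.commute)
  have top: "part A (num_rows A) = part \<alpha> (num_rows \<alpha>)"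
  proof -
    let ?q = "L + w + d - 1"
    have A0: "A = translate 0 (G ` {L..?q + f})" using A_shift translate_zero by simp
    have "{c \<in> {L..?q + f}. fst (G c) = fst (G (?q + f))} = (\<lambda>c. c + f) ` {c \<in> {L..?q}. fst (G c) = fst (G ?q)}"
    proof (intro subset_antisym subsetI)
      fix c assume c: "c \<in> {c \<in> {L..?q + f}. fst (G c) = fst (G (?q + f))}"
      \<comment> \<open>The last copy of \<open>\<alpha>\<close> in \<open>A\<close> has at least
        two rows, so no cell before it lies in the top row of \<open>A\<close>.\<close>
      have "fst (G (?q + f)) < fst (G (L + f))"
        using translated_rows(1)[OF _ \<alpha>0] m_pos m_less w_pos d_pos by (simp add: Gf)
      then have "L + f \<le> c" using mono[of c "L + f"] c by force
      moreover have "fst (G (c - f)) = fst (G ?q)" using c Gf[of "c - f"] Gf[of ?q] by simp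
      ultimately show "c \<in> (\<lambda>c. c + f) ` {c \<in> {L..?q}. fst (G c) = fst (G ?q)}"
        using c by (intro image_eqI[of _ _ "c - f"]) auto
    next
      fix c assume "c \<in> (\<lambda>c. c + f) ` {c \<in> {L..?q}. fst (G c) = fst (G ?q)}"
      then show "c \<in> {c \<in> {L..?q + f}. fst (G c) = fst (G (?q + f))}" using f(1) by (auto simp: Gf)
    qed
    then have "card {c \<in> {L..?q + f}. fst (G c) = fst (G (?q + f))} = card {c \<in> {L..?q}. fst (G c) = fst (G ?q)}"
      by (simp add: card_image)
    then show ?thesis using translated_rows(2)[OF _ A0] translated_rows(2)[OF _ \<alpha>0] w_pos d_pos f(1) by simp
  qed
  have ne: "ne_part N A = translate (scale (e - 1) v) (ne_part N \<alpha>)" if "int N \<le> w + d" for N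
  proof -
    have "max L (L + w + d - 1 + f - int N + 1) = L + w + d - int N + f" using that f(1) by simp
    moreover have "max L (L + w + d - 1 - int N + 1) = L + w + d - int N" using that by simp
    ultimately show ?thesis
      unfolding A_shift ribbon_eq ne_part_path[OF path] translate_scale by (simp add: f_def)
  qed
  have "is_m_intersection m A \<alpha> \<omega>"
  proof -
    have "ne_part (card \<omega>) \<alpha> \<simeq> \<omega>" "ribbon (ne_part (card \<omega> + 1) \<alpha>)"
      using \<omega> by (auto simp: is_m_intersection_def protrudes_top_def)
    moreover have "translate s X \<simeq> \<omega>" if "X \<simeq> \<omega>" for s X
    proof -
      obtain t where "\<omega> = translate t X" using \<open>X \<simeq> \<omega>\<close> by (auto simp: same_shape_def)
      then have "\<omega> = translate (t - s) (translate s X)" by (simp add: translate_eq image_image add.assoc)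
      then show ?thesis unfolding same_shape_def by blast
    qed
    ultimately have "ne_part (card \<omega>) A \<simeq> \<omega>" "ribbon (ne_part (card \<omega> + 1) A)"
      using ne[of "card \<omega>"] ne[of "card \<omega> + 1"] card_\<omega> d_pos ribbon_translate by simp_all
    then show ?thesis
      using \<omega> top unfolding is_m_intersection_def protrudes_top_def by (simp del: One_nat_def)
  qed
  \<comment> \<open>The witness \<open>\<omega>\<close> only shows that an intersection exists, and
    the choice may return another one. Its size is recovered from its number of rows and the size of
    its top row.\<close>
  then have \<omega>': "is_m_intersection m A \<alpha> (m_intersection m A \<alpha>)"
    unfolding m_intersection_def by (rule someI)
  define \<omega>' where "\<omega>' = m_intersection m A \<alpha>"
  have rib': "ribbon \<omega>'" and sw': "sw_part (card \<omega>') \<alpha> \<simeq> \<omega>'" and nr': "num_rows \<omega>' = m"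
    using \<omega>' by (auto simp: is_m_intersection_def protrudes_bottom_def \<omega>'_def)
  \<comment> \<open>For \<open>m = 1\<close> both sides are the same minimum; otherwise both are the
    top row of \<open>\<alpha>\<close>.\<close>
  have part': "part \<omega>' m = part \<omega> m"
    using \<omega> \<omega>' top by (auto simp: is_m_intersection_def \<omega>'_def split: if_splits)
  define q where "q = min (L + w + d - 1) (L + int (card \<omega>') - 1)"
  obtain u' where u': "\<omega>' = translate u' (G ` {L..q})"
    using sw' unfolding ribbon_eq sw_part_path[OF path] q_def same_shape_def by blast
  have "finite \<omega>'" "\<omega>' \<noteq> {}" using rib' skew_diagram_finite by (auto simp: ribbon_def)
  then have "L \<le> q" using w_pos d_pos unfolding q_def by (simp add: card_gt_0_iff Suc_le_eq)
  note rows' = translated_rows[OF \<open>L \<le> q\<close> u']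
  have eq_rows: "fst (G q) = fst (G (L + w - 1))" using rows'(1) nr' rows_\<omega> by simp
  then have cards: "card {c \<in> {L..q}. fst (G c) = fst (G q)} = card {c \<in> {L..L + w - 1}. fst (G c) = fst (G q)}"
    using rows'(2) nr' part' rows_\<omega> by simp
  \<comment> \<open>For a path that stops in row \<open>z\<close>, the number of its cells in that
    row determines where it stops.\<close>
  have less: "card {c \<in> {L..a}. fst (G c) = z} < card {c \<in> {L..b}. fst (G c) = z}"
    if "a < b" "L \<le> b" "fst (G b) = z" for a b z
  proof (rule psubset_card_mono)
    show "finite {c \<in> {L..b}. fst (G c) = z}" by (rule finite_subset[of _ "{L..b}"]) auto
    have "b \<in> {c \<in> {L..b}. fst (G c) = z}" "b \<notin> {c \<in> {L..a}. fst (G c) = z}" using that by auto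
    moreover have "{c \<in> {L..a}. fst (G c) = z} \<subseteq> {c \<in> {L..b}. fst (G c) = z}" using that by auto
    ultimately show "{c \<in> {L..a}. fst (G c) = z} \<subset> {c \<in> {L..b}. fst (G c) = z}" by blast
  qed
  have "q = L + w - 1"
    using less[of q "L + w - 1" "fst (G q)"] less[of "L + w - 1" q "fst (G q)"] cards eq_rows \<open>L \<le> q\<close> w_pos
    by (cases q "L + w - 1" rule: linorder_cases) auto
  then show ?thesis using rows'(3) unfolding \<omega>'_def by simp
qed

text \<open>Amalgamation puts the first \<open>w\<close> diagonals of the new copy onto the last
  \<open>w\<close> of the power. By periodicity this is the shift by the next multiple of
  \<open>v\<close>.\<close>

lemma eps_eq: "eps m \<alpha> (Suc k) = G ` {L..L + w + d * int (Suc k) - 1}"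
proof (induction k)
  case 0
  then show ?case using ribbon_eq by simp
next
  case (Suc k)
  let ?e = "int (Suc k)"
  let ?A = "G ` {L..L + w + d * ?e - 1}"
  have sw: "sw_part (nat w) \<alpha> = G ` {L..L + w - 1}"
    unfolding ribbon_eq sw_part_path[OF path] using w_pos d_pos by simp
  have "max L (L + w + d * ?e - 1 - w + 1) = L + d * ?e" using d_pos by simp
  then have ne: "ne_part (nat w) ?A = G ` {L + d * ?e..L + w + d * ?e - 1}"
    unfolding ne_part_path[OF path] using w_pos by simp
  have shift: "translate (scale ?e v) (G ` {a..b}) = G ` {a + d * ?e..b + d * ?e}" for a b
    by (rule translate_scale)
  have card_int: "card (m_intersection m ?A \<alpha>) = nat w" by (rule card_intersection_eps) simp_all
  have the: "(THE u. translate u (sw_part (nat w) \<alpha>) = ne_part (nat w) ?A) = scale ?e v"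
  proof (rule the_equality)
    show "translate (scale ?e v) (sw_part (nat w) \<alpha>) = ne_part (nat w) ?A"
      unfolding sw ne shift by (simp add: algebra_simps)
    fix u assume "translate u (sw_part (nat w) \<alpha>) = ne_part (nat w) ?A"
    then have eq: "translate u (G ` {L..L + w - 1}) = G ` {L + d * ?e..L + w + d * ?e - 1}"
      unfolding sw ne .
    have "L + d * ?e = L + diag u" "G (L + diag u) = G L + u"
      using translate_path_eqD[OF path path _ eq] w_pos by auto
    moreover have "G (L + ?e * d) = G L + scale ?e v" by (rule periodic_scale) (rule periodic)
    ultimately show "u = scale ?e v" by (simp add: mult.commute)
  qed
  have "eps m \<alpha> (Suc (Suc k)) = ?A \<union> translate (scale ?e v) \<alpha>"
    unfolding eps.simps m_union_def amalgamate_def Suc.IH card_int the ..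
  also have "\<dots> = G ` ({L..L + w + d * ?e - 1} \<union> {L + d * ?e..L + w + d - 1 + d * ?e})"
    unfolding ribbon_eq shift image_Un ..
  also have "{L..L + w + d * ?e - 1} \<union> {L + d * ?e..L + w + d - 1 + d * ?e} =
      {L..L + w + d * int (Suc (Suc k)) - 1}"
  proof -
    define e where "e = d * ?e"
    have "d * int (Suc (Suc k)) = e + d" "0 \<le> e" using d_pos by (simp_all add: e_def algebra_simps)
    then show ?thesis unfolding e_def[symmetric] using d_pos w_pos by auto
  qed
  finally show ?case .
qed

lemma eps_eq': "1 \<le> p \<Longrightarrow> eps m \<alpha> p = G ` {L..L + w + d * int p - 1}"
  using eps_eq[of "p - 1"] by simp

end

lemma staircase_path_exists:
  assumes "ribbon \<alpha>" and "nontrivial_self_intersection m \<alpha>" and "1 \<le> m" and "m < num_rows \<alpha>"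
  obtains G L d w v where "staircase_path \<alpha> m G L d w v"
proof -
  define \<omega> where "\<omega> = m_intersection m \<alpha> \<alpha>"
  have \<omega>: "is_m_intersection m \<alpha> \<alpha> \<omega>"
    using assms(2) unfolding nontrivial_self_intersection_def \<omega>_def m_intersection_def by (auto intro: someI_ex)
  have nontriv: "\<not> \<omega> \<simeq> \<alpha>" using assms(2) by (simp add: nontrivial_self_intersection_def \<omega>_def)
  have shape: "ne_part (card \<omega>) \<alpha> \<simeq> \<omega>" "sw_part (card \<omega>) \<alpha> \<simeq> \<omega>" "ribbon \<omega>"
    using \<omega> by (auto simp: is_m_intersection_def protrudes_top_def protrudes_bottom_def)
  obtain g p q where g: "diag_path g" "p \<le> q" "\<alpha> = g ` {p..q}"
    and g_rows: "\<And>c. p \<le> c \<Longrightarrow> c < q \<Longrightarrow> fst (g (c + 1)) = fst (g c) \<or> fst (g (c + 1)) = fst (g c) - 1"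
    using ribbon_path[OF assms(1)] by blast
  define w where "w = int (card \<omega>)"
  have "finite \<omega>" "\<omega> \<noteq> {}" using shape(3) skew_diagram_finite by (auto simp: ribbon_def)
  then have w: "0 < w" by (simp add: w_def card_gt_0_iff)
  \<comment> \<open>If the intersection were at least as long as \<open>\<alpha>\<close>, then
    \<open>ne_part\<close> would return all of \<open>\<alpha>\<close> and the intersection would be
    trivial.\<close>
  have small: "w < q - p + 1"
  proof (rule ccontr)
    assume "\<not> w < q - p + 1"
    then have "ne_part (card \<omega>) \<alpha> = \<alpha>" unfolding g(3) ne_part_path[OF g(1)] w_def[symmetric] by simp
    then show False using shape(1) nontriv same_shape_sym by simp
  qed
  have sw: "sw_part (card \<omega>) \<alpha> = g ` {p..p + w - 1}" and ne: "ne_part (card \<omega>) \<alpha> = g ` {q - w + 1..q}"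
    unfolding g(3) sw_part_path[OF g(1)] ne_part_path[OF g(1)] w_def[symmetric] using small by simp_all
  define X where "X = ne_part (card \<omega>) \<alpha>"
  define Y where "Y = sw_part (card \<omega>) \<alpha>"
  obtain a b where a: "\<omega> = translate a X" and b: "\<omega> = translate b Y"
    using shape(1,2) unfolding X_def[symmetric] Y_def[symmetric] same_shape_def by blast
  have "translate (b - a) Y = X"
  proof -
    have "(\<lambda>x. x - a) ` \<omega> = X" unfolding a by (simp add: translate_eq image_image)
    moreover have "(\<lambda>x. x - a) ` \<omega> = translate (b - a) Y"
      unfolding b by (simp add: translate_eq image_image add_diff_eq)
    ultimately show ?thesis by simp
  qed
  then have eq: "translate (b - a) (g ` {p..p + w - 1}) = g ` {q - w + 1..q}" unfolding sw ne X_def Y_def .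
  define d where "d = q - p + 1 - w"
  note eqD = translate_path_eqD[OF g(1) g(1) _ eq]
  have v: "diag (b - a) = d" using eqD(1) w by (simp add: d_def)
  have per: "g (c + d) = g c + (b - a)" if "p \<le> c" "c + d \<le> q" for c
    using eqD(3)[of c] w v that by (simp add: d_def)
  have d: "0 < d" using small by (simp add: d_def)
  obtain G where G: "diag_path G" "\<And>c. G (c + d) = G c + (b - a)" "\<And>c. p \<le> c \<Longrightarrow> c \<le> q \<Longrightarrow> G c = g c"
    using self_overlap_periodic[OF g(1) d v per] by blast
  have "staircase_path \<alpha> m G p d w (b - a)"
  proof
    show "diag_path G" "0 < d" "0 < w" "\<And>c. G (c + d) = G c + (b - a)" by fact+
    have "p + w + d - 1 = q" by (simp add: d_def)
    show "1 \<le> m" "m < num_rows \<alpha>" by fact+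
    show "is_m_intersection m \<alpha> \<alpha> (m_intersection m \<alpha> \<alpha>)" using \<omega> by (simp add: \<omega>_def)
    \<comment> \<open>Modulo the period the step begins at some \<open>b'\<close> below
      \<open>p + d\<close>. As the intersection is nonempty, \<open>p + d\<close> is still a
      diagonal of \<open>\<alpha>\<close>, so even the step from one period to the next is a step of
      \<open>\<alpha>\<close>.\<close>
    show "fst (G (c + 1)) = fst (G c) \<or> fst (G (c + 1)) = fst (G c) - 1" for c
    proof -
      define e where "e = (c - p) div d"
      define b' where "b' = p + (c - p) mod d"
      have b': "p \<le> b'" "b' < p + d" "c = b' + e * d"
        using d by (simp_all add: b'_def e_def algebra_simps)
      have per: "G (y + e * d) = G y + scale e (b - a)" for y by (rule periodic_scale) (rule G(2))
      have "G c = g b' + scale e (b - a)" using per[of b'] G(3)[of b'] b' small w by (simp add: d_def)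
      moreover have "G (c + 1) = g (b' + 1) + scale e (b - a)"
      proof -
        have "c + 1 = (b' + 1) + e * d" using b'(3) by simp
        then have "G (c + 1) = G (b' + 1) + scale e (b - a)" using per[of "b' + 1"] by (simp only:)
        then show ?thesis using G(3)[of "b' + 1"] b' w by (simp add: d_def)
      qed
      ultimately show ?thesis using g_rows[of b'] b' w by (auto simp: d_def)
    qed
    show "\<alpha> = G ` {p..p + w + d - 1}" unfolding g(3) using G(3) \<open>p + w + d - 1 = q\<close> by (intro image_cong) auto
    have "g ` {p..p + w - 1} = G ` {p..p + w - 1}" using G(3) small by (intro image_cong) auto
    then show "\<exists>u. m_intersection m \<alpha> \<alpha> = translate u (G ` {p..p + w - 1})"
      using b unfolding Y_def sw \<omega>_def[symmetric] by (intro exI[of _ b]) simp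
  qed
  then show ?thesis by (rule that)
qed

section \<open>Reading off the nesting\<close>

text \<open>The number \<open>i\<close> is listed if some ribbon begins with copy
  \<open>i + 1\<close>, and \<open>closes\<close> lists \<open>j\<close> if some ribbon ends with
  copy \<open>j\<close>; 0 and \<open>k\<close> come from the largest ribbon. A slash counts in
  both: the intersection of copies \<open>i\<close> and \<open>i + 1\<close> begins where copy
  \<open>i + 1\<close> begins and ends where copy \<open>i\<close> ends.\<close>

definition opens :: "letter list \<Rightarrow> nat \<Rightarrow> nat set" where
  "opens \<N> k = insert 0 {i \<in> {1..<k}. \<N> ! (i - 1) = LParen \<or> \<N> ! (i - 1) = Slash}"

definition closes :: "letter list \<Rightarrow> nat \<Rightarrow> nat set" where
  "closes \<N> k = insert k {i \<in> {1..<k}. \<N> ! (i - 1) = RParen \<or> \<N> ! (i - 1) = Slash}"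

lemma opens_reverse:
  assumes "length \<N> = k - 1" "1 \<le> k"
  shows "opens (reverse_nesting \<N>) k = (\<lambda>j. k - j) ` closes \<N> k"
    "closes (reverse_nesting \<N>) k = (\<lambda>j. k - j) ` opens \<N> k"
proof -
  have nth: "reverse_nesting \<N> ! (i - 1) = mirror_letter (\<N> ! (k - i - 1))" if "1 \<le> i" "i < k" for i
    using that assms by (simp add: reverse_nesting_def rev_nth)
  have m: "mirror_letter l = LParen \<longleftrightarrow> l = RParen" "mirror_letter l = RParen \<longleftrightarrow> l = LParen"
    "mirror_letter l = Slash \<longleftrightarrow> l = Slash" for l
    by (cases l; simp)+
  have *: "{i \<in> {1..<k}. P (k - i)} = (\<lambda>j. k - j) ` {i \<in> {1..<k}. P i}" for P
    by (auto intro!: image_eqI[of _ _ "k - _"])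
  have "{i \<in> {1..<k}. reverse_nesting \<N> ! (i - 1) = LParen \<or> reverse_nesting \<N> ! (i - 1) = Slash} =
      {i \<in> {1..<k}. \<N> ! (k - i - 1) = RParen \<or> \<N> ! (k - i - 1) = Slash}"
    using nth m by auto
  then show "opens (reverse_nesting \<N>) k = (\<lambda>j. k - j) ` closes \<N> k"
    unfolding opens_def closes_def image_insert *[symmetric] by simp
  have "{i \<in> {1..<k}. reverse_nesting \<N> ! (i - 1) = RParen \<or> reverse_nesting \<N> ! (i - 1) = Slash} =
      {i \<in> {1..<k}. \<N> ! (k - i - 1) = LParen \<or> \<N> ! (k - i - 1) = Slash}"
    using nth m by auto
  then show "closes (reverse_nesting \<N>) k = (\<lambda>j. k - j) ` opens \<N> k"
    unfolding opens_def closes_def image_insert *[symmetric] by simp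
qed

lemma diag_border:
  assumes "connected_shape D"
  shows "diag ` border x D = diag ` D"
proof (cases x)
  case SE
  interpret connected_shape D by fact
  show ?thesis using SE diag_border_SE diag_image by simp
next
  case NW
  interpret R: connected_shape "rot D" by (rule connected_shape_rot[OF assms])
  have "diag ` rot (border NW D) = diag ` rot D"
    using R.diag_border_SE R.diag_image border_rot[of NW D] by simp
  then show ?thesis unfolding diag_rot NW by (simp add: inj_image_eq_iff inj_def)
qed

context staircase_path
begin

lemma copies_union:
  assumes "i < j"
  shows "(\<Union>l\<in>{i + 1..j}. {P + d * (int l - 1)..P + w + d * int l - 1}) = {P + d * int i..P + w + d * int j - 1}"
  using assms
proof (induction j rule: less_induct)
  case (less j)
  show ?case
  proof (cases "j = i + 1")
    case True
    then show ?thesis by simp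
  next
    case False
    then obtain j' where j': "j = Suc j'" "i < j'" using less.prems by (cases j) auto
    have "{i + 1..j} = insert j {i + 1..j'}" using j' by auto
    then have "(\<Union>l\<in>{i + 1..j}. {P + d * (int l - 1)..P + w + d * int l - 1}) =
        {P + d * int j'..P + w + d * int j - 1} \<union> {P + d * int i..P + w + d * int j' - 1}"
      using less.IH[of j'] j' by simp
    moreover have "d * int j = d * int j' + d" "d * int i \<le> d * int j'"
      using j' d_pos by (simp_all add: algebra_simps)
    moreover have "{P + b..P + w + (b + d) - 1} \<union> {P + a..P + w + b - 1} = {P + a..P + w + (b + d) - 1}"
      if "a \<le> b" for a b
      using that d_pos w_pos by auto
    ultimately show ?thesis by simp
  qed
qed

lemma ribbon_copy_eq:
  assumes i: "1 \<le> i" "i \<le> k" and \<theta>: "\<theta> = H ` {P..P + w + d * int k - 1}" and H: "diag_path H"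
  shows "ribbon_copy m \<alpha> \<theta> i = H ` {P + d * (int i - 1)..P + w + d * int i - 1}"
proof -
  have mono: "d * 1 \<le> d * int i" "d * int i \<le> d * int k" using i d_pos by (intro mult_left_mono; simp)+
  have c1: "int (card (eps m \<alpha> i)) = w + d * int i"
    using i mono d_pos w_pos by (simp add: eps_eq' diag_path_card[OF path])
  have c2: "int (card \<alpha>) = w + d"
    using d_pos w_pos diag_path_card[OF path, of L "L + w + d - 1"] unfolding ribbon_eq[symmetric] by simp
  have "sw_part (card (eps m \<alpha> i)) \<theta> = H ` {P..P + w + d * int i - 1}"
  proof -
    have "min (P + w + d * int k - 1) (P + (w + d * int i) - 1) = P + w + d * int i - 1"
      using mono by linarith
    then show ?thesis unfolding \<theta> sw_part_path[OF H] c1 by (simp only:)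
  qed
  then show ?thesis
  proof -
    have "max P (P + w + d * int i - 1 - (w + d) + 1) = P + d * (int i - 1)"
      using mono by (simp add: algebra_simps)
    then show ?thesis
      unfolding ribbon_copy_def \<open>sw_part (card (eps m \<alpha> i)) \<theta> = _\<close> ne_part_path[OF H] c2 by simp
  qed
qed

lemma spans_copies_range:
  assumes ij: "1 \<le> i" "i < j" "j \<le> k" and \<theta>: "\<theta> = H ` {P..P + w + d * int k - 1}" and H: "diag_path H"
    and \<rho>: "spans_copies m \<alpha> \<theta> \<rho> i j"
  shows "Min (diag ` \<rho>) = P + d * int i" "Max (diag ` \<rho>) = P + w - 1 + d * int j"
proof -
  have "diag ` \<rho> = (\<Union>l\<in>{i + 1..j}. diag ` ribbon_copy m \<alpha> \<theta> l)"
    using \<rho> by (simp add: spans_copies_def image_UN)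
  also have "\<dots> = (\<Union>l\<in>{i + 1..j}. {P + d * (int l - 1)..P + w + d * int l - 1})"
    using ij by (intro SUP_cong) (simp_all add: ribbon_copy_eq[OF _ _ \<theta> H] diag_path_image[OF H])
  also have "\<dots> = {P + d * int i..P + w + d * int j - 1}" by (rule copies_union[OF ij(2)])
  finally have eq: "diag ` \<rho> = {P + d * int i..P + w + d * int j - 1}" .
  have "d * int i \<le> d * int j" using ij d_pos by (intro mult_left_mono) auto
  then show "Min (diag ` \<rho>) = P + d * int i" "Max (diag ` \<rho>) = P + w - 1 + d * int j"
    unfolding eq using w_pos by (auto intro!: Min_eqI Max_eqI)
qed

lemma spans_intersection_range:
  assumes i: "1 \<le> i" "i < k" and \<theta>: "\<theta> = H ` {P..P + w + d * int k - 1}" and H: "diag_path H"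
    and \<rho>: "spans_intersection m \<alpha> \<theta> \<rho> i"
  shows "Min (diag ` \<rho>) = P + d * int i" "Max (diag ` \<rho>) = P + w - 1 + d * int i"
proof -
  have "ribbon_copy m \<alpha> \<theta> i \<inter> ribbon_copy m \<alpha> \<theta> (i + 1) =
      H ` ({P + d * (int i - 1)..P + w + d * int i - 1} \<inter> {P + d * int i..P + w + d * int (i + 1) - 1})"
  proof -
    have "ribbon_copy m \<alpha> \<theta> i = H ` {P + d * (int i - 1)..P + w + d * int i - 1}"
      by (rule ribbon_copy_eq[OF _ _ \<theta> H]) (use i in simp_all)
    moreover have "ribbon_copy m \<alpha> \<theta> (i + 1) = H ` {P + d * (int (i + 1) - 1)..P + w + d * int (i + 1) - 1}"
      by (rule ribbon_copy_eq[OF _ _ \<theta> H]) (use i in simp_all)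
    moreover have "int (i + 1) - 1 = int i" by simp
    ultimately show ?thesis by (simp only: image_Int[OF diag_path_inj[OF H]])
  qed
  also have "{P + d * (int i - 1)..P + w + d * int i - 1} \<inter> {P + d * int i..P + w + d * int (i + 1) - 1} =
      {P + d * int i..P + w + d * int i - 1}"
    using d_pos by (auto simp: algebra_simps)
  finally have eq: "diag ` \<rho> = {P + d * int i..P + w + d * int i - 1}"
    using \<rho> by (simp add: spans_intersection_def diag_path_image[OF H])
  show "Min (diag ` \<rho>) = P + d * int i" "Max (diag ` \<rho>) = P + w - 1 + d * int i"
    unfolding eq using w_pos by (auto intro!: Min_eqI Max_eqI)
qed

text \<open>This turns the nesting into positions on the periodic path. Diagrams are concrete sets
  of cells, so each staircase brings its own translation \<open>u\<close>.\<close>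

lemma staircase_data:
  assumes "is_staircase x \<alpha> m k \<N> D"
  obtains u P where "connected_shape D" "1 \<le> k" "length \<N> = k - 1" "P = L + diag u"
    "border x D = (\<lambda>c. G (c - diag u) + u) ` {P..P + w + d * int k - 1}"
    "diag_starts D = (\<lambda>i. P + d * int i) ` opens \<N> k"
    "diag_ends D = (\<lambda>j. P + w - 1 + d * int j) ` closes \<N> k"
proof -
  from assms obtain \<theta> where dec: "ribbon_staircase_decomposition x \<alpha> m D" and \<theta>: "\<theta> \<in> decomposition x D"
    and k: "1 \<le> k" and shape: "\<theta> \<simeq> eps m \<alpha> k" and len: "length \<N> = k - 1"
    and creates: "\<And>\<rho>. \<rho> \<in> decomposition x D - {\<theta>} \<Longrightarrow> \<exists>i \<in> {1..<k}. \<exists>l. creates_letter m \<alpha> k \<theta> \<rho> i l"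
    and letters: "\<And>i l. i \<in> {1..<k} \<Longrightarrow> l \<noteq> Dot \<Longrightarrow>
      \<N> ! (i - 1) = l \<longleftrightarrow> (\<exists>\<rho> \<in> decomposition x D - {\<theta>}. creates_letter m \<alpha> k \<theta> \<rho> i l)"
    unfolding is_staircase_def by blast
  have "D \<noteq> {}"
  proof
    assume "D = {}"
    have "decomposition_ribbon x D \<rho> \<Longrightarrow> D \<noteq> {}" for D \<rho>
      by (induction rule: decomposition_ribbon.induct) (auto simp: components_def)
    then show False using \<theta> \<open>D = {}\<close> by (auto simp: decomposition_def)
  qed
  then have D: "connected_shape D"
    using dec skew_diagram_shape by (auto simp: ribbon_staircase_decomposition_def)
  then interpret D: connected_shape D .
  obtain u where "\<theta> = translate u (eps m \<alpha> k)" using same_shape_sym[OF shape] by (auto simp: same_shape_def)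
  define P where "P = L + diag u"
  define H where "H = (\<lambda>c. G (c - diag u) + u)"
  have H: "diag_path H" unfolding H_def by (rule diag_path_translate[OF path])
  have \<theta>_eq: "\<theta> = H ` {P..P + w + d * int k - 1}"
    unfolding \<open>\<theta> = translate u (eps m \<alpha> k)\<close> eps_eq'[OF k] translate_path H_def P_def
    by (simp add: algebra_simps)
  have dk: "0 < d * int k" using d_pos k by simp
  have \<theta>_range: "Min (diag ` \<theta>) = P" "Max (diag ` \<theta>) = P + w - 1 + d * int k"
    unfolding \<theta>_eq diag_path_image[OF H] using w_pos dk by (auto intro!: Min_eqI Max_eqI)
  have ranges: "(\<exists>i j. 1 \<le> i \<and> i < j \<and> j < k \<and> spans_copies m \<alpha> \<theta> \<rho> i j) \<or>
      (\<exists>i. 1 \<le> i \<and> i < k \<and> spans_intersection m \<alpha> \<theta> \<rho> i)" if \<rho>: "\<rho> \<in> decomposition x D - {\<theta>}" for \<rho>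
  proof -
    obtain i l where i: "i \<in> {1..<k}" and l: "creates_letter m \<alpha> k \<theta> \<rho> i l" using creates[OF \<rho>] by blast
    show ?thesis using i l by (cases l) auto
  qed
  \<comment> \<open>Every other ribbon creates a letter and therefore begins \<open>d * i\<close>
    diagonals after \<open>P\<close> for some \<open>i \<ge> 1\<close>, whereas the border meets
    every diagonal of \<open>D\<close>, among them \<open>P\<close>.\<close>
  have border: "border x D = \<theta>"
  proof (rule ccontr)
    assume "border x D \<noteq> \<theta>"
    then have "border x D \<in> decomposition x D - {\<theta>}" using D.decomposition_unfold by blast
    from ranges[OF this] obtain i where i: "1 \<le> i" "Min (diag ` border x D) = P + d * int i"
      using spans_copies_range(1)[OF _ _ _ \<theta>_eq H] spans_intersection_range(1)[OF _ _ \<theta>_eq H]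
      by (metis less_imp_le)
    have "\<theta> \<subseteq> D"
      using decomposition_ribbon_nonempty[of x D \<theta>] \<theta> D.finite by (simp add: decomposition_def)
    moreover have "P \<in> diag ` \<theta>" unfolding \<theta>_eq diag_path_image[OF H] using w_pos dk by simp
    ultimately have "P \<in> diag ` border x D" unfolding diag_border[OF D] by blast
    moreover have "finite (diag ` border x D)" unfolding diag_border[OF D] using D.finite by simp
    ultimately have "P + d * int i \<le> P" using i(2) Min_le by metis
    moreover have "0 < d * int i" using d_pos i by simp
    ultimately show False by simp
  qed
  have copies: "\<N> ! (i - 1) = LParen \<and> \<N> ! (j - 1) = RParen"
    if "1 \<le> i" "i < j" "j < k" "\<rho> \<in> decomposition x D - {\<theta>}" "spans_copies m \<alpha> \<theta> \<rho> i j" for i j \<rho>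
    using letters[of i LParen] letters[of j RParen] that by auto
  have slash: "\<N> ! (i - 1) = Slash"
    if "1 \<le> i" "i < k" "\<rho> \<in> decomposition x D - {\<theta>}" "spans_intersection m \<alpha> \<theta> \<rho> i" for i \<rho>
    using letters[of i Slash] that by auto
  have ends_of: "\<exists>i \<in> opens \<N> k. \<exists>j \<in> closes \<N> k. Min (diag ` \<rho>) = P + d * int i \<and> Max (diag ` \<rho>) = P + w - 1 + d * int j"
    if \<rho>: "\<rho> \<in> decomposition x D" for \<rho>
  proof (cases "\<rho> = \<theta>")
    case True
    have "Min (diag ` \<rho>) = P + d * int 0" "Max (diag ` \<rho>) = P + w - 1 + d * int k"
      using True \<theta>_range by simp_all
    moreover have "0 \<in> opens \<N> k" "k \<in> closes \<N> k" by (simp_all add: opens_def closes_def)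
    ultimately show ?thesis by blast
  next
    case False
    then have \<rho>': "\<rho> \<in> decomposition x D - {\<theta>}" using \<rho> by simp
    from ranges[OF this] show ?thesis
    proof (elim disjE exE conjE)
      fix i j assume ij: "1 \<le> i" "i < j" "j < k" "spans_copies m \<alpha> \<theta> \<rho> i j"
      then have "i \<in> opens \<N> k" "j \<in> closes \<N> k"
        using copies[OF ij(1-3) \<rho>' ij(4)] by (simp_all add: opens_def closes_def)
      then show ?thesis using spans_copies_range[OF ij(1,2) less_imp_le[OF ij(3)] \<theta>_eq H ij(4)] by blast
    next
      fix i assume i: "1 \<le> i" "i < k" "spans_intersection m \<alpha> \<theta> \<rho> i"
      then have "i \<in> opens \<N> k" "i \<in> closes \<N> k"
        using slash[OF i(1,2) \<rho>' i(3)] by (simp_all add: opens_def closes_def)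
      then show ?thesis using spans_intersection_range[OF i(1,2) \<theta>_eq H i(3)] by blast
    qed
  qed
  have starts: "diag_starts D = (\<lambda>i. P + d * int i) ` opens \<N> k"
    unfolding decomposition_range(1)[OF D, of x, symmetric]
  proof (intro subset_antisym subsetI)
    fix a assume "a \<in> (\<lambda>i. P + d * int i) ` opens \<N> k"
    then obtain i where i: "i \<in> opens \<N> k" "a = P + d * int i" by blast
    then consider "i = 0" | "i \<in> {1..<k}" "\<N> ! (i - 1) = LParen" | "i \<in> {1..<k}" "\<N> ! (i - 1) = Slash"
      by (auto simp: opens_def)
    then show "a \<in> (\<lambda>\<rho>. Min (diag ` \<rho>)) ` decomposition x D"
    proof cases
      case 1
      then show ?thesis using \<theta> \<theta>_range i by force
    next
      case 2
      then obtain \<rho> j where "\<rho> \<in> decomposition x D" "i < j" "j < k" "spans_copies m \<alpha> \<theta> \<rho> i j"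
        using letters[of i LParen] by auto
      then show ?thesis using spans_copies_range(1)[OF _ _ _ \<theta>_eq H, of i j \<rho>] 2 i by force
    next
      case 3
      then obtain \<rho> where "\<rho> \<in> decomposition x D" "spans_intersection m \<alpha> \<theta> \<rho> i"
        using letters[of i Slash] by auto
      then show ?thesis using spans_intersection_range(1)[OF _ _ \<theta>_eq H, of i \<rho>] 3 i by force
    qed
  qed (use ends_of in blast)
  have ends: "diag_ends D = (\<lambda>j. P + w - 1 + d * int j) ` closes \<N> k"
    unfolding decomposition_range(2)[OF D, of x, symmetric]
  proof (intro subset_antisym subsetI)
    fix a assume "a \<in> (\<lambda>j. P + w - 1 + d * int j) ` closes \<N> k"
    then obtain j where j: "j \<in> closes \<N> k" "a = P + w - 1 + d * int j" by blast
    then consider "j = k" | "j \<in> {1..<k}" "\<N> ! (j - 1) = RParen" | "j \<in> {1..<k}" "\<N> ! (j - 1) = Slash"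
      by (auto simp: closes_def)
    then show "a \<in> (\<lambda>\<rho>. Max (diag ` \<rho>)) ` decomposition x D"
    proof cases
      case 1
      then show ?thesis using \<theta> \<theta>_range j by force
    next
      case 2
      then obtain \<rho> i where "\<rho> \<in> decomposition x D" "1 \<le> i" "i < j" "spans_copies m \<alpha> \<theta> \<rho> i j"
        using letters[of j RParen] by auto
      then show ?thesis using spans_copies_range(2)[OF _ _ _ \<theta>_eq H, of i j \<rho>] 2 j by force
    next
      case 3
      then obtain \<rho> where "\<rho> \<in> decomposition x D" "spans_intersection m \<alpha> \<theta> \<rho> j"
        using letters[of j Slash] by auto
      then show ?thesis using spans_intersection_range(2)[OF _ _ \<theta>_eq H, of j \<rho>] 3 j by force
    qed
  qed (use ends_of in blast)
  show ?thesis
    by (rule that[OF D k len P_def _ starts ends]) (use border \<theta>_eq H_def in simp)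
qed

lemma goes_east_path:
  assumes "diag_path H" "p \<le> c" "c < q"
  shows "goes_east (H ` {p..q}) c \<longleftrightarrow> H (c + 1) = H c + (0, 1)"
proof
  assume "goes_east (H ` {p..q}) c"
  then obtain i where "(i, i + c) \<in> H ` {p..q}" "(i, i + c + 1) \<in> H ` {p..q}" by (auto simp: goes_east_def)
  then have "(i, i + c) = H (diag (i, i + c))" "(i, i + c + 1) = H (diag (i, i + c + 1))"
    using diag_path_mem[OF assms(1)] by blast+
  then have "H c = (i, i + c)" "H (c + 1) = (i, i + c + 1)" by simp_all
  then show "H (c + 1) = H c + (0, 1)" by simp
next
  assume east: "H (c + 1) = H c + (0, 1)"
  have "diag (H c) = c" using assms(1) by (simp add: diag_path_def)
  then have "H c = (fst (H c), fst (H c) + c)" by (simp add: diag_def prod_eq_iff)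
  moreover from this east have "H (c + 1) = (fst (H c), fst (H c) + c + 1)" by (metis add_Pair add_0_right)
  moreover have "H c \<in> H ` {p..q}" "H (c + 1) \<in> H ` {p..q}" using assms by auto
  ultimately show "goes_east (H ` {p..q}) c" unfolding goes_east_def by metis
qed

theorem staircase_reverse:
  assumes S: "is_staircase x \<alpha> m k \<N> D" and S': "is_staircase x \<alpha> m k (reverse_nesting \<N>) D'"
  shows "D \<sim> D'"
proof -
  obtain u P where D: "connected_shape D" and k: "1 \<le> k" and len: "length \<N> = k - 1" and P: "P = L + diag u"
    and border: "border x D = (\<lambda>c. G (c - diag u) + u) ` {P..P + w + d * int k - 1}"
    and starts: "diag_starts D = (\<lambda>i. P + d * int i) ` opens \<N> k"
    and ends: "diag_ends D = (\<lambda>j. P + w - 1 + d * int j) ` closes \<N> k"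
    by (rule staircase_data[OF S])
  obtain u' P' where D': "connected_shape D'" and "1 \<le> k" "length (reverse_nesting \<N>) = k - 1"
    and P': "P' = L + diag u'"
    and border': "border x D' = (\<lambda>c. G (c - diag u') + u') ` {P'..P' + w + d * int k - 1}"
    and starts': "diag_starts D' = (\<lambda>i. P' + d * int i) ` opens (reverse_nesting \<N>) k"
    and ends': "diag_ends D' = (\<lambda>j. P' + w - 1 + d * int j) ` closes (reverse_nesting \<N>) k"
    by (rule staircase_data[OF S'])
  \<comment> \<open>With this constant the start \<open>P + d * i\<close> is reflected to
    \<open>P' + w - 1 + d * (k - i)\<close>, the end of copy \<open>k - i\<close>, and the end
    \<open>P + w - 1 + d * j\<close> to the start \<open>P' + d * (k - j)\<close>.\<close>
  define \<kappa> where "\<kappa> = P + P' + w - 1 + d * int k"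
  have opens: "i \<le> k" if "i \<in> opens \<N> k" for i using that by (auto simp: opens_def)
  have closes: "j \<le> k" if "j \<in> closes \<N> k" for j using that by (auto simp: closes_def)
  have step: "goes_east ((\<lambda>c. G (c - diag u) + u) ` {P..P + w + d * int k - 1}) c \<longleftrightarrow>
      G (c - P + L + 1) = G (c - P + L) + (0, 1)"
    if "P = L + diag u" and c: "P \<le> c" "c < P + w + d * int k - 1" for u P c
  proof -
    have "c + 1 - diag u = c - P + L + 1" "c - diag u = c - P + L" using that(1) by simp_all
    then show ?thesis
      unfolding goes_east_path[OF diag_path_translate[OF path] c] by (simp add: algebra_simps)
  qed
  show ?thesis
  proof (rule schur_equivalent_reflect[OF D D', where \<kappa> = \<kappa> and x = x])
    show "diag_starts D' = (\<lambda>x. \<kappa> - x) ` diag_ends D"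
      unfolding starts' ends opens_reverse[OF len k] image_image
      by (intro image_cong) (auto simp: \<kappa>_def of_nat_diff closes algebra_simps)
    show "diag_ends D' = (\<lambda>x. \<kappa> - x) ` diag_starts D"
      unfolding ends' starts opens_reverse[OF len k] image_image
      by (intro image_cong) (auto simp: \<kappa>_def of_nat_diff opens algebra_simps)
    fix a b c assume a: "a \<in> diag_starts D" and b: "b \<in> diag_ends D" and c: "a \<le> c" "c < b"
    obtain i where i: "i \<le> k" "a = P + d * int i" using a opens unfolding starts by blast
    obtain j where j: "j \<le> k" "b = P + w - 1 + d * int j" using b closes unfolding ends by blast
    have bounds: "0 \<le> d * int i" "d * int i \<le> d * int k" "0 \<le> d * int j" "d * int j \<le> d * int k"
      using d_pos i j by (auto intro!: mult_left_mono)
    \<comment> \<open>Apart from the change of base point from \<open>P\<close> to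
      \<open>P'\<close>, the path is moved by \<open>e\<close> periods. This number is negative if
      \<open>i + j\<close> exceeds \<open>k\<close>, which is why \<open>periodic_scale\<close>
      covers all integers.\<close>
    define e where "e = int k - int i - int j"
    have de: "d * e = d * int k - d * int i - d * int j" by (simp add: e_def algebra_simps)
    have shift: "c + (\<kappa> - a - b) = c + P' - P + e * d"
      using i j de by (simp add: \<kappa>_def mult.commute)
    have G: "G (y + e * d) = G y + scale e v" for y by (rule periodic_scale) (rule periodic)
    have "goes_east (border x D') (c + P' - P + e * d) \<longleftrightarrow>
        G ((c + P' - P + e * d) - P' + L + 1) = G ((c + P' - P + e * d) - P' + L) + (0, 1)"
      unfolding border' by (rule step[OF P']) (use c i j bounds de mult.commute[of e d] in linarith)+
    moreover have "(c + P' - P + e * d) - P' + L + 1 = (c - P + L + 1) + e * d"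
      "(c + P' - P + e * d) - P' + L = (c - P + L) + e * d" by simp_all
    ultimately have "goes_east (border x D') (c + (\<kappa> - a - b)) \<longleftrightarrow>
        G ((c - P + L + 1) + e * d) = G ((c - P + L) + e * d) + (0, 1)"
      unfolding shift by (simp only:)
    also have "\<dots> \<longleftrightarrow> G (c - P + L + 1) = G (c - P + L) + (0, 1)"
      unfolding G by (simp add: algebra_simps)
    also have "\<dots> \<longleftrightarrow> goes_east (border x D) c"
      unfolding border using step[OF P, of c] c i j bounds by simp
    finally show "goes_east (border x D') (c + (\<kappa> - a - b)) = goes_east (border x D) c" .
  qed
qed

end

theorem theorem7p30:
  fixes \<alpha> D D' :: diagram and m k :: nat and \<N> :: "letter list" and x :: side
  assumes "ribbon \<alpha>" and "1 \<le> m" and "m < num_rows \<alpha>"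
    and "is_staircase x \<alpha> m k \<N> D"
    and "is_staircase x \<alpha> m k (reverse_nesting \<N>) D'"
  shows "D \<sim> D'"
proof -
  have "nontrivial_self_intersection m \<alpha>"
    using assms(4) by (simp add: is_staircase_def ribbon_staircase_decomposition_def)
  then obtain G L d w v where "staircase_path \<alpha> m G L d w v"
    using staircase_path_exists[OF assms(1) _ assms(2,3)] by blast
  then show ?thesis using staircase_path.staircase_reverse assms(4,5) by blast
qed

end
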